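(* There is an algorithm which, given an integer $d\ge 1$ and a matrix $\varphi\in GL(d,\mathbb{Z})$, decides whether the mapping torus $G=\mathbb{Z}^d\rtimes_\varphi\mathbb{Z}$ has rank $2$ or not.
   Context: For a group $A$ and $\varphi\in \mathrm{Aut}(A)$, the mapping torus is $A\rtimes_\varphi\mathbb{Z}=\langle A,t\mid tat^{-1}=\varphi(a)\ (a\in A)\rangle$. The rank of a finitely generated group is the minimum cardinality of a generating set. *)

theory Defs
  imports
    "HOL-Library.Nat_Bijection"
    "HOL-Algebra.Generated_Groups"
    "HOL-Algebra.Bij"
    "Jordan_Normal_Form.Matrix"
begin

section \<open>Algorithms\<close>

text \<open>
  Algorithms are Kleene's partial recursive functions, presented as programs with a
  big-step semantics: \<open>computes p xs y\<close> means that program \<open>p\<close> halts on the argument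
  list \<open>xs\<close> with result \<open>y\<close>.
\<close>

datatype recf =
    Zero
  | Succ
  | Proj nat
  | Comp recf "recf list"
  | Prec recf recf
  | Mu recf

inductive computes :: "recf \<Rightarrow> nat list \<Rightarrow> nat \<Rightarrow> bool" where
  Zero: "computes Zero xs 0"
| Succ: "computes Succ [x] (Suc x)"
| Proj: "i < length xs \<Longrightarrow> computes (Proj i) xs (xs ! i)"
| Comp: "list_all2 (\<lambda>g y. computes g xs y) gs ys \<Longrightarrow> computes f ys z \<Longrightarrow> computes (Comp f gs) xs z"
| Prec_0: "computes f xs y \<Longrightarrow> computes (Prec f g) (0 # xs) y"
| Prec_Suc: "computes (Prec f g) (n # xs) y \<Longrightarrow> computes g (n # y # xs) z
    \<Longrightarrow> computes (Prec f g) (Suc n # xs) z"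
| Mu: "computes f (n # xs) 0 \<Longrightarrow> (\<And>m. m < n \<Longrightarrow> \<exists>y. computes f (m # xs) (Suc y))
    \<Longrightarrow> computes (Mu f) xs n"

inductive_cases computes_elims:
  "computes Zero xs y" "computes Succ xs y" "computes (Proj i) xs y" "computes (Comp f gs) xs y"
  "computes (Prec f g) xs y" "computes (Mu f) xs y"

lemma computes_deterministic:
  assumes "computes p xs y" and "computes p xs z"
  shows "y = z"
  using assms
proof (induction arbitrary: z rule: computes.induct)
  case (Comp xs gs ys f z z')
  from Comp.prems obtain us where us: "list_all2 (\<lambda>g y. computes g xs y) gs us" "computes f us z'"
    by (auto elim: computes_elims)
  have "ys = us"
    using Comp.IH(1) us(1) by (auto simp: list_all2_conv_all_nth intro!: nth_equalityI)
  with us(2) Comp.IH(2) show ?case by simp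
next
  case (Prec_0 f xs y g)
  from Prec_0.prems have "computes f xs z" by (cases) auto
  with Prec_0.IH show ?case by simp
next
  case (Prec_Suc f g n xs y z z')
  from Prec_Suc.prems obtain u where "computes (Prec f g) (n # xs) u" "computes g (n # u # xs) z'"
    by cases auto
  with Prec_Suc.IH show ?case by metis
next
  case (Mu f n xs z)
  from Mu.prems have z: "computes f (z # xs) 0" "\<And>m. m < z \<Longrightarrow> \<exists>y. computes f (m # xs) (Suc y)"
    by (cases; simp)+
  show ?case
  proof (cases n z rule: linorder_cases)
    case less
    with z(2) obtain y where "computes f (n # xs) (Suc y)" by blast
    with Mu.IH(1) show ?thesis by force
  next
    case greater
    with Mu.IH(2) obtain y where "\<And>w. computes f (z # xs) w \<longrightarrow> Suc y = w" by blast
    with z(1) show ?thesis by force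
  qed
qed (erule computes_elims; simp)+

text \<open>Row-wise code of an integer matrix as a natural number.\<close>

definition mat_encode :: "int mat \<Rightarrow> nat" where
  "mat_encode A = list_encode (map (\<lambda>row. list_encode (map int_encode row)) (mat_to_list A))"

lemma mat_encode_inject:
  assumes "A \<in> carrier_mat d d" "B \<in> carrier_mat d d" "mat_encode A = mat_encode B"
  shows "A = B"
proof -
  have "inj (map int_encode)" by (rule inj_mapI[OF inj_int_encode])
  then have "inj (\<lambda>row. list_encode (map int_encode row))"
    by (intro injI) (metis injD list_encode_inverse)
  then have inj: "inj (map (\<lambda>row. list_encode (map int_encode row)))"
    by (rule inj_mapI)
  have "map (\<lambda>row. list_encode (map int_encode row)) (mat_to_list A)
      = map (\<lambda>row. list_encode (map int_encode row)) (mat_to_list B)"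
    using assms(3) unfolding mat_encode_def by (metis list_encode_inverse)
  then have eq: "mat_to_list A = mat_to_list B" by (rule injD[OF inj])
  have "A $$ (i, j) = B $$ (i, j)" if "i < d" "j < d" for i j
  proof -
    have "mat_to_list A ! i ! j = A $$ (i, j)" "mat_to_list B ! i ! j = B $$ (i, j)"
      using assms(1,2) that by (auto simp: mat_to_list_def)
    then show ?thesis unfolding eq by (rule trans[OF sym])
  qed
  with assms(1,2) show ?thesis by (intro eq_matI) auto
qed


section \<open>Mapping tori and rank\<close>

text \<open>
  The semidirect product of a group \<open>A\<close> with the integers along an automorphism \<open>\<phi>\<close>;
  the pair \<open>(a, m)\<close> stands for \<open>a t\<^sup>m\<close>.
\<close>

definition mapping_torus :: "('a, 'b) monoid_scheme \<Rightarrow> ('a \<Rightarrow> 'a) \<Rightarrow> ('a \<times> int) monoid" where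
  "mapping_torus A \<phi> =
    \<lparr>carrier = carrier A \<times> UNIV,
     monoid.mult = (\<lambda>(a, m) (b, n). (a \<otimes>\<^bsub>A\<^esub> (\<phi> [^]\<^bsub>AutoGroup A\<^esub> m) b, m + n)),
     one = (\<one>\<^bsub>A\<^esub>, 0)\<rparr>"

lemma (in group) auto_int_pow:
  assumes "\<phi> \<in> auto G"
  shows "\<phi> [^]\<^bsub>AutoGroup G\<^esub> (m::int) \<in> auto G"
    and "a \<in> carrier G \<Longrightarrow> (\<phi> [^]\<^bsub>AutoGroup G\<^esub> (m + n)) a
      = (\<phi> [^]\<^bsub>AutoGroup G\<^esub> m) ((\<phi> [^]\<^bsub>AutoGroup G\<^esub> (n::int)) a)"
    and "a \<in> carrier G \<Longrightarrow> (\<phi> [^]\<^bsub>AutoGroup G\<^esub> (0::int)) a = a"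
    and "\<phi> [^]\<^bsub>AutoGroup G\<^esub> (1::int) = \<phi>"
proof -
  interpret Au: group "AutoGroup G" by (rule AutoGroup)
  have phi: "\<phi> \<in> carrier (AutoGroup G)" using assms by (simp add: AutoGroup_def)
  have closed: "\<phi> [^]\<^bsub>AutoGroup G\<^esub> (k::int) \<in> auto G" for k
    using Au.int_pow_closed[OF phi] by (simp add: AutoGroup_def)
  show "\<phi> [^]\<^bsub>AutoGroup G\<^esub> (m::int) \<in> auto G" by (rule closed)
  have Bij: "\<phi> [^]\<^bsub>AutoGroup G\<^esub> (k::int) \<in> Bij (carrier G)" for k
    using closed by (simp add: auto_def)
  show "(\<phi> [^]\<^bsub>AutoGroup G\<^esub> (m + n)) a
      = (\<phi> [^]\<^bsub>AutoGroup G\<^esub> m) ((\<phi> [^]\<^bsub>AutoGroup G\<^esub> (n::int)) a)" if "a \<in> carrier G"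
  proof -
    have "\<phi> [^]\<^bsub>AutoGroup G\<^esub> (m + n)
        = \<phi> [^]\<^bsub>AutoGroup G\<^esub> m \<otimes>\<^bsub>BijGroup (carrier G)\<^esub> \<phi> [^]\<^bsub>AutoGroup G\<^esub> n"
      using Au.int_pow_mult[OF phi, of m n] by (simp add: AutoGroup_def)
    then show ?thesis using that Bij by (simp add: BijGroup_def compose_def)
  qed
  show "(\<phi> [^]\<^bsub>AutoGroup G\<^esub> (0::int)) a = a" if "a \<in> carrier G"
    using that by (simp add: AutoGroup_def BijGroup_def)
  show "\<phi> [^]\<^bsub>AutoGroup G\<^esub> (1::int) = \<phi>" using phi by simp
qed

lemma auto_closed: "f \<in> auto G \<Longrightarrow> a \<in> carrier G \<Longrightarrow> f a \<in> carrier G"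
  by (auto simp: auto_def hom_def)

lemma auto_mult: "f \<in> auto G \<Longrightarrow> a \<in> carrier G \<Longrightarrow> b \<in> carrier G
    \<Longrightarrow> f (a \<otimes>\<^bsub>G\<^esub> b) = f a \<otimes>\<^bsub>G\<^esub> f b"
  by (auto simp: auto_def hom_def)

lemma (in group) auto_one: "f \<in> auto G \<Longrightarrow> f \<one> = \<one>"
  using hom_one[of f G G] is_group by (simp add: auto_def)

lemma mapping_torus_simps:
  "carrier (mapping_torus A \<phi>) = carrier A \<times> UNIV"
  "(a, m) \<otimes>\<^bsub>mapping_torus A \<phi>\<^esub> (b, n)
    = (a \<otimes>\<^bsub>A\<^esub> (\<phi> [^]\<^bsub>AutoGroup A\<^esub> m) b, m + n)"
  "\<one>\<^bsub>mapping_torus A \<phi>\<^esub> = (\<one>\<^bsub>A\<^esub>, 0)"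
  by (simp_all add: mapping_torus_def)

lemma (in group) group_mapping_torus:
  assumes "\<phi> \<in> auto G"
  shows "group (mapping_torus G \<phi>)"
proof (rule groupI, goal_cases)
  case (1 x y)
  then show ?case
    by (cases x; cases y)
      (simp add: mapping_torus_simps auto_closed[OF auto_int_pow(1)[OF assms]])
next
  case 2
  show ?case by (simp add: mapping_torus_simps)
next
  case (3 x y z)
  then show ?case
    by (cases x; cases y; cases z)
      (simp add: mapping_torus_simps auto_mult[OF auto_int_pow(1)[OF assms]]
        auto_closed[OF auto_int_pow(1)[OF assms]] auto_int_pow(2)[OF assms] m_assoc)
next
  case (4 x)
  then show ?case
    by (cases x) (auto simp: mapping_torus_simps auto_int_pow(3)[OF assms] simp del: int_pow_0)
next
  case (5 x)
  obtain a m where x: "x = (a, m)" "a \<in> carrier G"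
    using 5 by (cases x) (auto simp: mapping_torus_simps)
  let ?b = "(\<phi> [^]\<^bsub>AutoGroup G\<^esub> (- m)) (inv a)"
  have "(\<phi> [^]\<^bsub>AutoGroup G\<^esub> (- m)) (inv a) \<otimes> (\<phi> [^]\<^bsub>AutoGroup G\<^esub> (- m)) a = \<one>"
    using x by (simp flip: auto_mult[OF auto_int_pow(1)[OF assms]]
        add: auto_one[OF auto_int_pow(1)[OF assms]])
  then have "(?b, - m) \<otimes>\<^bsub>mapping_torus G \<phi>\<^esub> x = \<one>\<^bsub>mapping_torus G \<phi>\<^esub>"
    using x by (simp add: mapping_torus_simps del: int_pow_0)
  moreover have "(?b, - m) \<in> carrier (mapping_torus G \<phi>)"
    using x by (simp add: mapping_torus_simps auto_closed[OF auto_int_pow(1)[OF assms]])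
  ultimately show ?case by blast
qed

text \<open>The defining relation \<open>t a t\<^sup>-\<^sup>1 = \<phi> a\<close>, with \<open>t = (1, 1)\<close>.\<close>

lemma (in group) mapping_torus_relation:
  assumes "\<phi> \<in> auto G" "a \<in> carrier G"
  shows "(\<one>, 1) \<otimes>\<^bsub>mapping_torus G \<phi>\<^esub> (a, 0) \<otimes>\<^bsub>mapping_torus G \<phi>\<^esub> inv\<^bsub>mapping_torus G \<phi>\<^esub> (\<one>, 1)
    = (\<phi> a, 0)"
proof -
  interpret T: group "mapping_torus G \<phi>" by (rule group_mapping_torus[OF assms(1)])
  have t: "(\<one>, 1) \<in> carrier (mapping_torus G \<phi>)" "(a, 0) \<in> carrier (mapping_torus G \<phi>)"
    "(\<phi> a, 0) \<in> carrier (mapping_torus G \<phi>)"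
    using assms by (simp_all add: mapping_torus_simps auto_closed[OF assms(1)])
  have "(\<one>, 1) \<otimes>\<^bsub>mapping_torus G \<phi>\<^esub> (a, 0) = (\<phi> a, 0) \<otimes>\<^bsub>mapping_torus G \<phi>\<^esub> (\<one>, 1)"
    using assms
    by (simp add: mapping_torus_simps auto_closed[OF assms(1)] auto_int_pow(3,4) del: int_pow_0)
  then show ?thesis
    using t T.m_assoc[OF t(3,1) T.inv_closed[OF t(1)]] T.r_inv[OF t(1)] T.r_one[OF t(3)]
    by (simp only:)
qed

text \<open>The value is only meaningful for finitely generated groups.\<close>

definition group_rank :: "('a, 'b) monoid_scheme \<Rightarrow> nat" where
  "group_rank G = (LEAST n. \<exists>S \<subseteq> carrier G. finite S \<and> card S = n \<and> generate G S = carrier G)"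

definition GL_int :: "nat \<Rightarrow> int mat set" where
  "GL_int d = {A \<in> carrier_mat d d. invertible_mat A}"

text \<open>Elements of \<^const>\<open>auto\<close> are extensional, hence the restriction.\<close>

definition mat_auto :: "nat \<Rightarrow> int mat \<Rightarrow> int vec \<Rightarrow> int vec" where
  "mat_auto d A = (\<lambda>v \<in> carrier_vec d. A *\<^sub>v v)"

abbreviation int_vec_group :: "nat \<Rightarrow> int vec monoid" where
  "int_vec_group d \<equiv> monoid_vec TYPE(int) d"

lemma group_int_vec_group: "group (int_vec_group d)"
proof (rule groupI, goal_cases)
  case (5 x)
  then show ?case
    by (intro bexI[of _ "- x"]) (auto simp: monoid_vec_simps)
qed (auto simp: monoid_vec_simps)

lemma mat_auto_in_auto:
  assumes "A \<in> GL_int d"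
  shows "mat_auto d A \<in> auto (int_vec_group d)"
proof -
  have A: "A \<in> carrier_mat d d" using assms by (simp add: GL_int_def)
  obtain B where AB: "A * B = 1\<^sub>m d" and BA: "B * A = 1\<^sub>m (dim_row B)"
    using assms by (auto simp: GL_int_def invertible_mat_def inverts_mat_def)
  have "dim_col B = d" using arg_cong[OF AB, of dim_col] by simp
  moreover have "dim_row B = d" using arg_cong[OF BA, of dim_col] A by simp
  ultimately have B: "B \<in> carrier_mat d d" by auto
  have BA: "B * A = 1\<^sub>m d" using BA B by simp
  have "B *\<^sub>v (A *\<^sub>v v) = v" "A *\<^sub>v (B *\<^sub>v v) = v" if "v \<in> carrier_vec d" for v
    using that A B AB BA by (simp_all flip: assoc_mult_mat_vec)
  then have "bij_betw (mat_auto d A) (carrier_vec d) (carrier_vec d)"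
    using A B by (intro bij_betw_byWitness[where f' = "\<lambda>v. B *\<^sub>v v"]) (auto simp: mat_auto_def)
  moreover have "mat_auto d A \<in> hom (int_vec_group d) (int_vec_group d)"
    using A by (auto simp: hom_def monoid_vec_simps mat_auto_def mult_add_distrib_mat_vec)
  ultimately show ?thesis
    by (simp add: auto_def Bij_def monoid_vec_simps mat_auto_def)
qed

text \<open>The groups in question are finitely generated, so that their rank is meaningful.\<close>

lemma finitely_generated_mapping_torus_int_vec_group:
  assumes "A \<in> GL_int d"
  defines "T \<equiv> mapping_torus (int_vec_group d) (mat_auto d A)"
  shows "\<exists>S \<subseteq> carrier T. finite S \<and> generate T S = carrier T"
proof -
  let ?Z = "int_vec_group d"
  interpret Z: group ?Z by (rule group_int_vec_group)
  note phi = mat_auto_in_auto[OF assms(1)]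
  interpret T: group T unfolding T_def by (rule Z.group_mapping_torus[OF phi])
  note simps = mapping_torus_simps[of ?Z "mat_auto d A", folded T_def]
  let ?e = "\<lambda>i. (unit_vec d i :: int vec, 0 :: int)"
  let ?t = "(0\<^sub>v d :: int vec, 1 :: int)"
  let ?S = "insert ?t (?e ` {..<d})"
  have S: "?S \<subseteq> carrier T" by (auto simp: simps monoid_vec_simps)
  have sub: "subgroup (generate T ?S) T" by (rule T.generate_is_subgroup[OF S])
  have mult0: "(v, 0) \<otimes>\<^bsub>T\<^esub> (w, n) = (v + w, n)" if "v \<in> carrier_vec d" "w \<in> carrier_vec d" for v w n
    using that Z.auto_int_pow(3)[OF phi, of w] by (simp add: simps monoid_vec_simps)
  have phi0: "(mat_auto d A [^]\<^bsub>AutoGroup ?Z\<^esub> m) (0\<^sub>v d) = 0\<^sub>v d" for m :: int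
    using Z.auto_one[OF Z.auto_int_pow(1)[OF phi, of m]] by (simp add: monoid_vec_simps)
  have one: "\<one>\<^bsub>T\<^esub> = (0\<^sub>v d, 0)" by (simp add: simps monoid_vec_simps)
  have inv_t: "inv\<^bsub>T\<^esub> (0\<^sub>v d, int n) = (0\<^sub>v d, - int n)" for n
    by (rule T.inv_equality) (simp_all add: one simps phi0, simp_all add: monoid_vec_simps)
  have t_pow: "(0\<^sub>v d, m) \<in> generate T ?S" for m
  proof -
    have pos: "(0\<^sub>v d, int n) \<in> generate T ?S" for n
    proof (induction n)
      case 0
      then show ?case using subgroup.one_closed[OF sub] by (simp add: one)
    next
      case (Suc n)
      have "(0\<^sub>v d, int n) \<otimes>\<^bsub>T\<^esub> ?t \<in> generate T ?S"
        by (rule subgroup.m_closed[OF sub Suc]) (auto intro: generate.incl)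
      then show ?case
        by (simp add: simps phi0, simp add: monoid_vec_simps add.commute)
    qed
    show ?thesis
    proof (cases "m \<ge> 0")
      case True
      then show ?thesis using pos[of "nat m"] by simp
    next
      case False
      then show ?thesis
        using subgroup.m_inv_closed[OF sub pos[of "nat (- m)"]] inv_t[of "nat (- m)"] by simp
    qed
  qed
  have inv0: "inv\<^bsub>T\<^esub> (v, 0) = (- v, 0)" if "v \<in> carrier_vec d" for v
    using that by (intro T.inv_equality) (simp_all add: mult0 one, simp_all add: simps monoid_vec_simps)
  have multiple: "(c \<cdot>\<^sub>v unit_vec d i, 0) \<in> generate T ?S" if "i < d" for c i
  proof -
    have pos: "(int n \<cdot>\<^sub>v unit_vec d i, 0) \<in> generate T ?S" for n
    proof (induction n)
      case 0
      have "(0::int) \<cdot>\<^sub>v unit_vec d i = 0\<^sub>v d" by (intro eq_vecI) auto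
      then show ?case using subgroup.one_closed[OF sub] by (simp add: one)
    next
      case (Suc n)
      have "(int n \<cdot>\<^sub>v unit_vec d i, 0) \<otimes>\<^bsub>T\<^esub> ?e i \<in> generate T ?S"
        using that by (intro subgroup.m_closed[OF sub Suc]) (auto intro: generate.incl)
      moreover have "int n \<cdot>\<^sub>v unit_vec d i + unit_vec d i = int (Suc n) \<cdot>\<^sub>v unit_vec d i"
        by (intro eq_vecI) (auto simp: algebra_simps)
      ultimately show ?case by (simp add: mult0)
    qed
    show ?thesis
    proof (cases "c \<ge> 0")
      case True
      then show ?thesis using pos[of "nat c"] by simp
    next
      case False
      have "- (int (nat (- c)) \<cdot>\<^sub>v unit_vec d i) = c \<cdot>\<^sub>v unit_vec d i"
        using False by (intro eq_vecI) auto
      then show ?thesis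
        using subgroup.m_inv_closed[OF sub pos[of "nat (- c)"]] by (simp add: inv0)
    qed
  qed
  have vecs: "(v, 0) \<in> generate T ?S" if v: "v \<in> carrier_vec d" for v
  proof -
    have partial: "(vec d (\<lambda>i. if i < k then v $ i else 0), 0) \<in> generate T ?S" if "k \<le> d" for k
      using that
    proof (induction k)
      case 0
      have "vec d (\<lambda>i. 0) = (0\<^sub>v d :: int vec)" by auto
      then show ?case using subgroup.one_closed[OF sub] by (simp add: one)
    next
      case (Suc k)
      have "vec d (\<lambda>i. if i < k then v $ i else 0) + v $ k \<cdot>\<^sub>v unit_vec d k
          = vec d (\<lambda>i. if i < Suc k then v $ i else 0)"
        using Suc.prems by (intro eq_vecI) (auto simp: less_Suc_eq unit_vec_def)
      moreover have "(vec d (\<lambda>i. if i < k then v $ i else 0), 0)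
          \<otimes>\<^bsub>T\<^esub> (v $ k \<cdot>\<^sub>v unit_vec d k, 0) \<in> generate T ?S"
        using Suc by (intro subgroup.m_closed[OF sub] multiple) auto
      ultimately show ?case by (simp add: mult0)
    qed
    have "vec d (\<lambda>i. if i < d then v $ i else 0) = v"
      using v by (intro eq_vecI) auto
    then show ?thesis using partial[of d] by (simp only: order_refl)
  qed
  have "(v, m) \<in> generate T ?S" if v: "v \<in> carrier_vec d" for v m
    using subgroup.m_closed[OF sub vecs[OF v] t_pow[of m]] v by (simp add: mult0)
  then have "carrier T \<subseteq> generate T ?S" by (auto simp: simps monoid_vec_simps)
  with S show ?thesis
    using T.generate_incl[OF S] by (intro exI[of _ ?S] conjI subset_antisym) simp_all
qed

end

theory Submission
  imports Defs "Jordan_Normal_Form.Char_Poly" "HOL-Algebra.Zassenhaus"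
begin

text \<open>
  The mapping torus of \<open>\<phi>\<close> is generated by two elements iff \<open>\<int>\<^sup>d\<close> is a cyclic module over \<open>\<int>[x]\<close>, where
  \<open>x\<close> acts as \<open>\<phi>\<close>: by the Euclidean algorithm the generators can be taken as \<open>(a, m)\<close> and \<open>(b, 0)\<close>,
  and then the elements \<open>\<phi>\<^sup>i b\<close> span \<open>\<int>\<^sup>d\<close>. It remains to show that some generator of a cyclic module
  is bounded computably in terms of \<open>d\<close> and the entries of \<open>\<phi>\<close>, so that a bounded search decides.

  Let \<open>\<chi>\<close> be the characteristic polynomial and \<open>Q\<^sub>z = \<chi> / (x - z)\<close> for a root \<open>z\<close> of \<open>\<chi>\<close>. A unit \<open>u\<close> of
  \<open>\<int>[x] / \<chi>\<close> maps generators to generators and multiplies \<open>Q\<^sub>z(\<phi>) v\<close> by \<open>u(z)\<close>. Each irreducible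
  factor \<open>f\<close> of \<open>\<chi>\<close> has a root \<open>j\<close> at which \<open>Q\<^sub>j(\<phi>) v\<close> is small, because norms of nonzero algebraic
  integers are at least 1. Multiplying by a unit that is less than 1 at all roots of \<open>f\<close> except \<open>j\<close> and its
  conjugate, bounded at these two, and 1 at the other roots of \<open>\<chi>\<close>, makes all \<open>Q\<^sub>z(\<phi>) v\<close> small after
  finitely many steps. Such units, with an explicit bound, come from Dirichlet's pigeonhole argument.
  Then \<open>\<chi>'(\<phi>) v = \<Sum> Q\<^sub>z(\<phi>) v\<close>, the sum over the roots with multiplicity, is small too. It determines
  \<open>v\<close> up to a unipotent unit, so every integer vector with the same image is again a generator, and a
  solvable system of integer linear equations has a bounded solution.
\<close>

section \<open>Recursive functions\<close>

text \<open>A generator can be confirmed by exhibiting it, but its absence cannot; hence the need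
  for a bound. The obstacle is that units of \<open>\<int>[x] / \<chi>\<close> can turn one
  generator into infinitely many, of unbounded size, so only a suitable representative can be small.
  The vectors \<open>Q\<^sub>z(\<phi>) v\<close> serve as coordinates: each lies in an eigenspace,
  and polynomials act on it by scalars. At a multiple root they see \<open>v\<close> only modulo
  nilpotents, which is why \<open>\<chi>'\<close> and unipotent units come in. Roots, units and the
  number of reduction steps occur in the correctness proof alone; the program never computes them.
  What has to be explicit is the size of a single unit: each step brings the coordinates where the
  unit may be large below a fixed bound and contracts the others, so the final size does not depend
  on how many steps were made. The resulting bound is built from sums, products, powers and
  factorials, so that a program can evaluate it.\<close>

definition recursive :: "nat \<Rightarrow> (nat list \<Rightarrow> nat) \<Rightarrow> bool" where
  "recursive n f \<longleftrightarrow> (\<exists>p. \<forall>xs. length xs = n \<longrightarrow> computes p xs (f xs))"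

lemma recursive_cong:
  "recursive n f \<Longrightarrow> (\<And>xs. length xs = n \<Longrightarrow> f xs = g xs) \<Longrightarrow> recursive n g"
  unfolding recursive_def by metis

lemma recursive_proj: "i < n \<Longrightarrow> recursive n (\<lambda>xs. xs ! i)"
  unfolding recursive_def by (metis computes.Proj)

lemma recursive_compose:
  assumes "recursive (length gs) f" and gs: "\<And>g. g \<in> set gs \<Longrightarrow> recursive n g"
  shows "recursive n (\<lambda>xs. f (map (\<lambda>g. g xs) gs))"
proof -
  obtain p where p: "\<And>xs. length xs = length gs \<Longrightarrow> computes p xs (f xs)"
    using assms(1) unfolding recursive_def by blast
  obtain P where P: "\<And>g xs. g \<in> set gs \<Longrightarrow> length xs = n \<Longrightarrow> computes (P g) xs (g xs)"
    using gs unfolding recursive_def by metis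
  have "computes (Comp p (map P gs)) xs (f (map (\<lambda>g. g xs) gs))" if "length xs = n" for xs
    using that by (intro computes.Comp[where ys = "map (\<lambda>g. g xs) gs"] p)
      (auto simp: list_all2_conv_all_nth intro: P)
  then show ?thesis unfolding recursive_def by blast
qed

lemma recursive_weaken: "recursive n f \<Longrightarrow> recursive (m + n) (\<lambda>xs. f (drop m xs))"
proof -
  assume f: "recursive n f"
  have "recursive (m + n) (\<lambda>xs. f (map (\<lambda>g. g xs) (map (\<lambda>i xs. xs ! (m + i)) [0..<n])))"
    using f by (intro recursive_compose) (auto intro!: recursive_proj)
  then show ?thesis
    by (rule recursive_cong) (auto intro!: arg_cong[where f = f] nth_equalityI)
qed

lemma recursive_0: "recursive n (\<lambda>_. 0)"
  unfolding recursive_def by (metis computes.Zero)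

lemma recursive_Suc: "recursive n f \<Longrightarrow> recursive n (\<lambda>xs. Suc (f xs))"
proof -
  assume f: "recursive n f"
  have "recursive 1 (\<lambda>xs. Suc (xs ! 0))"
    unfolding recursive_def by (intro exI[of _ Succ]) (auto simp: length_Suc_conv intro: computes.Succ)
  then show ?thesis using recursive_compose[of "[f]" "\<lambda>xs. Suc (xs ! 0)" n] f by simp
qed

lemma recursive_const: "recursive n (\<lambda>_. c)"
  by (induction c) (auto intro: recursive_0 recursive_Suc)

text \<open>\<open>Prec\<close> counts in its leading argument and hands the counter and the
  previous value to the step in front of the parameters; hence positions 0 and 1 and
  \<open>drop 2 ys\<close>. The number of rounds \<open>a xs\<close> is substituted afterwards by
  composition.\<close>

lemma recursive_rec_nat:
  assumes "recursive n a" "recursive n b"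
    and "recursive (Suc (Suc n)) (\<lambda>ys. g (ys ! 0) (ys ! 1) (drop 2 ys))"
  shows "recursive n (\<lambda>xs. rec_nat (b xs) (\<lambda>k y. g k y xs) (a xs))"
proof -
  obtain p where p: "\<And>xs. length xs = n \<Longrightarrow> computes p xs (b xs)"
    using assms(2) unfolding recursive_def by blast
  obtain q where q: "\<And>xs. length xs = Suc (Suc n) \<Longrightarrow> computes q xs (g (xs ! 0) (xs ! 1) (drop 2 xs))"
    using assms(3) unfolding recursive_def by blast
  have "computes (Prec p q) (k # xs) (rec_nat (b xs) (\<lambda>k y. g k y xs) k)" if "length xs = n" for k xs
  proof (induction k)
    case 0
    then show ?case using p that by (auto intro: computes.Prec_0)
  next
    case (Suc k)
    show ?case
      using q[of "k # rec_nat (b xs) (\<lambda>k y. g k y xs) k # xs"] that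
      by (auto intro!: computes.Prec_Suc[OF Suc])
  qed
  then have "recursive (Suc n) (\<lambda>ys. rec_nat (b (tl ys)) (\<lambda>k y. g k y (tl ys)) (hd ys))"
    unfolding recursive_def by (intro exI[of _ "Prec p q"]) (auto simp: length_Suc_conv)
  then have "recursive n (\<lambda>xs. (\<lambda>ys. rec_nat (b (tl ys)) (\<lambda>k y. g k y (tl ys)) (hd ys))
      (map (\<lambda>g. g xs) (a # map (\<lambda>i xs. xs ! i) [0..<n])))"
    by (intro recursive_compose) (use assms(1) in \<open>auto intro: recursive_proj\<close>)
  then show ?thesis
    by (rule recursive_cong) (simp add: comp_def, metis map_nth)
qed

lemma recursive_proj_drop: "m + i < n \<Longrightarrow> recursive n (\<lambda>xs. drop m xs ! i)"
  by (rule recursive_cong[OF recursive_proj[of "m + i"]]) auto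

lemma recursive_drop: "recursive k f \<Longrightarrow> n = m + k \<Longrightarrow> recursive n (\<lambda>xs. f (drop m xs))"
  using recursive_weaken by blast

lemma recursive_add:
  assumes "recursive n f" "recursive n g"
  shows "recursive n (\<lambda>xs. f xs + g xs)"
proof -
  have "recursive n (\<lambda>xs. rec_nat (f xs) (\<lambda>k y. Suc y) (g xs))"
    by (intro recursive_rec_nat recursive_Suc recursive_proj assms) simp
  moreover have "rec_nat a (\<lambda>k y. Suc y) b = a + b" for a b by (induction b) auto
  ultimately show ?thesis by simp
qed

lemma recursive_mult:
  assumes "recursive n f" "recursive n g"
  shows "recursive n (\<lambda>xs. f xs * g xs)"
proof -
  have "recursive n (\<lambda>xs. rec_nat 0 (\<lambda>k y. y + f xs) (g xs))"
    by (intro recursive_rec_nat recursive_add recursive_proj recursive_0 assms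
        recursive_drop[OF assms(1)]) simp_all
  moreover have "rec_nat 0 (\<lambda>k y. y + a) b = a * b" for a b :: nat by (induction b) auto
  ultimately show ?thesis by simp
qed

lemma recursive_power:
  assumes "recursive n f" "recursive n g"
  shows "recursive n (\<lambda>xs. f xs ^ g xs)"
proof -
  have "recursive n (\<lambda>xs. rec_nat 1 (\<lambda>k y. y * f xs) (g xs))"
    by (intro recursive_rec_nat recursive_mult recursive_proj recursive_const assms
        recursive_drop[OF assms(1)]) simp_all
  moreover have "rec_nat 1 (\<lambda>k y. y * a) b = a ^ b" for a b :: nat by (induction b) auto
  ultimately show ?thesis by simp
qed

lemma recursive_fact:
  assumes "recursive n f"
  shows "recursive n (\<lambda>xs. fact (f xs))"
proof -
  have "recursive n (\<lambda>xs. rec_nat 1 (\<lambda>k y. Suc k * y) (f xs))"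
    by (intro recursive_rec_nat recursive_mult recursive_Suc recursive_proj recursive_const assms) simp_all
  moreover have "rec_nat 1 (\<lambda>k y. Suc k * y) b = fact b" for b :: nat by (induction b) auto
  ultimately show ?thesis by simp
qed

lemma recursive_diff:
  assumes "recursive n f" "recursive n g"
  shows "recursive n (\<lambda>xs. f xs - g xs)"
proof -
  have pred: "recursive n (\<lambda>xs. h xs - 1)" if "recursive n h" for n h
  proof -
    have "recursive n (\<lambda>xs. rec_nat 0 (\<lambda>k y. k) (h xs))"
      by (intro recursive_rec_nat recursive_0 recursive_proj that) simp
    moreover have "rec_nat 0 (\<lambda>k y. k) a = a - 1" for a :: nat by (induction a) auto
    ultimately show ?thesis by simp
  qed
  have "recursive n (\<lambda>xs. rec_nat (f xs) (\<lambda>k y. y - 1) (g xs))"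
    by (intro recursive_rec_nat pred recursive_proj assms) simp
  moreover have "rec_nat a (\<lambda>k y. y - 1) b = a - b" for a b :: nat by (induction b) auto
  ultimately show ?thesis by simp
qed

text \<open>A bound variable is prepended to the argument list: the body sees it as
  \<open>ys ! 0\<close> and the outer arguments as \<open>drop 1 ys\<close>. Bounded quantifiers and
  integer sums follow the same convention.\<close>

lemma recursive_sum:
  assumes "recursive n a" and f: "recursive (Suc n) (\<lambda>ys. f (ys ! 0) (drop 1 ys))"
  shows "recursive n (\<lambda>xs. \<Sum>i<a xs. f i xs)"
proof -
  \<comment> \<open>The step of the recursion also receives the accumulator, at position 1, which
    the summand has to skip.\<close>
  have "recursive (Suc (Suc n)) (\<lambda>xs. (\<lambda>ys. f (ys ! 0) (drop 1 ys))
      (map (\<lambda>g. g xs) ((\<lambda>xs. xs ! 0) # map (\<lambda>i xs. xs ! (2 + i)) [0..<n])))"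
    using f by (intro recursive_compose) (auto intro!: recursive_proj)
  then have "recursive (Suc (Suc n)) (\<lambda>ys. f (ys ! 0) (drop 2 ys))"
  proof (rule recursive_cong)
    fix xs :: "nat list"
    assume "length xs = Suc (Suc n)"
    then have "map (\<lambda>i. xs ! Suc (Suc i)) [0..<n] = drop 2 xs"
      by (auto intro!: nth_equalityI)
    then show "(\<lambda>ys. f (ys ! 0) (drop 1 ys))
        (map (\<lambda>g. g xs) ((\<lambda>xs. xs ! 0) # map (\<lambda>i xs. xs ! (2 + i)) [0..<n])) = f (xs ! 0) (drop 2 xs)"
      by (simp add: comp_def)
  qed
  then have "recursive n (\<lambda>xs. rec_nat 0 (\<lambda>k y. y + f k xs) (a xs))"
    by (intro recursive_rec_nat recursive_add recursive_0 recursive_proj assms) auto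
  moreover have "rec_nat 0 (\<lambda>k y. y + h k) b = (\<Sum>i<b. h i)" for h :: "nat \<Rightarrow> nat" and b by (induction b) auto
  ultimately show ?thesis by simp
qed

section \<open>Decidable predicates and bounded quantifiers\<close>

definition decidable :: "nat \<Rightarrow> (nat list \<Rightarrow> bool) \<Rightarrow> bool" where
  "decidable n P \<longleftrightarrow> recursive n (\<lambda>xs. if P xs then 1 else 0)"

lemma decidable_0: "recursive n f \<Longrightarrow> decidable n (\<lambda>xs. f xs = 0)"
  unfolding decidable_def
  by (rule recursive_cong[OF recursive_diff[OF recursive_const[of n 1], of f]]) auto

lemma decidable_not: "decidable n P \<Longrightarrow> decidable n (\<lambda>xs. \<not> P xs)"
  unfolding decidable_def
  by (rule recursive_cong[OF recursive_diff[OF recursive_const[of n 1]]]) auto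

lemma decidable_conj: "decidable n P \<Longrightarrow> decidable n Q \<Longrightarrow> decidable n (\<lambda>xs. P xs \<and> Q xs)"
  unfolding decidable_def by (drule recursive_mult, assumption, erule recursive_cong) auto

lemma decidable_disj: "decidable n P \<Longrightarrow> decidable n Q \<Longrightarrow> decidable n (\<lambda>xs. P xs \<or> Q xs)"
  using decidable_not[OF decidable_conj[OF decidable_not decidable_not], of n P Q] by simp

lemma decidable_eq: "recursive n f \<Longrightarrow> recursive n g \<Longrightarrow> decidable n (\<lambda>xs. f xs = g xs)"
proof -
  assume f: "recursive n f" "recursive n g"
  have "decidable n (\<lambda>xs. (f xs - g xs) + (g xs - f xs) = 0)"
    by (intro decidable_0 recursive_add recursive_diff f)
  moreover have "((f xs - g xs) + (g xs - f xs) = 0) = (f xs = g xs)" for xs by auto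
  ultimately show ?thesis by simp
qed

lemma recursive_if:
  assumes "decidable n P" "recursive n f" "recursive n g"
  shows "recursive n (\<lambda>xs. if P xs then f xs else g xs)"
  by (rule recursive_cong[OF recursive_add[OF
        recursive_mult[OF assms(1)[unfolded decidable_def] assms(2)]
        recursive_mult[OF decidable_not[OF assms(1), unfolded decidable_def] assms(3)]]]) auto

lemma decidable_ex:
  assumes "recursive n a" "decidable (Suc n) (\<lambda>ys. P (ys ! 0) (drop 1 ys))"
  shows "decidable n (\<lambda>xs. \<exists>i<a xs. P i xs)"
proof -
  have "recursive n (\<lambda>xs. \<Sum>i<a xs. if P i xs then 1 else 0)"
    using assms by (intro recursive_sum) (auto simp: decidable_def)
  moreover have "((\<Sum>i<b. if Q i then 1 else 0) \<noteq> (0::nat)) = (\<exists>i<b. Q i)" for b :: nat and Q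
    by auto
  ultimately show ?thesis
    using decidable_not[OF decidable_0, of n "\<lambda>xs. \<Sum>i<a xs. if P i xs then 1 else 0"]
    by (simp only:)
qed

lemma decidable_all:
  assumes "recursive n a" "decidable (Suc n) (\<lambda>ys. P (ys ! 0) (drop 1 ys))"
  shows "decidable n (\<lambda>xs. \<forall>i<a xs. P i xs)"
  using decidable_not[OF decidable_ex[OF assms(1) decidable_not[OF assms(2)]]] by simp

section \<open>Integer-valued recursive functions, given by positive and negative part\<close>

definition recursive_int :: "nat \<Rightarrow> (nat list \<Rightarrow> int) \<Rightarrow> bool" where
  "recursive_int n f \<longleftrightarrow> recursive n (\<lambda>xs. nat (f xs)) \<and> recursive n (\<lambda>xs. nat (- f xs))"

lemma recursive_int_of_nat: "recursive n f \<Longrightarrow> recursive_int n (\<lambda>xs. int (f xs))"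
  unfolding recursive_int_def by (simp add: recursive_0)

lemma recursive_int_mult:
  assumes "recursive_int n f" "recursive_int n g"
  shows "recursive_int n (\<lambda>xs. f xs * g xs)"
proof -
  have *: "recursive n (\<lambda>xs. (nat (f xs) * nat (g xs) + nat (- f xs) * nat (- g xs))
      - (nat (f xs) * nat (- g xs) + nat (- f xs) * nat (g xs)))"
    "recursive n (\<lambda>xs. (nat (f xs) * nat (- g xs) + nat (- f xs) * nat (g xs))
      - (nat (f xs) * nat (g xs) + nat (- f xs) * nat (- g xs)))"
    using assms unfolding recursive_int_def
    by (intro recursive_diff recursive_add recursive_mult; simp)+
  have 1: "nat (a * b) = (nat a * nat b + nat (- a) * nat (- b))
      - (nat a * nat (- b) + nat (- a) * nat b)" for a b :: int
    by (cases "a \<ge> 0"; cases "b \<ge> 0") (auto simp flip: nat_mult_distrib simp: mult_nonneg_nonpos mult_nonpos_nonneg mult_nonpos_nonpos)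
  have 2: "nat (- (a * b)) = (nat a * nat (- b) + nat (- a) * nat b)
      - (nat a * nat b + nat (- a) * nat (- b))" for a b :: int
    using 1[of "- a" b] by (simp add: add.commute)
  show ?thesis using * unfolding recursive_int_def 1 2 by simp
qed

text \<open>Adding up positive and negative parts separately gives two naturals whose difference is
  the sum; their truncated differences in both directions are then its positive and negative
  part.\<close>

lemma recursive_int_sum:
  assumes "recursive n a" "recursive_int (Suc n) (\<lambda>ys. f (ys ! 0) (drop 1 ys))"
  shows "recursive_int n (\<lambda>xs. \<Sum>i<a xs. f i xs)"
proof -
  have *: "recursive n (\<lambda>xs. (\<Sum>i<a xs. nat (f i xs)) - (\<Sum>i<a xs. nat (- f i xs)))"
    "recursive n (\<lambda>xs. (\<Sum>i<a xs. nat (- f i xs)) - (\<Sum>i<a xs. nat (f i xs)))"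
    using assms unfolding recursive_int_def by (auto intro!: recursive_diff recursive_sum)
  have "(\<Sum>i<b. h i) = int (\<Sum>i<b. nat (h i)) - int (\<Sum>i<b. nat (- h i))"
    for h :: "nat \<Rightarrow> int" and b
    unfolding of_nat_sum sum_subtractf[symmetric] by (intro sum.cong) auto
  moreover have "nat z = p - q \<and> nat (- z) = q - p" if "z = int p - int q" for z p q
    using that by (simp only: minus_diff_eq nat_minus_as_int)
  ultimately have "nat (\<Sum>i<b. h i) = (\<Sum>i<b. nat (h i)) - (\<Sum>i<b. nat (- h i))"
    "nat (- (\<Sum>i<b. h i)) = (\<Sum>i<b. nat (- h i)) - (\<Sum>i<b. nat (h i))"
    for h :: "nat \<Rightarrow> int" and b
    by blast+
  then show ?thesis using * unfolding recursive_int_def by simp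
qed

lemma decidable_int_eq:
  assumes "recursive_int n f" "recursive_int n g"
  shows "decidable n (\<lambda>xs. f xs = g xs)"
proof -
  have "decidable n (\<lambda>xs. nat (f xs) = nat (g xs) \<and> nat (- f xs) = nat (- g xs))"
    using assms unfolding recursive_int_def by (intro decidable_conj decidable_eq; simp)
  moreover have "(nat a = nat b \<and> nat (- a) = nat (- b)) = (a = b)" for a b :: int by auto
  ultimately show ?thesis by simp
qed

text \<open>A bounded search: in a sum over all candidates only the wanted value contributes. The
  projections of the pairing function are computed in the same way.\<close>

lemma recursive_div_2: "recursive n f \<Longrightarrow> recursive n (\<lambda>xs. f xs div 2)"
proof -
  assume f: "recursive n f"
  have "recursive n (\<lambda>xs. \<Sum>k<Suc (f xs). if k + k = f xs \<or> Suc (k + k) = f xs then k else 0)"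
    by (intro recursive_sum recursive_Suc f recursive_if decidable_disj decidable_eq recursive_add
        recursive_proj recursive_const recursive_drop[OF f]) simp_all
  moreover have "(\<Sum>k<Suc a. if k + k = a \<or> Suc (k + k) = a then k else 0) = a div 2" for a
  proof -
    have "(k + k = a \<or> Suc (k + k) = a) = (k = a div 2)" for k by presburger
    then show ?thesis by (auto simp: sum.delta less_Suc_eq_le)
  qed
  ultimately show ?thesis by simp
qed

lemma recursive_int_decode:
  assumes "recursive n f"
  shows "recursive_int n (\<lambda>xs. int_decode (f xs))"
proof -
  have 1: "nat (int_decode m) = (if m div 2 + m div 2 = m then m div 2 else 0)"
    and 2: "nat (- int_decode m) = (if m div 2 + m div 2 = m then 0 else Suc (m div 2))" for m
    by (auto simp: int_decode_def sum_decode_def split: sum.splits) presburger+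
  show ?thesis unfolding recursive_int_def 1 2
    by (intro conjI recursive_if decidable_eq recursive_add recursive_Suc recursive_div_2
        recursive_const assms)
qed

section \<open>Codes of pairs, lists and integer tables\<close>

lemma recursive_prod_encode:
  assumes "recursive n f" "recursive n g"
  shows "recursive n (\<lambda>xs. prod_encode (f xs, g xs))"
  unfolding prod_encode_def triangle_def
  using assms by (simp add: recursive_add recursive_mult recursive_Suc recursive_div_2)

lemma recursive_fst_prod_decode:
  assumes "recursive n f"
  shows "recursive n (\<lambda>xs. fst (prod_decode (f xs)))"
proof -
  have "recursive n (\<lambda>xs. \<Sum>a<Suc (f xs). if \<exists>b<Suc (f xs). prod_encode (a, b) = f xs then a else 0)"
    by (intro recursive_sum recursive_Suc assms recursive_if decidable_ex decidable_eq recursive_prod_encode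
        recursive_proj recursive_proj_drop recursive_const recursive_drop[OF assms]
        recursive_drop[OF recursive_drop[OF assms]]) simp_all
  moreover have "(\<Sum>a<Suc m. if \<exists>b<Suc m. prod_encode (a, b) = m then a else 0) = fst (prod_decode m)" for m
  proof -
    obtain c d where m: "m = prod_encode (c, d)" by (metis prod_decode_inverse surj_pair)
    have "(\<exists>b<Suc m. prod_encode (a, b) = m) = (a = c)" for a
      using le_prod_encode_2[of d c] by (auto simp: m less_Suc_eq_le)
    then show ?thesis using le_prod_encode_1[of c d] by (simp add: m less_Suc_eq_le sum.delta del: sum.lessThan_Suc)
  qed
  ultimately show ?thesis by simp
qed

lemma recursive_snd_prod_decode:
  assumes "recursive n f"
  shows "recursive n (\<lambda>xs. snd (prod_decode (f xs)))"
proof -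
  have "recursive n (\<lambda>xs. \<Sum>b<Suc (f xs). if prod_encode (fst (prod_decode (f xs)), b) = f xs then b else 0)"
    by (intro recursive_sum recursive_Suc assms recursive_if decidable_eq recursive_prod_encode
        recursive_fst_prod_decode recursive_proj recursive_const recursive_drop[OF assms]) simp_all
  moreover have "(\<Sum>b<Suc m. if prod_encode (fst (prod_decode m), b) = m then b else 0) = snd (prod_decode m)" for m
  proof -
    obtain c d where m: "m = prod_encode (c, d)" by (metis prod_decode_inverse surj_pair)
    have "(prod_encode (fst (prod_decode m), b) = m) = (b = d)" for b
      by (auto simp: m)
    then show ?thesis using le_prod_encode_2[of d c] by (simp add: m less_Suc_eq_le sum.delta del: sum.lessThan_Suc)
  qed
  ultimately show ?thesis by simp
qed

text \<open>The code of \<open>x # xs\<close> is the successor of the code of the pair of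
  \<open>x\<close> and the code of \<open>xs\<close>. Subtracting 1 and projecting therefore yields
  the head or the code of the tail.\<close>

definition nth_code :: "nat \<Rightarrow> nat \<Rightarrow> nat" where
  "nth_code c i = fst (prod_decode (rec_nat c (\<lambda>_ z. snd (prod_decode (z - 1))) i - 1))"

lemma nth_code: "i < length xs \<Longrightarrow> nth_code (list_encode xs) i = xs ! i"
proof -
  have "rec_nat (list_encode xs) (\<lambda>_ z. snd (prod_decode (z - 1))) i = list_encode (drop i xs)"
    if "i \<le> length xs"
    using that
  proof (induction i)
    case (Suc i)
    then show ?case by (simp flip: Cons_nth_drop_Suc)
  qed simp
  moreover assume "i < length xs"
  ultimately show ?thesis unfolding nth_code_def
    by (simp flip: Cons_nth_drop_Suc)
qed

lemma recursive_nth_code: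
  assumes "recursive n f" "recursive n g"
  shows "recursive n (\<lambda>xs. nth_code (f xs) (g xs))"
  unfolding nth_code_def
  by (intro recursive_fst_prod_decode recursive_diff recursive_rec_nat recursive_snd_prod_decode
      recursive_proj recursive_const assms) simp

definition entry_code :: "nat \<Rightarrow> nat \<Rightarrow> nat \<Rightarrow> int" where
  "entry_code c i j = int_decode (nth_code (nth_code c i) j)"

lemma recursive_entry_code:
  assumes "recursive n f" "recursive n g" "recursive n h"
  shows "recursive_int n (\<lambda>xs. entry_code (f xs) (g xs) (h xs))"
  unfolding entry_code_def by (intro recursive_int_decode recursive_nth_code assms)

text \<open>Nested as in \<open>mat_encode\<close>, so that the input matrix and the tables searched
  for are read by the same function \<open>entry_code\<close>.\<close>

definition table_code :: "nat \<Rightarrow> nat \<Rightarrow> (nat \<Rightarrow> nat \<Rightarrow> int) \<Rightarrow> nat" where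
  "table_code m n a = list_encode (map (\<lambda>i. list_encode (map (\<lambda>j. int_encode (a i j)) [0..<n])) [0..<m])"

lemma entry_table_code: "i < m \<Longrightarrow> j < n \<Longrightarrow> entry_code (table_code m n a) i j = a i j"
  unfolding entry_code_def table_code_def by (simp add: nth_code)

text \<open>A bound for the codes of all lists of length \<open>n\<close> with entries at most
  \<open>b\<close>: when the tail has code at most \<open>z\<close>, the pairing function yields at
  most \<open>(b + z) ^ 2 + b\<close>, which is below the square of
  \<open>b + z + 1\<close>.\<close>

definition list_code_bound :: "nat \<Rightarrow> nat \<Rightarrow> nat" where
  "list_code_bound b n = rec_nat 0 (\<lambda>_ z. Suc ((b + z + 1) ^ 2)) n"

lemma list_encode_le:
  assumes "\<And>x. x \<in> set xs \<Longrightarrow> x \<le> b"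
  shows "list_encode xs \<le> list_code_bound b (length xs)"
  using assms
proof (induction xs)
  case (Cons x xs)
  have "triangle k \<le> k ^ 2" for k by (induction k) (auto simp: power2_eq_square)
  then have "prod_encode (x, list_encode xs) \<le> (x + list_encode xs) ^ 2 + x"
    unfolding prod_encode_def by simp
  also have "\<dots> \<le> (x + list_encode xs + 1) ^ 2" by (simp add: power2_eq_square)
  also have "\<dots> \<le> (b + list_code_bound b (length xs) + 1) ^ 2"
    using Cons by (intro power_mono add_mono) auto
  finally show ?case by (simp add: list_code_bound_def)
qed (simp add: list_code_bound_def)

lemma table_code_le:
  assumes "\<And>i j. i < m \<Longrightarrow> j < n \<Longrightarrow> \<bar>a i j\<bar> \<le> int b"
  shows "table_code m n a \<le> list_code_bound (list_code_bound (2 * b + 1) n) m"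
proof -
  have "int_encode z \<le> 2 * b + 1" if "\<bar>z\<bar> \<le> int b" for z
    using that by (auto simp: int_encode_def sum_encode_def)
  then have "list_encode (map (\<lambda>j. int_encode (a i j)) [0..<n]) \<le> list_code_bound (2 * b + 1) n"
    if "i < m" for i
  proof -
    have "list_encode (map (\<lambda>j. int_encode (a i j)) [0..<n])
        \<le> list_code_bound (2 * b + 1) (length (map (\<lambda>j. int_encode (a i j)) [0..<n]))"
      using \<open>\<And>z. \<bar>z\<bar> \<le> int b \<Longrightarrow> int_encode z \<le> 2 * b + 1\<close> that assms
      by (intro list_encode_le) auto
    then show ?thesis by simp
  qed
  then show ?thesis unfolding table_code_def
    using list_encode_le[of "map (\<lambda>i. list_encode (map (\<lambda>j. int_encode (a i j)) [0..<n])) [0..<m]"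
        "list_code_bound (2 * b + 1) n"] by fastforce
qed

lemma recursive_list_code_bound:
  assumes "recursive n f" "recursive n g"
  shows "recursive n (\<lambda>xs. list_code_bound (f xs) (g xs))"
  unfolding list_code_bound_def
  by (intro recursive_rec_nat recursive_Suc recursive_power recursive_add recursive_proj
      recursive_const assms recursive_drop[OF assms(1)]) simp_all

section \<open>Small solutions of integer linear systems\<close>

text \<open>Eliminating a variable with coefficient \<open>a\<close> leaves a divisibility condition modulo \<open>a\<close>. It is
  kept by looking only for solutions congruent to the given one, modulo \<open>m\<close>.\<close>

lemma small_integer_solution:
  fixes x :: "'i \<Rightarrow> int" and es :: "(('i \<Rightarrow> int) \<times> int) list"
  assumes "finite J"
    and "\<And>a b. (a, b) \<in> set es \<Longrightarrow> (\<Sum>j\<in>J. a j * x j) = b"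
    and "\<And>a b. (a, b) \<in> set es \<Longrightarrow> \<bar>b\<bar> \<le> h \<and> (\<forall>j\<in>J. \<bar>a j\<bar> \<le> h)"
    and "0 < m" "m \<le> h" "(2 * h) ^ (2 ^ length es) \<le> E"
  shows "\<exists>y. (\<forall>(a, b) \<in> set es. (\<Sum>j\<in>J. a j * y j) = b)
    \<and> (\<forall>j\<in>J. \<bar>y j\<bar> \<le> E * (int (card J) * E + 1) ^ length es) \<and> (\<forall>j\<in>J. m dvd y j - x j)"
  using assms(2-)
proof (induction "length es" arbitrary: es h m)
  case 0
  \<comment> \<open>No equation is left: the residues \<open>x j mod m\<close> keep the congruence
    and are below \<open>m\<close>.\<close>
  then have "m \<le> E" by simp
  then show ?case
    using "0.prems"(3) "0.hyps" by (intro exI[of _ "\<lambda>j. x j mod m"])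
      (auto simp: mod_eq_dvd_iff[symmetric] intro: order.trans[OF less_imp_le[OF pos_mod_bound]])
next
  case (Suc n all)
  then obtain a b es where all: "all = (a, b) # es" by (metis length_Suc_conv surj_pair)
  note prems = Suc.prems[unfolded all]
  have n: "n = length es" using Suc.hyps(2) all by simp
  have h: "1 \<le> h" using prems by simp
  have le: "(2 * h) ^ (2 ^ length es) \<le> E"
    using power_increasing[of "2 ^ length es" "2 ^ length ((a, b) # es)" "2 * h"] prems(5) h by simp
  have "h \<le> (2 * h) ^ (2 ^ length es)"
    using self_le_power[of "2 * h" "2 ^ length es"] h by simp
  then have hE: "h \<le> E" using le by simp
  define X where "X = E * (int (card J) * E + 1) ^ length es"
  have EX: "E \<le> X" and X0: "0 \<le> X"
    unfolding X_def using h hE by (auto intro!: mult_right_mono[of 1 _ E, simplified] one_le_power simp: mult.commute)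
  have ab: "(\<Sum>j\<in>J. a j * x j) = b" "\<bar>b\<bar> \<le> h" "\<And>j. j \<in> J \<Longrightarrow> \<bar>a j\<bar> \<le> h"
    using prems(1,2)[of a b] by auto
  have X': "E * (int (card J) * E + 1) ^ length ((a, b) # es) = X + int (card J) * E * X"
    unfolding X_def by (simp add: algebra_simps)
  show ?case
  proof (cases "\<forall>j\<in>J. a j = 0")
    case True
    obtain y where y: "\<forall>(a, b) \<in> set es. (\<Sum>j\<in>J. a j * y j) = b" "\<forall>j\<in>J. \<bar>y j\<bar> \<le> X"
        "\<forall>j\<in>J. m dvd y j - x j"
      using Suc.hyps(1)[OF n prems(1,2) prems(3,4) le] unfolding X_def by auto
    have "X \<le> X + int (card J) * E * X" using X0 hE h by simp
    then have "\<forall>j\<in>J. \<bar>y j\<bar> \<le> X + int (card J) * E * X" using y(2) by force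
    moreover have "(\<Sum>j\<in>J. a j * y j) = b" using True ab(1) by simp
    ultimately show ?thesis unfolding all X' using y by (intro exI[of _ y]) auto
  next
    case False
    then obtain k where k: "k \<in> J" "a k \<noteq> 0" by blast
    \<comment> \<open>Fraction-free elimination: the new coefficient of \<open>k\<close> is
      \<open>a k * a' k - a' k * a k = 0\<close>. The entry bound grows from \<open>h\<close> to
      \<open>2 * h\<^sup>2\<close>, so \<open>2 * h\<close> gets squared; this is the origin of the
      exponent \<open>2 ^ length es\<close>.\<close>
    define es' where "es' = map (\<lambda>(a', b'). (\<lambda>j. a k * a' j - a' k * a j, a k * b' - a' k * b)) es"
    have ak: "\<bar>a k\<bar> \<le> h" using ab k by simp
    have es': "\<exists>a'' b''. (a'', b'') \<in> set es \<and> a' = (\<lambda>j. a k * a'' j - a'' k * a j)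
        \<and> b' = a k * b'' - a'' k * b" if "(a', b') \<in> set es'" for a' b'
      using that unfolding es'_def by auto
    have bnd: "\<bar>p * q - r * s\<bar> \<le> 2 * h\<^sup>2"
      if "\<bar>p\<bar> \<le> h" "\<bar>q\<bar> \<le> h" "\<bar>r\<bar> \<le> h" "\<bar>s\<bar> \<le> h" for p q r s
    proof -
      have "\<bar>p * q\<bar> \<le> h * h" "\<bar>r * s\<bar> \<le> h * h"
        unfolding abs_mult using that h by (intro mult_mono; simp)+
      then show ?thesis unfolding power2_eq_square by linarith
    qed
    have "\<exists>y. (\<forall>(a, b) \<in> set es'. (\<Sum>j\<in>J. a j * y j) = b)
      \<and> (\<forall>j\<in>J. \<bar>y j\<bar> \<le> X) \<and> (\<forall>j\<in>J. m * \<bar>a k\<bar> dvd y j - x j)"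
    proof -
      have 1: "(\<Sum>j\<in>J. a' j * x j) = b'" if m: "(a', b') \<in> set es'" for a' b'
      proof -
        obtain a'' b'' where 2: "(a'', b'') \<in> set es" "a' = (\<lambda>j. a k * a'' j - a'' k * a j)"
          "b' = a k * b'' - a'' k * b" using es'[OF m] by blast
        have "(\<Sum>j\<in>J. a'' j * x j) = b''" using prems(1) 2(1) by simp
        moreover have "(\<Sum>j\<in>J. a' j * x j) = a k * (\<Sum>j\<in>J. a'' j * x j) - a'' k * (\<Sum>j\<in>J. a j * x j)"
          unfolding 2 by (simp add: sum_distrib_left sum_subtractf algebra_simps)
        ultimately show ?thesis using ab 2 by simp
      qed
      have 2: "\<bar>b'\<bar> \<le> 2 * h\<^sup>2 \<and> (\<forall>j\<in>J. \<bar>a' j\<bar> \<le> 2 * h\<^sup>2)" if m: "(a', b') \<in> set es'" for a' b'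
      proof -
        obtain a'' b'' where 2: "(a'', b'') \<in> set es" "a' = (\<lambda>j. a k * a'' j - a'' k * a j)"
          "b' = a k * b'' - a'' k * b" using es'[OF m] by blast
        have "\<bar>b''\<bar> \<le> h \<and> (\<forall>j\<in>J. \<bar>a'' j\<bar> \<le> h)" using prems(2)[of a'' b''] 2(1) by simp
        then show ?thesis unfolding 2 using ab k by (auto intro!: bnd)
      qed
      have "m * \<bar>a k\<bar> \<le> h * h" using prems(3,4) ak h by (intro mult_mono) auto
      then have 3: "m * \<bar>a k\<bar> \<le> 2 * h\<^sup>2" using zero_le_square[of h] unfolding power2_eq_square by linarith
      have "(2 * (2 * h\<^sup>2)) ^ (2 ^ length es') = (2 * h) ^ (2 ^ length ((a, b) # es))"
        unfolding es'_def by (simp add: power_mult power_mult_distrib)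
      then have 4: "(2 * (2 * h\<^sup>2)) ^ (2 ^ length es') \<le> E" using prems(5) by simp
      have "n = length es'" using n by (simp add: es'_def)
      from Suc.hyps(1)[OF this 1 2 _ 3 4] k prems(3) show ?thesis
        unfolding X_def by (simp add: es'_def)
    qed
    then obtain y where y: "\<forall>(a, b) \<in> set es'. (\<Sum>j\<in>J. a j * y j) = b" "\<forall>j\<in>J. \<bar>y j\<bar> \<le> X"
        "\<forall>j\<in>J. m * \<bar>a k\<bar> dvd y j - x j"
      by blast
    \<comment> \<open>The eliminated variable is recovered from the first equation. Since
      \<open>y\<close> agrees with \<open>x\<close> modulo \<open>m * \<bar>a k\<bar>\<close>, the
      numerator \<open>b - T\<close> is \<open>a k * x k\<close> up to a multiple of
      \<open>m * a k\<close>: the division is exact and its result is congruent to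
      \<open>x k\<close> modulo \<open>m\<close>.\<close>
    define T where "T = (\<Sum>j\<in>J - {k}. a j * y j)"
    define z where "z = (b - T) div a k"
    have split: "(\<Sum>j\<in>J. g j) = g k + (\<Sum>j\<in>J - {k}. g j)" for g :: "'i \<Rightarrow> int"
      using assms(1) k(1) by (rule sum.remove)
    have "b - T = a k * x k - (\<Sum>j\<in>J - {k}. a j * (y j - x j))"
      unfolding T_def using ab(1) split[of "\<lambda>j. a j * x j"]
      by (simp add: algebra_simps sum_subtractf)
    moreover have "m * \<bar>a k\<bar> dvd (\<Sum>j\<in>J - {k}. a j * (y j - x j))"
      using y(3) by (intro dvd_sum dvd_mult) auto
    then obtain q where "(\<Sum>j\<in>J - {k}. a j * (y j - x j)) = m * \<bar>a k\<bar> * q" ..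
    ultimately have bT: "b - T = a k * (x k - sgn (a k) * m * q)"
      by (simp add: algebra_simps abs_sgn)
    then have z: "z = x k - sgn (a k) * m * q" unfolding z_def using k(2) by simp
    have zT: "a k * z + T = b" unfolding z using bT by simp
    have "\<bar>T\<bar> \<le> (\<Sum>j\<in>J - {k}. \<bar>a j * y j\<bar>)" unfolding T_def by (rule sum_abs)
    also have "\<dots> \<le> (\<Sum>j\<in>J - {k}. h * X)"
      using ab(3) y(2) h by (intro sum_mono) (auto simp: abs_mult intro!: mult_mono)
    also have "\<dots> \<le> int (card J) * (h * X)"
      using assms(1) X0 h by (simp add: mult_right_mono card_mono)
    also have "\<dots> \<le> int (card J) * (E * X)"
      using hE X0 by (intro mult_left_mono mult_right_mono) auto
    finally have T: "\<bar>T\<bar> \<le> int (card J) * E * X" by (simp add: mult.assoc)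
    have "\<bar>z\<bar> \<le> \<bar>a k * z\<bar>" using k(2) by (simp add: abs_mult mult_le_cancel_right1 int_one_le_iff_zero_less)
    also have "\<dots> = \<bar>b - T\<bar>" using zT by (simp add: algebra_simps)
    also have "\<dots> \<le> X + int (card J) * E * X" using T ab(2) hE EX by linarith
    finally have zb: "\<bar>z\<bar> \<le> X + int (card J) * E * X" .
    have "X \<le> X + int (card J) * E * X" using X0 hE h by simp
    then have yb: "\<forall>j\<in>J. \<bar>y j\<bar> \<le> X + int (card J) * E * X" using y(2) by force
    define w where "w = y(k := z)"
    have w_sum: "(\<Sum>j\<in>J. g j * w j) = g k * z + (\<Sum>j\<in>J - {k}. g j * y j)" for g
      unfolding split[of "\<lambda>j. g j * w j"] by (simp add: w_def)
    have "(\<Sum>j\<in>J. a' j * w j) = b'" if m: "(a', b') \<in> set es" for a' b'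
    proof -
      have "(\<lambda>j. a k * a' j - a' k * a j, a k * b' - a' k * b) \<in> set es'"
        using m unfolding es'_def by force
      then have "(\<Sum>j\<in>J. (a k * a' j - a' k * a j) * y j) = a k * b' - a' k * b" using y(1) by auto
      then have "a k * (\<Sum>j\<in>J - {k}. a' j * y j) - a' k * T = a k * b' - a' k * b"
        unfolding split[of "\<lambda>j. (a k * a' j - a' k * a j) * y j"] T_def
        by (simp add: algebra_simps sum_subtractf sum_distrib_left)
      then have "a k * (a' k * z + (\<Sum>j\<in>J - {k}. a' j * y j)) = a k * b'"
        using zT[symmetric] by (simp add: algebra_simps)
      then show ?thesis unfolding w_sum using k(2) by simp
    qed
    moreover have "(\<Sum>j\<in>J. a j * w j) = b" unfolding w_sum using zT by (simp add: T_def)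
    moreover have "m dvd w j - x j" if "j \<in> J" for j
      using y(3) that unfolding w_def z by (auto intro: dvd_mult_left)
    ultimately show ?thesis
      unfolding all X' using yb zb by (intro exI[of _ w]) (auto simp: w_def)
  qed
qed

section \<open>Units with prescribed sizes at the roots\<close>

abbreviation ipoly :: "int poly \<Rightarrow> complex \<Rightarrow> complex" where
  "ipoly p z \<equiv> poly (map_poly of_int p) z"

abbreviation roots :: "int poly \<Rightarrow> complex set" where
  "roots p \<equiv> {z. ipoly p z = 0}"

lemma ipoly_simps:
  "ipoly (p + q) z = ipoly p z + ipoly q z" "ipoly (p - q) z = ipoly p z - ipoly q z"
  "ipoly (p * q) z = ipoly p z * ipoly q z" "ipoly (- p) z = - ipoly p z"
  "ipoly (p ^ k) z = ipoly p z ^ k" "ipoly [:c:] z = of_int c" "ipoly (monom c k) z = of_int c * z ^ k"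
  by (simp_all add: of_int_poly_hom.hom_add of_int_poly_hom.hom_mult of_int_poly_hom.hom_minus
      of_int_poly_hom.hom_uminus of_int_poly_hom.hom_power of_int_hom.map_poly_pCons_hom map_poly_monom poly_monom)

lemma ipoly_dvd: "p dvd q \<Longrightarrow> ipoly p z = 0 \<Longrightarrow> ipoly q z = 0"
  by (auto simp: ipoly_simps elim!: dvdE)

lemma ipoly_sum: "ipoly (\<Sum>i\<in>I. g i) z = (\<Sum>i\<in>I. ipoly (g i) z)"
  by (induction I rule: infinite_finite_induct) (simp_all add: ipoly_simps)

lemma ipoly_altdef: "degree p < n \<Longrightarrow> ipoly p z = (\<Sum>i<n. of_int (coeff p i) * z ^ i)"
proof -
  assume n: "degree p < n"
  have "ipoly p z = (\<Sum>i\<le>degree p. of_int (coeff p i) * z ^ i)"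
    unfolding poly_altdef by simp
  also have "\<dots> = (\<Sum>i<n. of_int (coeff p i) * z ^ i)"
    using n by (intro sum.mono_neutral_left) (auto simp: coeff_eq_0)
  finally show ?thesis .
qed

lemma finite_roots: "p \<noteq> 0 \<Longrightarrow> finite (roots p)"
  by (rule poly_roots_finite) simp

lemma zero_if_many_roots: "card (roots f) = n \<Longrightarrow> degree r < n \<Longrightarrow> roots f \<subseteq> roots r \<Longrightarrow> r = 0"
  using card_mono[OF finite_roots, of r "roots f"] card_poly_roots_bound[of "map_poly of_int r :: complex poly"]
  by fastforce

lemma monic_division:
  fixes f p :: "int poly"
  assumes "lead_coeff f = 1"
  shows "\<exists>q r. p = f * q + r \<and> (r = 0 \<or> degree r < degree f)"
proof -
  obtain q r where "pseudo_divmod p f = (q, r)" by fastforce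
  moreover have "f \<noteq> 0" using assms by auto
  ultimately show ?thesis using pseudo_divmod[of f p q r] assms by auto
qed

section \<open>Prime factors of integer polynomials and their roots\<close>

text \<open>Bezout over the rationals, with denominators cleared. By pseudo-division, an element
  \<open>p\<close> of minimal degree in the ideal of \<open>f\<close> and \<open>r\<close> divides
  an integer multiple of each element. If \<open>p\<close> were not constant, the prime
  \<open>f\<close> would divide \<open>p\<close> or the cofactor \<open>q\<close> in
  \<open>smult c f = p * q\<close>: in the former case it divides a constant multiple of
  \<open>r\<close>, in the latter \<open>p\<close> divides a nonzero constant.\<close>

lemma prime_poly_const_combination:
  fixes f r :: "int poly"
  assumes "prime_elem f" "0 < degree f" "\<not> f dvd r"
  shows "\<exists>a b c. c \<noteq> 0 \<and> a * f + b * r = [:c:]"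
proof -
  define I where "I = {p. \<exists>a b. p = a * f + b * r}"
  have I: "f \<in> I" "r \<in> I"
    unfolding I_def by (auto intro: exI[of _ 1] exI[of _ 0])
  have "f \<in> I \<and> f \<noteq> 0" using I assms by auto
  then obtain p where p: "p \<in> I" "p \<noteq> 0" and min: "\<And>q. q \<in> I \<Longrightarrow> q \<noteq> 0 \<Longrightarrow> degree p \<le> degree q"
    using ex_has_least_nat[of "\<lambda>p. p \<in> I \<and> p \<noteq> 0" f degree] by blast
  have multiple: "\<exists>c. c \<noteq> 0 \<and> p dvd smult c g" if g: "g \<in> I" for g
  proof -
    obtain q s where qs: "pseudo_divmod g p = (q, s)" by fastforce
    define c where "c = lead_coeff p ^ (Suc (degree g) - degree p)"
    have c: "smult c g = p * q + s" "s = 0 \<or> degree s < degree p"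
      using pseudo_divmod[OF p(2) qs] unfolding c_def by auto
    obtain a b a' b' where "g = a * f + b * r" "p = a' * f + b' * r" using g p(1) unfolding I_def by blast
    then have "s = (smult c a - a' * q) * f + (smult c b - b' * q) * r"
      using c(1) by (simp add: algebra_simps smult_add_right)
    then have "s \<in> I" unfolding I_def by blast
    then have "s = 0" using min c(2) by fastforce
    then show ?thesis using c(1) p(2) by (intro exI[of _ c]) (auto simp: c_def)
  qed
  have "degree p = 0"
  proof (rule ccontr)
    assume dp: "degree p \<noteq> 0"
    obtain c q where c: "c \<noteq> 0" "smult c f = p * q" using multiple[OF I(1)] by (auto elim!: dvdE)
    then have "f dvd p * q" by (metis dvd_smult dvd_refl)
    then show False
    proof (cases "f dvd p")
      case True
      obtain c where "c \<noteq> 0" "p dvd smult c r" using multiple[OF I(2)] by blast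
      then have "f dvd [:c:] * r" using True by (simp add: dvd_trans)
      then have "f dvd [:c:]" using assms(1,3) by (metis prime_elem_dvd_multD)
      then have "degree f \<le> degree [:c:]" using \<open>c \<noteq> 0\<close> by (intro dvd_imp_degree_le) auto
      then show False using assms(2) by simp
    next
      case False
      then have "f dvd q" using \<open>f dvd p * q\<close> assms(1) by (metis prime_elem_dvd_multD)
      then obtain q' where "q = f * q'" ..
      then have "f * (p * q') = f * [:c:]" using c by (simp add: ac_simps)
      then have *: "p * q' = [:c:]" using assms(2) by (metis degree_0 mult_left_cancel less_irrefl)
      then have "q' \<noteq> 0" using c(1) by auto
      then have "degree (p * q') = degree p + degree q'" using p(2) by (intro degree_mult_eq)
      then show False using * dp by simp
    qed
  qed
  then obtain c where "p = [:c:]" by (metis degree_eq_zeroE)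
  then show ?thesis using p unfolding I_def by auto metis
qed

text \<open>What the estimates use of irreducibility: the roots are simple, and an integer
  polynomial vanishes at all of them or at none. This takes the place of Galois conjugation.\<close>

definition conjugate_roots :: "int poly \<Rightarrow> bool" where
  "conjugate_roots f \<longleftrightarrow> lead_coeff f = 1 \<and> card (roots f) = degree f \<and>
    (\<forall>r. \<forall>z \<in> roots f. ipoly r z = 0 \<longrightarrow> roots f \<subseteq> roots r)"

lemma conjugate_roots_nonzero:
  assumes "conjugate_roots f" "r \<noteq> 0" "degree r < degree f" "z \<in> roots f"
  shows "ipoly r z \<noteq> 0"
  using assms zero_if_many_roots[of f "degree f" r] unfolding conjugate_roots_def by blast

text \<open>A common root of \<open>f\<close> and \<open>r\<close> would be a root of the nonzero
  constant that combines them. Applied to the derivative, this shows that the roots are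
  simple.\<close>

lemma conjugate_roots_prime:
  assumes "prime_elem f" "0 < degree f" "lead_coeff f = 1"
  shows "conjugate_roots f" and "\<not> f dvd r \<Longrightarrow> z \<in> roots f \<Longrightarrow> ipoly r z \<noteq> 0"
proof -
  show *: "ipoly r z \<noteq> 0" if r: "\<not> f dvd r" and z: "z \<in> roots f" for r z
  proof
    assume "ipoly r z = 0"
    obtain a b c where c: "c \<noteq> 0" "a * f + b * r = [:c:]"
      using prime_poly_const_combination[OF assms(1,2) r] by blast
    have "ipoly (a * f + b * r) z = 0" using z \<open>ipoly r z = 0\<close> by (simp add: ipoly_simps)
    then show False unfolding c(2) using c(1) by (simp add: ipoly_simps)
  qed
  have "pderiv f \<noteq> 0" using assms(2) by (simp add: pderiv_eq_0_iff)
  then have "\<not> f dvd pderiv f"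
    using dvd_imp_degree_le[of f "pderiv f"] assms(2) by (simp add: degree_pderiv)
  then have "ipoly (pderiv f) z \<noteq> 0" if "z \<in> roots f" for z using * that by blast
  then have "rsquarefree (map_poly of_int f :: complex poly)"
    unfolding rsquarefree_roots by (simp add: of_int_hom.map_poly_pderiv)
  then have "card (roots f) = degree f"
    using rsquarefree_card_degree[of "map_poly of_int f :: complex poly"] assms(2) by fastforce
  moreover have "roots f \<subseteq> roots r" if "z \<in> roots f" "ipoly r z = 0" for r z
    using * that ipoly_dvd by blast
  ultimately show "conjugate_roots f" unfolding conjugate_roots_def using assms(3) by blast
qed

text \<open>Some prime factor of \<chi> vanishes at \<open>z\<close>; as \<chi> is monic, the
  leading coefficient of that factor is a unit and can be scaled away. With the full multiplicity as
  \<open>e\<close>, the prime does not divide the cofactor \<open>h\<close>, so they have no common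
  root.\<close>

lemma conjugate_roots_factor:
  assumes "lead_coeff \<chi> = 1" "z \<in> roots \<chi>"
  obtains f h e where "conjugate_roots f" "z \<in> roots f" "\<chi> = f ^ e * h" "roots f \<inter> roots h = {}"
proof -
  have "\<chi> \<noteq> 0" using assms(1) by auto
  then obtain A where A: "\<And>p. p \<in># A \<Longrightarrow> prime_elem p" "normalize (prod_mset A) = normalize \<chi>"
    using prime_factorization_exists[of \<chi>] by blast
  then have dvd: "prod_mset A dvd \<chi>" "\<chi> dvd prod_mset A"
    by (metis associated_iff_dvd)+
  have "ipoly (prod_mset A) z = 0" using dvd(2) assms(2) ipoly_dvd by blast
  then have "\<exists>p\<in>#A. ipoly p z = 0"
    by (induction A) (auto simp: ipoly_simps)
  then obtain p where p: "p \<in># A" "ipoly p z = 0" by blast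
  have "p dvd \<chi>" using p(1) dvd(1) by (meson dvd_prod_mset dvd_trans)
  then obtain k where "\<chi> = p * k" ..
  then have "lead_coeff p * lead_coeff k = 1" using assms(1) by (simp add: lead_coeff_mult)
  then have lc: "lead_coeff p * lead_coeff p = 1" by (auto simp: zmult_eq_1_iff)
  define f where "f = smult (lead_coeff p) p"
  have lf: "lead_coeff f = 1" unfolding f_def using lc by auto
  have "p = smult (lead_coeff p) f" unfolding f_def by (simp add: lc)
  then have "p dvd f" "f dvd p" unfolding f_def by (metis dvd_refl dvd_smult, metis dvd_refl dvd_smult)
  have pf: "prime_elem f" 
  proof -
    have "[:lead_coeff p:] * [:lead_coeff p:] = [:lead_coeff p * lead_coeff p:]" by simp
    also have "\<dots> = 1" unfolding lc by (rule one_pCons[symmetric])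
    finally have "[:lead_coeff p:] * [:lead_coeff p:] = 1" .
    then have "is_unit [:lead_coeff p:]" by (metis dvd_triv_left)
    then have "prime_elem ([:lead_coeff p:] * p)" using A(1)[OF p(1)] by (simp only: prime_elem_mult_unit_left)
    then show ?thesis unfolding f_def by simp
  qed
  have zf: "z \<in> roots f" using p(2) \<open>p dvd f\<close> ipoly_dvd by blast
  have df: "0 < degree f"
  proof (rule ccontr)
    assume "\<not> 0 < degree f"
    then have "f = [:lead_coeff f:]" by (metis degree_eq_zeroE coeff_pCons_0 not_gr_zero)
    then show False using zf lf by (metis (mono_tags) ipoly_simps(6) mem_Collect_eq of_int_1 zero_neq_one)
  qed
  have "\<not> is_unit f" using pf by auto
  then obtain h where h: "\<chi> = f ^ multiplicity f \<chi> * h" "\<not> f dvd h"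
    using multiplicity_decompose'[OF \<open>\<chi> \<noteq> 0\<close>, of f] by metis
  show ?thesis
    using that[OF conjugate_roots_prime(1)[OF pf df lf] zf h(1)]
      conjugate_roots_prime(2)[OF pf df lf h(2)] by blast
qed

section \<open>Norms of integer polynomials modulo a monic polynomial\<close>

text \<open>\<open>N\<close> is the norm of \<open>r\<close> modulo \<open>f\<close>, the
  determinant of multiplication by \<open>r\<close> on the powers of \<open>x\<close> below the
  degree of \<open>f\<close>. The Vandermonde matrix of the roots conjugates it to the diagonal
  matrix of the values of \<open>r\<close>; the adjugate, which is integral, yields \<open>s\<close>
  with \<open>r * s\<close> congruent to \<open>N\<close>.\<close>

lemma norm_poly:
  assumes f: "lead_coeff f = 1" "card (roots f) = degree f"
  shows "\<exists>N s a. of_int N = (\<Prod>z\<in>roots f. ipoly r z) \<and> r * s + f * a = [:N:]"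
proof (cases "degree f = 0")
  case True
  then have "f = 1" using f(1) by (metis degree_eq_zeroE lead_coeff_pCons(2) one_pCons)
  then show ?thesis by (intro exI[of _ 1] exI[of _ 0]) simp
next
  case False
  define n where "n = degree f"
  have f0: "f \<noteq> 0" using f(1) by auto
  obtain zs where zs: "set zs = roots f" "distinct zs"
    using finite_distinct_list[OF finite_roots[OF f0]] by blast
  have len: "length zs = n" using zs f(2) distinct_card[of zs] by (simp add: n_def)
  have "\<forall>k. \<exists>q R. r * monom 1 k = f * q + R \<and> degree R < n"
    using monic_division[OF f(1)] False unfolding n_def by (metis degree_0 not_gr_zero)
  then obtain q R where R: "\<And>k. r * monom 1 k = f * q k + R k" "\<And>k. degree (R k) < n" by metis
  \<comment> \<open>Column \<open>k\<close> of \<open>X\<close> holds the remainder of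
    \<open>r * x ^ k\<close> modulo \<open>f\<close>, and \<open>V\<close> evaluates coefficient
    vectors at the roots.\<close>
  define X where "X = mat n n (\<lambda>(i, k). coeff (R k) i)"
  define V where "V = mat n n (\<lambda>(a, i). (zs ! a) ^ i)"
  define D where "D = mat n n (\<lambda>(a, b). if a = b then ipoly r (zs ! a) else 0)"
  have X: "X \<in> carrier_mat n n" and V: "V \<in> carrier_mat n n" and D: "D \<in> carrier_mat n n"
    unfolding X_def V_def D_def by auto
  have "V * map_mat of_int X = D * V"
  proof (rule eq_matI)
    fix a k assume "a < dim_row (D * V)" "k < dim_col (D * V)"
    then have ak: "a < n" "k < n" using D V by auto
    have "zs ! a \<in> roots f" using ak len zs(1) nth_mem by blast
    then have "ipoly (R k) (zs ! a) = ipoly r (zs ! a) * (zs ! a) ^ k"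
      using arg_cong[OF R(1)[of k], of "\<lambda>p. ipoly p (zs ! a)"] by (simp add: ipoly_simps poly_monom)
    moreover have "(V * map_mat of_int X) $$ (a, k) = ipoly (R k) (zs ! a)"
      using ak unfolding ipoly_altdef[OF R(2)] V_def X_def
      by (simp add: times_mat_def scalar_prod_def lessThan_atLeast0 mult.commute)
    moreover have "(D * V) $$ (a, k) = (\<Sum>i<n. (if a = i then ipoly r (zs ! a) else 0) * zs ! i ^ k)"
      using ak unfolding V_def D_def
      by (simp add: times_mat_def scalar_prod_def lessThan_atLeast0)
    moreover have "\<dots> = ipoly r (zs ! a) * (zs ! a) ^ k"
      using ak by (simp add: if_distrib[of "\<lambda>x. x * _"] sum.delta cong: if_cong)
    ultimately show "(V * map_mat of_int X) $$ (a, k) = (D * V) $$ (a, k)" by simp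
  qed (use X V D in auto)
  then have "det V * det (map_mat of_int X) = det D * det V"
    using det_mult[OF V, of "map_mat of_int X"] det_mult[OF D V] X by auto
  \<comment> \<open>A nonzero vector in the kernel would be a polynomial of degree below
    \<open>n\<close> with \<open>n\<close> roots.\<close>
  moreover have "det V \<noteq> 0"
  proof
    assume "det V = 0"
    then obtain v where v: "v \<in> carrier_vec n" "v \<noteq> 0\<^sub>v n" "V *\<^sub>v v = 0\<^sub>v n"
      using det_0_iff_vec_prod_zero_field[OF V] by blast
    define p where "p = (\<Sum>i<n. monom (v $ i) i)"
    have cp: "coeff p i = (if i < n then v $ i else 0)" for i
      unfolding p_def coeff_sum by (auto simp: if_distrib sum.delta cong: if_cong)
    have "p \<noteq> 0"
    proof
      assume "p = 0"
      then have "v $ i = 0" if "i < n" for i using cp[of i] that by simp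
      then have "v = 0\<^sub>v n" using v(1) by (intro eq_vecI) auto
      then show False using v(2) by simp
    qed
    have "degree p < n" using False cp by (intro degree_lessI) (auto simp: n_def)
    have "poly p (zs ! a) = 0" if "a < n" for a
    proof -
      have "0 = (V *\<^sub>v v) $ a" using v(3) that by simp
      also have "\<dots> = (\<Sum>i<n. zs ! a ^ i * v $ i)"
        using that V v(1) by (simp add: V_def scalar_prod_def lessThan_atLeast0)
      also have "\<dots> = poly p (zs ! a)" unfolding p_def by (simp add: poly_sum poly_monom mult.commute)
      finally show ?thesis ..
    qed
    then have "set zs \<subseteq> {z. poly p z = 0}" using len by (auto simp: in_set_conv_nth)
    then have "card (set zs) \<le> degree p"
      using card_mono[OF poly_roots_finite[OF \<open>p \<noteq> 0\<close>]] card_poly_roots_bound[OF \<open>p \<noteq> 0\<close>] le_trans by blast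
    then show False using \<open>degree p < n\<close> distinct_card[OF zs(2)] len by simp
  qed
  ultimately have "det (map_mat of_int X) = det D" by simp
  moreover have "det D = (\<Prod>z\<in>roots f. ipoly r z)"
  proof -
    have "upper_triangular D" unfolding upper_triangular_def D_def by auto
    then have "det D = prod_list (diag_mat D)" by (rule det_upper_triangular[OF _ D])
    also have "diag_mat D = map (ipoly r) zs"
      using D len unfolding diag_mat_def D_def by (auto intro: nth_equalityI)
    also have "prod_list (map (ipoly r) zs) = (\<Prod>z\<in>roots f. ipoly r z)"
      using zs by (metis prod.distinct_set_conv_list)
    finally show ?thesis .
  qed
  ultimately have N: "of_int (det X) = (\<Prod>z\<in>roots f. ipoly r z)" by simp
  \<comment> \<open>The first column of the adjugate is mapped by \<open>X\<close> to the constant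
    polynomial \<open>N\<close>, so it holds the coefficients of \<open>s\<close>.\<close>
  define y where "y k = adj_mat X $$ (k, 0)" for k
  have adj: "adj_mat X \<in> carrier_mat n n" "X * adj_mat X = det X \<cdot>\<^sub>m 1\<^sub>m n" using adj_mat[OF X] by auto
  have Xy: "(\<Sum>k<n. coeff (R k) i * y k) = (if i = 0 then det X else 0)" if "i < n" for i
  proof -
    have "(X * adj_mat X) $$ (i, 0) = (\<Sum>k<n. coeff (R k) i * y k)"
      using that adj(1) X by (simp add: times_mat_def scalar_prod_def lessThan_atLeast0 y_def X_def)
    then show ?thesis unfolding adj(2) using that by auto
  qed
  have "(\<Sum>k<n. smult (y k) (R k)) = [:det X:]"
  proof (rule poly_eqI)
    fix i
    show "coeff (\<Sum>k<n. smult (y k) (R k)) i = coeff [:det X:] i"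
    proof (cases "i < n")
      case True
      then show ?thesis using Xy[OF True] by (auto simp: coeff_sum mult.commute coeff_pCons split: nat.splits)
    next
      case i: False
      then have "coeff (R k) i = 0" for k using R(2)[of k] by (intro coeff_eq_0) auto
      then show ?thesis using i False by (simp add: coeff_sum n_def coeff_pCons split: nat.splits)
    qed
  qed
  moreover have "r * (\<Sum>k<n. smult (y k) (monom 1 k)) = f * (\<Sum>k<n. smult (y k) (q k)) + (\<Sum>k<n. smult (y k) (R k))"
    unfolding sum_distrib_left sum.distrib[symmetric]
    by (intro sum.cong) (simp_all only: mult_smult_right R(1) smult_add_right)
  ultimately have "r * (\<Sum>k<n. smult (y k) (monom 1 k)) + f * (- (\<Sum>k<n. smult (y k) (q k))) = [:det X:]"
    by simp
  then show ?thesis using N by blast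
qed

lemma ipoly_cnj: "ipoly p (cnj z) = cnj (ipoly p z)"
proof -
  have "map_poly cnj (map_poly of_int p) = map_poly of_int p"
    by (intro poly_eqI) (simp add: coeff_map_poly)
  then show ?thesis by (metis poly_cnj complex_cnj_cnj)
qed

lemma norm_ipoly_le:
  assumes "degree p < n" "\<And>i. \<bar>coeff p i\<bar> \<le> Q" "cmod z \<le> \<rho>" "1 \<le> \<rho>"
  shows "cmod (ipoly p z) \<le> real n * Q * \<rho> ^ n"
proof -
  have Q: "0 \<le> Q" using assms(2)[of 0] by simp
  have "cmod (of_int (coeff p i) * z ^ i) \<le> of_int Q * \<rho> ^ n" if "i < n" for i
  proof -
    have "cmod z ^ i \<le> \<rho> ^ i" using assms(3) by (intro power_mono) auto
    also have "\<dots> \<le> \<rho> ^ n" using that assms(4) by (intro power_increasing) auto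
    finally have "cmod z ^ i \<le> \<rho> ^ n" .
    moreover have "\<bar>real_of_int (coeff p i)\<bar> \<le> of_int Q" using assms(2)[of i] by linarith
    ultimately show ?thesis using Q by (simp add: norm_mult norm_power mult_mono)
  qed
  then have "(\<Sum>i<n. cmod (of_int (coeff p i) * z ^ i)) \<le> (\<Sum>i<n. of_int Q * \<rho> ^ n)"
    by (intro sum_mono) auto
  then show ?thesis
    unfolding ipoly_altdef[OF assms(1)] using norm_sum[of "\<lambda>i. of_int (coeff p i) * z ^ i" "{..<n}"] by simp
qed

lemma ipoly_smult: "ipoly (smult c p) z = of_int c * ipoly p z"
proof -
  have "smult c p = [:c:] * p" by simp
  then show ?thesis by (simp only: ipoly_simps)
qed

section \<open>Units by the pigeonhole principle\<close>

text \<open>Each of the \<open>(Q + 1) ^ n\<close> polynomials with coefficients in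
  \<open>{..Q}\<close> is assigned one of \<open>m ^ n\<close> cells at every point of
  \<open>S\<close>. This leaves \<open>(m ^ n) ^ card S = Q ^ n\<close> possibilities, so two of
  them share all cells, and \<open>r\<close> is their difference.\<close>

lemma small_values_poly:
  assumes "finite S" "card S \<le> n" "0 < n" "1 \<le> \<rho>" "2 \<le> m"
    and S: "\<And>z. z \<in> S \<Longrightarrow> cmod z \<le> \<rho> \<and> cnj z \<in> S"
  shows "\<exists>r. r \<noteq> 0 \<and> degree r < n
    \<and> (\<forall>z\<in>S. cmod (ipoly r z) \<le> 8 * real n * \<rho> ^ n * real m ^ card S / real m ^ n)
    \<and> (\<forall>z. cmod z \<le> \<rho> \<longrightarrow> cmod (ipoly r z) \<le> 8 * real n * \<rho> ^ n * real m ^ card S)"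
proof -
  define Q where "Q = m ^ card S"
  define F where "F = PiE {..<n} (\<lambda>_. {..Q})"
  define P where "P c = (\<Sum>i<n. monom (int (c i)) i)" for c
  \<comment> \<open>One real coordinate for each point: as \<open>S\<close> is closed under
    conjugation, the real part read off at one point of a conjugate pair and the imaginary part at
    the other determine both values.\<close>
  define l where "l z w = (if 0 \<le> Im z then Re w else Im w)" for z w
  define X where "X = real n * Q * \<rho> ^ n"
  \<comment> \<open>The shifted values lie between 0 and \<open>2 * X\<close>; twice the width
    needed keeps the cell index strictly below \<open>m ^ n\<close>. Real and imaginary part
    together cost another factor 2, whence the 8 in the statement.\<close>
  define \<delta> where "\<delta> = 4 * X / real m ^ n"
  define cell where "cell c = (\<lambda>z\<in>S. nat \<lfloor>(l z (ipoly (P c) z) + X) / \<delta>\<rfloor>)" for c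
  have Q: "1 \<le> Q" unfolding Q_def using assms(5) by simp
  have X: "0 < X" unfolding X_def using assms(3,4) Q by simp
  have \<delta>: "0 < \<delta>" unfolding \<delta>_def using X assms(5) by simp
  have coeff_P: "coeff (P c) i = (if i < n then int (c i) else 0)" for c i
    unfolding P_def coeff_sum by (auto simp: if_distrib sum.delta cong: if_cong)
  have deg: "degree p < n" if "\<And>i. n \<le> i \<Longrightarrow> coeff p i = 0" for p :: "int poly"
    using that assms(3) by (intro degree_lessI) auto
  have l_le: "\<bar>l z w\<bar> \<le> cmod w" for z w
    unfolding l_def using abs_Re_le_cmod abs_Im_le_cmod by simp
  have l_P: "\<bar>l z (ipoly (P c) z)\<bar> \<le> X" if "c \<in> F" "z \<in> S" for c z
  proof -
    have "cmod (ipoly (P c) z) \<le> real n * int Q * \<rho> ^ n"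
      using that S assms(4) by (intro norm_ipoly_le deg) (auto simp: coeff_P F_def)
    then show ?thesis using l_le[of z "ipoly (P c) z"] by (simp add: X_def)
  qed
  have "cell ` F \<subseteq> PiE S (\<lambda>_. {..<m ^ n})"
  proof -
    have "nat \<lfloor>(l z (ipoly (P c) z) + X) / \<delta>\<rfloor> < m ^ n" if "c \<in> F" "z \<in> S" for c z
    proof -
      have "(l z (ipoly (P c) z) + X) / \<delta> \<le> (2 * X) / \<delta>"
        using l_P[OF that] \<delta> by (intro divide_right_mono) auto
      also have "\<dots> < real m ^ n" unfolding \<delta>_def using X assms(5) by simp
      finally have "\<lfloor>(l z (ipoly (P c) z) + X) / \<delta>\<rfloor> < int (m ^ n)" by (simp add: floor_less_iff)
      moreover have "0 < int (m ^ n)" using assms(5) by simp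
      ultimately show ?thesis by (metis nat_int zless_nat_conj)
    qed
    then show ?thesis unfolding cell_def by auto
  qed
  then have "card (cell ` F) \<le> card (PiE S (\<lambda>_. {..<m ^ n}))"
    using assms(1) by (intro card_mono finite_PiE) auto
  also have "\<dots> = Q ^ n" using assms(1) by (simp add: card_PiE Q_def flip: power_mult) (simp add: mult.commute)
  also have "\<dots> < (Q + 1) ^ n" using assms(3) by (intro power_strict_mono) auto
  also have "\<dots> = card F" unfolding F_def by (simp add: card_PiE)
  finally have "\<not> inj_on cell F" using card_image by fastforce
  then obtain c c' where c: "c \<in> F" "c' \<in> F" "c \<noteq> c'" "cell c = cell c'" unfolding inj_on_def by blast
  define r where "r = P c - P c'"
  have coeff_r: "coeff r i = (if i < n then int (c i) - int (c' i) else 0)" for i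
    unfolding r_def by (simp add: coeff_P)
  have "r \<noteq> 0"
  proof
    assume "r = 0"
    then have "\<And>i. i < n \<Longrightarrow> c i = c' i" using coeff_r by (metis coeff_0 of_nat_eq_iff eq_iff_diff_eq_0)
    then have "c = c'" using c(1,2) unfolding F_def by (intro PiE_ext) auto
    then show False using c(3) by simp
  qed
  moreover have deg_r: "degree r < n" by (intro deg) (simp add: coeff_r)
  moreover have "cmod (ipoly r z) \<le> 8 * real n * \<rho> ^ n * real m ^ card S / real m ^ n" if "z \<in> S" for z
  proof -
    have l_r: "\<bar>l z (ipoly r z)\<bar> \<le> \<delta>" if z: "z \<in> S" for z
    proof -
      let ?u = "l z (ipoly (P c) z)" and ?v = "l z (ipoly (P c') z)"
      have *: "0 \<le> (?u + X) / \<delta>" "0 \<le> (?v + X) / \<delta>"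
        using l_P[OF c(1) z] l_P[OF c(2) z] \<delta> by (auto intro!: divide_nonneg_pos)
      have "nat \<lfloor>(?u + X) / \<delta>\<rfloor> = nat \<lfloor>(?v + X) / \<delta>\<rfloor>"
        using fun_cong[OF c(4), of z] z by (simp add: cell_def)
      then have "\<lfloor>(?u + X) / \<delta>\<rfloor> = \<lfloor>(?v + X) / \<delta>\<rfloor>" using * by (simp add: nat_eq_iff)
      then have "\<bar>(?u + X) / \<delta> - (?v + X) / \<delta>\<bar> < 1" by linarith
      then have "\<bar>(?u - ?v) / \<delta>\<bar> < 1" by (simp add: diff_divide_distrib add_divide_distrib)
      then have "\<bar>?u - ?v\<bar> < \<delta>" using \<delta> by (simp add: abs_divide)
      then show ?thesis unfolding r_def l_def ipoly_simps by (auto split: if_splits)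
    qed
    have "\<bar>Re (ipoly r z)\<bar> \<le> \<delta> \<and> \<bar>Im (ipoly r z)\<bar> \<le> \<delta>"
    proof (cases "Im z" "0 :: real" rule: linorder_cases)
      case less
      then show ?thesis
        using l_r[OF that] l_r[of "cnj z"] S[OF that] unfolding ipoly_cnj by (auto simp: l_def)
    next
      case equal
      then have "cnj z = z" by (simp add: complex_eq_iff)
      then have "ipoly r z = cnj (ipoly r z)" using ipoly_cnj[of r z] by simp
      then have "Im (ipoly r z) = 0" by (simp add: complex_eq_iff)
      then show ?thesis using l_r[OF that] equal \<delta> by (auto simp: l_def)
    next
      case greater
      then show ?thesis
        using l_r[OF that] l_r[of "cnj z"] S[OF that] unfolding ipoly_cnj by (auto simp: l_def)
    qed
    then have "cmod (ipoly r z) \<le> 2 * \<delta>" using cmod_le[of "ipoly r z"] by linarith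
    then show ?thesis unfolding \<delta>_def X_def Q_def by (simp add: mult_ac)
  qed
  moreover have "cmod (ipoly r z) \<le> 8 * real n * \<rho> ^ n * real m ^ card S" if "cmod z \<le> \<rho>" for z
  proof -
    have "\<bar>coeff r i\<bar> \<le> int Q" for i
    proof (cases "i < n")
      case True
      then have "c i \<le> Q" "c' i \<le> Q" using c(1,2) unfolding F_def by auto
      then have "\<bar>int (c i) - int (c' i)\<bar> \<le> int Q" by linarith
      then show ?thesis by (simp add: coeff_r)
    qed (simp add: coeff_r)
    then have "cmod (ipoly r z) \<le> real n * int Q * \<rho> ^ n"
      using that assms(4) deg_r by (intro norm_ipoly_le)
    also have "\<dots> \<le> 8 * (real n * int Q * \<rho> ^ n)" using assms(4) by simp
    finally show ?thesis by (simp add: Q_def mult_ac)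
  qed
  ultimately show ?thesis by blast
qed

text \<open>The polynomials supplied by \<open>small_values_poly\<close> have bounded norm, so that their values are
  known up to a bounded factor.\<close>

lemma controlled_values_poly:
  assumes f: "conjugate_roots f" and j: "j \<in> roots f" and \<rho>: "\<And>z. z \<in> roots f \<Longrightarrow> cmod z \<le> \<rho>" "1 \<le> \<rho>"
    and m: "2 \<le> (m :: nat)"
  defines "n \<equiv> degree f" and "S \<equiv> roots f - {j, cnj j}"
  defines "C \<equiv> 8 * real n * \<rho> ^ n"
  defines "b \<equiv> \<lambda>z. C * real m ^ card S / (if z \<in> S then real m ^ n else 1)"
  shows "\<exists>r N s a. degree r < n \<and> N \<noteq> 0 \<and> \<bar>of_int N\<bar> \<le> C ^ n \<and> r * s + f * a = [:N:]
    \<and> (\<forall>z\<in>roots f. b z / C ^ n \<le> cmod (ipoly r z) \<and> cmod (ipoly r z) \<le> b z)"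
proof -
  have lf: "lead_coeff f = 1" "card (roots f) = n" using f unfolding conjugate_roots_def n_def by auto
  then have fin: "finite (roots f)" by (intro finite_roots) auto
  have n: "0 < n" using lf(2) j fin card_gt_0_iff by fastforce
  have C: "1 \<le> C"
  proof -
    have "1 * 1 \<le> real n * \<rho> ^ n" using n \<rho>(2) by (intro mult_mono one_le_power) auto
    then show ?thesis by (simp add: C_def)
  qed
  have S: "finite S" "card S \<le> n" "S \<subseteq> roots f"
    unfolding S_def using fin lf(2) by (auto intro: card_mono)
  have cnj: "cnj z \<in> roots f" if "z \<in> roots f" for z using that by (simp add: ipoly_cnj)
  \<comment> \<open>Removing \<open>j\<close> together with \<open>cnj j\<close> keeps
    \<open>S\<close> closed under conjugation.\<close>
  have "cmod z \<le> \<rho> \<and> cnj z \<in> S" if "z \<in> S" for z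
    using that \<rho> cnj unfolding S_def by auto
  from small_values_poly[OF S(1,2) n \<rho>(2) m this] obtain r where r: "r \<noteq> 0" "degree r < n"
    "\<And>z. z \<in> S \<Longrightarrow> cmod (ipoly r z) \<le> C * real m ^ card S / real m ^ n"
    "\<And>z. cmod z \<le> \<rho> \<Longrightarrow> cmod (ipoly r z) \<le> C * real m ^ card S"
    unfolding C_def by blast
  have le: "cmod (ipoly r z) \<le> b z" if "z \<in> roots f" for z
    using that r(3,4) \<rho>(1) unfolding b_def by auto
  have b0: "0 < b z" for z unfolding b_def using C m by simp
  \<comment> \<open>The \<open>n\<close> factors \<open>m ^ card S\<close> cancel the
    \<open>card S\<close> denominators \<open>m ^ n\<close>, so the bound on the norm does not
    depend on \<open>m\<close>.\<close>
  have prod_b: "(\<Prod>z\<in>roots f. b z) = C ^ n"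
  proof -
    have "(\<Prod>z\<in>roots f. if z \<in> S then real m ^ n else 1) = real m ^ (n * card S)"
      using S(3) fin by (simp add: prod.If_cases Int_absorb1 power_mult)
    then show ?thesis
      unfolding b_def prod_dividef using lf(2) m
      by (simp add: power_mult_distrib power_mult[symmetric] mult.commute)
  qed
  obtain N s a where N: "of_int N = (\<Prod>z\<in>roots f. ipoly r z)" "r * s + f * a = [:N:]"
    using norm_poly[OF lf(1)] lf(2) unfolding n_def by blast
  have nz: "ipoly r z \<noteq> 0" if "z \<in> roots f" for z
    using conjugate_roots_nonzero[OF f r(1) _ that] r(2) by (simp add: n_def)
  then have N0: "N \<noteq> 0" using N(1) fin by (metis of_int_0 prod_zero_iff)
  have absN: "\<bar>of_int N\<bar> = (\<Prod>z\<in>roots f. cmod (ipoly r z))"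
    using arg_cong[OF N(1), of cmod] by (simp add: prod_norm)
  also have "\<dots> \<le> C ^ n" unfolding prod_b[symmetric] using le by (intro prod_mono) auto
  finally have "\<bar>of_int N\<bar> \<le> C ^ n" .
  \<comment> \<open>The norm is a nonzero integer, so at least 1 in absolute value, and the other
    values are at most \<open>b w\<close>; hence this one cannot fall short of \<open>b z\<close> by
    more than the factor \<open>C ^ n\<close>.\<close>
  moreover have "b z / C ^ n \<le> cmod (ipoly r z)" if z: "z \<in> roots f" for z
  proof -
    have "1 \<le> \<bar>real_of_int N\<bar>" using N0 by linarith
    also have "\<dots> = cmod (ipoly r z) * (\<Prod>w\<in>roots f - {z}. cmod (ipoly r w))"
      unfolding absN using fin z by (rule prod.remove)
    also have "\<dots> \<le> cmod (ipoly r z) * (\<Prod>w\<in>roots f - {z}. b w)"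
      using le by (intro mult_left_mono prod_mono) auto
    finally have "b z * 1 \<le> b z * (cmod (ipoly r z) * (\<Prod>w\<in>roots f - {z}. b w))"
      using b0[of z] by (intro mult_left_mono) auto
    also have "\<dots> = cmod (ipoly r z) * (\<Prod>w\<in>roots f. b w)"
      unfolding prod.remove[OF fin z, of b] by simp
    finally show ?thesis unfolding prod_b using C by (simp add: divide_le_eq)
  qed
  ultimately show ?thesis using N0 N(2) le r(2) by blast
qed

text \<open>Two of the polynomials for sufficiently separated parameters agree modulo a multiple of
  their norms, so their quotient is a unit of the ring generated by a root of \<open>f\<close>. It is congruent
  to 1 modulo the norm of \<open>h\<close>, so it can be extended by 1 at the roots of \<open>h\<close>.\<close>

lemma dominant_unit:
  fixes \<rho> H :: nat
  assumes f: "conjugate_roots f" and j: "j \<in> roots f"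
    and \<rho>: "\<And>z. z \<in> roots f \<Longrightarrow> cmod z \<le> \<rho>" "1 \<le> \<rho>"
    and h: "\<And>z. z \<in> roots f \<Longrightarrow> ipoly h z \<noteq> 0 \<and> cmod (ipoly h z) \<le> H"
  defines "n \<equiv> degree f"
  defines "c \<equiv> (8 * n * \<rho> ^ n) ^ n"
  defines "K \<equiv> (fact c * H ^ n) ^ n"
  shows "\<exists>u v. (\<forall>z\<in>roots f. ipoly u z * ipoly v z = 1)
    \<and> (\<forall>z\<in>roots h. ipoly u z = 1 \<and> ipoly v z = 1)
    \<and> (\<forall>z\<in>roots f - {j, cnj j}. cmod (ipoly u z) < 1)
    \<and> (\<forall>z\<in>roots f. cmod (ipoly u z) \<le> real (c * ((c + 1) ^ (K + 1)) ^ n))"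
proof -
  define S where "S = roots f - {j, cnj j}"
  \<comment> \<open>Consecutive parameters differ by the factor \<open>c + 1\<close>, which beats
    the uncertainty \<open>C ^ n = c\<close> in the values of the polynomials.\<close>
  define m where "m i = (c + 1) ^ (i + 1)" for i
  define C where "C = 8 * real n * real \<rho> ^ n"
  define b where "b i z = C * real (m i) ^ card S / (if z \<in> S then real (m i) ^ n else 1)" for i z
  have lf: "lead_coeff f = 1" "card (roots f) = n" using f unfolding conjugate_roots_def n_def by auto
  then have fin: "finite (roots f)" by (intro finite_roots) auto
  have n: "0 < n" using lf(2) j fin card_gt_0_iff by fastforce
  have Cc: "C ^ n = real c" unfolding C_def c_def by simp
  have c1: "1 \<le> c" unfolding c_def using n \<rho>(2) by simp
  have C0: "0 < C" unfolding C_def using n \<rho>(2) by simp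
  have m2: "2 \<le> m i" for i
  proof -
    have "(2 :: nat) ^ 1 \<le> (c + 1) ^ 1" using c1 by simp
    also have "\<dots> \<le> m i" unfolding m_def by (intro power_increasing) auto
    finally show ?thesis by simp
  qed
  have "card S < n"
    unfolding S_def lf(2)[symmetric] using fin j by (intro psubset_card_mono) auto
  have "\<exists>r N s a. degree r < n \<and> N \<noteq> 0 \<and> \<bar>of_int N\<bar> \<le> C ^ n \<and> r * s + f * a = [:N:]
    \<and> (\<forall>z\<in>roots f. b i z / C ^ n \<le> cmod (ipoly r z) \<and> cmod (ipoly r z) \<le> b i z)" for i
    using controlled_values_poly[OF f j \<rho>(1) _ m2[of i]] \<rho>(2)
    unfolding b_def C_def S_def n_def by simp
  then obtain r N s a where r: "\<And>i. N i \<noteq> 0" "\<And>i. \<bar>of_int (N i)\<bar> \<le> C ^ n"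
      "\<And>i. r i * s i + f * a i = [:N i:]"
      "\<And>i z. z \<in> roots f \<Longrightarrow> b i z / C ^ n \<le> cmod (ipoly (r i) z)"
      "\<And>i z. z \<in> roots f \<Longrightarrow> cmod (ipoly (r i) z) \<le> b i z"
      "\<And>i. degree (r i) < n"
    by metis
  have b0: "0 < b i z" for i z unfolding b_def using C0 m2[of i] by simp
  have nz: "ipoly (r i) z \<noteq> 0" if "z \<in> roots f" for i z
    using r(4)[OF that, of i] b0[of i z] c1 unfolding Cc
    by (metis divide_pos_pos not_le norm_zero of_nat_0_less_iff zero_less_one_class.zero_less_one order.strict_trans2)
  have rs: "ipoly (r i) z * ipoly (s i) z = of_int (N i)" if "z \<in> roots f" for i z
    using arg_cong[OF r(3)[of i], of "\<lambda>p. ipoly p z"] that by (simp add: ipoly_simps)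
  \<comment> \<open>All norms are at most \<open>c\<close> in absolute value and hence divide
    \<open>fact c\<close>, so that one modulus serves for every pair.\<close>
  have "N i dvd fact c" for i
  proof -
    have "\<bar>N i\<bar> \<le> int c" using r(2)[of i] unfolding Cc by linarith
    then have "nat \<bar>N i\<bar> dvd fact c" using r(1)[of i] by (intro dvd_fact) auto
    then show ?thesis by (simp add: nat_dvd_iff)
  qed
  then obtain e where e: "\<And>i. fact c = N i * e i" unfolding dvd_def by metis
  obtain D s\<^sub>h a\<^sub>h where D: "of_int D = (\<Prod>z\<in>roots f. ipoly h z)" "h * s\<^sub>h + f * a\<^sub>h = [:D:]"
    using norm_poly[OF lf(1)] lf(2) unfolding n_def by blast
  have hs: "ipoly h z * ipoly s\<^sub>h z = of_int D" if "z \<in> roots f" for z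
    using arg_cong[OF D(2), of "\<lambda>p. ipoly p z"] that by (simp add: ipoly_simps)
  have D0: "D \<noteq> 0" using D(1) h fin by (metis of_int_0 prod_zero_iff)
  have "\<bar>real_of_int D\<bar> = (\<Prod>z\<in>roots f. cmod (ipoly h z))"
    using arg_cong[OF D(1), of cmod] by (simp add: prod_norm)
  also have "\<dots> \<le> (\<Prod>z\<in>roots f. real H)" using h by (intro prod_mono) auto
  finally have "real_of_int \<bar>D\<bar> \<le> real_of_int (int (H ^ n))" using lf(2) by simp
  then have DH: "nat \<bar>D\<bar> \<le> H ^ n" by (simp only: of_int_le_iff nat_le_iff)
  define W where "W = fact c * \<bar>D\<bar>"
  have W0: "0 < W" unfolding W_def using D0 by simp
  define cell where "cell i = (\<lambda>t\<in>{..<n}. coeff (r i) t mod W)" for i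
  have "\<exists>i l. i < l \<and> l \<le> K \<and> cell i = cell l"
  proof -
    have "cell ` {..K} \<subseteq> PiE {..<n} (\<lambda>_. {0..<W})"
      unfolding cell_def using W0 by (auto split: if_splits)
    then have "card (cell ` {..K}) \<le> card (PiE {..<n} (\<lambda>_. {0..<W}))"
      by (intro card_mono finite_PiE) auto
    also have "\<dots> = nat W ^ n" by (simp add: card_PiE)
    also have "nat W = fact c * nat \<bar>D\<bar>" unfolding W_def
      by (metis nat_mult_distrib fact_ge_zero nat_int of_nat_fact)
    also have "(fact c * nat \<bar>D\<bar>) ^ n \<le> K"
      unfolding K_def using DH by (intro power_mono mult_left_mono) auto
    also have "K < card {..K}" by simp
    finally have "\<not> inj_on cell {..K}" using card_image by fastforce
    then show ?thesis unfolding inj_on_def by (metis atMost_iff linorder_neqE_nat)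
  qed
  then obtain i l where il: "i < l" "l \<le> K" "cell i = cell l" by blast
  have "W dvd coeff (r l - r i) t" for t
  proof (cases "t < n")
    case True
    then have "coeff (r i) t mod W = coeff (r l) t mod W"
      using fun_cong[OF il(3), of t] by (simp add: cell_def)
    then show ?thesis by (simp add: mod_eq_dvd_iff[symmetric])
  next
    case False
    then show ?thesis using r(6)[of i] r(6)[of l] by (simp add: coeff_eq_0)
  qed
  then have "[:W:] dvd r l - r i" by (simp add: const_poly_dvd_iff)
  then obtain t where t: "r l - r i = [:W:] * t" ..
  define t' where "t' = [:sgn D:] * t"
  have t': "ipoly (r l) z = ipoly (r i) z + fact c * of_int D * ipoly t' z" for z
    using arg_cong[OF t, of "\<lambda>p. ipoly p z"] unfolding t'_def W_def
    by (simp add: ipoly_simps ipoly_smult algebra_simps abs_sgn)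
  \<comment> \<open>At a root of \<open>f\<close>, the product \<open>s\<^sub>h * h\<close> is
    \<open>D\<close> and \<open>e i * s i\<close> is \<open>fact c / r i\<close>, so
    \<open>u\<close> takes the value \<open>1 + fact c * D * t' / r i = r l / r i\<close>; likewise
    \<open>v\<close> is \<open>r i / r l\<close>. At the roots of \<open>h\<close> the factor
    \<open>h\<close> leaves 1.\<close>
  define u where "u = 1 + s\<^sub>h * h * t' * [:e i:] * s i"
  define v where "v = 1 - s\<^sub>h * h * t' * [:e l:] * s l"
  have ev: "fact c = complex_of_int (N k) * of_int (e k)" for k
    using e[of k] by (metis of_int_fact of_int_mult)
  have u: "ipoly u z * ipoly (r i) z = ipoly (r l) z" if z: "z \<in> roots f" for z
  proof -
    have "ipoly u z * ipoly (r i) z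
        = ipoly (r i) z + (ipoly h z * ipoly s\<^sub>h z) * ipoly t' z * of_int (e i) * (ipoly (r i) z * ipoly (s i) z)"
      unfolding u_def by (simp add: ipoly_simps ipoly_smult algebra_simps)
    then show ?thesis unfolding hs[OF z] rs[OF z] t' ev[of i] by (simp add: mult_ac)
  qed
  have v: "ipoly v z * ipoly (r l) z = ipoly (r i) z" if z: "z \<in> roots f" for z
  proof -
    have "ipoly v z * ipoly (r l) z
        = ipoly (r l) z - (ipoly h z * ipoly s\<^sub>h z) * ipoly t' z * of_int (e l) * (ipoly (r l) z * ipoly (s l) z)"
      unfolding v_def by (simp add: ipoly_simps ipoly_smult algebra_simps)
    then show ?thesis unfolding hs[OF z] rs[OF z] using t'[of z] unfolding ev[of l] by (simp add: mult_ac)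
  qed
  have 1: "ipoly u z * ipoly v z = 1" if "z \<in> roots f" for z
  proof -
    have "(ipoly u z * ipoly (r i) z) * (ipoly v z * ipoly (r l) z) = ipoly (r i) z * ipoly (r l) z"
      unfolding u[OF that] v[OF that] by (rule mult.commute)
    then show ?thesis using nz[OF that, of i] nz[OF that, of l] by (simp add: mult_ac)
  qed
  have 2: "ipoly u z = 1 \<and> ipoly v z = 1" if "z \<in> roots h" for z
    using that unfolding u_def v_def by (simp add: ipoly_simps ipoly_smult)
  define q where "q = real ((c + 1) ^ (l - i))"
  have "l + 1 = (i + 1) + (l - i)" using il(1) by simp
  then have "m l = m i * (c + 1) ^ (l - i)" unfolding m_def power_add[symmetric] by (simp only:)
  then have mq: "real (m l) = real (m i) * q" unfolding q_def by simp
  have "(c + 1) ^ 1 \<le> (c + 1) ^ (l - i)" using il(1) by (intro power_increasing) auto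
  then have qc: "real c + 1 \<le> q" unfolding q_def by (metis of_nat_1 of_nat_add of_nat_le_iff power_one_right)
  have qM: "q \<le> real ((c + 1) ^ (K + 1))"
    unfolding q_def of_nat_le_iff using il by (intro power_increasing) auto
  have ratio: "b l z = b i z * (q ^ card S / (if z \<in> S then q ^ n else 1))" for z
    unfolding b_def mq by (simp add: power_mult_distrib)
  have u_le: "cmod (ipoly u z) \<le> real c * (q ^ card S / (if z \<in> S then q ^ n else 1))" if z: "z \<in> roots f" for z
  proof -
    have "cmod (ipoly u z) * (b i z / C ^ n) \<le> cmod (ipoly u z) * cmod (ipoly (r i) z)"
      using r(4)[OF z] by (intro mult_left_mono) auto
    also have "\<dots> = cmod (ipoly (r l) z)" using arg_cong[OF u[OF z], of cmod] by (simp add: norm_mult)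
    also have "\<dots> \<le> b i z * (q ^ card S / (if z \<in> S then q ^ n else 1))" using r(5)[OF z, of l] ratio by simp
    finally have "b i z / C ^ n * cmod (ipoly u z)
        \<le> b i z / C ^ n * (real c * (q ^ card S / (if z \<in> S then q ^ n else 1)))"
      using c1 unfolding Cc by (simp add: mult.commute)
    moreover have "0 < b i z / C ^ n" using b0[of i z] c1 unfolding Cc by simp
    ultimately show ?thesis by (rule mult_left_le_imp_le)
  qed
  \<comment> \<open>As \<open>card S < n\<close>, the ratio \<open>q\<close> of the parameters
    enters with exponent at most -1, and \<open>q \<ge> c + 1\<close> absorbs the factor
    \<open>c\<close>.\<close>
  have 3: "cmod (ipoly u z) < 1" if "z \<in> roots f - {j, cnj j}" for z
  proof -
    have "q * q ^ card S \<le> q ^ n"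
      unfolding power_Suc[symmetric] using \<open>card S < n\<close> qc c1 by (intro power_increasing) auto
    then have "q ^ card S / q ^ n \<le> 1 / q" using qc c1 by (simp add: field_simps)
    also have "\<dots> \<le> 1 / (real c + 1)" using qc c1 by (intro divide_left_mono) auto
    finally have "real c * (q ^ card S / q ^ n) \<le> real c * (1 / (real c + 1))" by (intro mult_left_mono) auto
    also have "\<dots> < 1" by simp
    finally show ?thesis using u_le[of z] that unfolding S_def by simp
  qed
  have 4: "cmod (ipoly u z) \<le> real (c * ((c + 1) ^ (K + 1)) ^ n)" if z: "z \<in> roots f" for z
  proof -
    have q1: "1 \<le> q" using qc by linarith
    have "q ^ card S \<le> q ^ n" using \<open>card S < n\<close> q1 by (intro power_increasing) auto
    also have "\<dots> \<le> real ((c + 1) ^ (K + 1)) ^ n" using qM q1 by (intro power_mono) auto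
    finally have "q ^ card S \<le> real ((c + 1) ^ (K + 1)) ^ n" .
    moreover have "q ^ card S / (if z \<in> S then q ^ n else 1) \<le> q ^ card S"
      using q1 by (simp add: divide_le_eq mult_le_cancel_left1)
    ultimately have "real c * (q ^ card S / (if z \<in> S then q ^ n else 1)) \<le> real c * real ((c + 1) ^ (K + 1)) ^ n"
      by (intro mult_left_mono) auto
    then show ?thesis using u_le[OF z] by simp
  qed
  show ?thesis
    by (intro exI[of _ u] exI[of _ v] conjI ballI)
      (rule 1 2[THEN conjunct1] 2[THEN conjunct2] 3 4, assumption)+
qed

section \<open>Cyclic vectors of bounded size\<close>

text \<open>Vectors are functions on all naturals, so that the module laws below hold without
  carrier conditions, over the integers and the complex numbers alike.\<close>

definition apply_mat :: "nat \<Rightarrow> (nat \<Rightarrow> nat \<Rightarrow> 'a) \<Rightarrow> (nat \<Rightarrow> 'a) \<Rightarrow> nat \<Rightarrow> 'a :: comm_ring_1" where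
  "apply_mat d a v = (\<lambda>i. \<Sum>j<d. a i j * v j)"

definition act :: "nat \<Rightarrow> (nat \<Rightarrow> nat \<Rightarrow> 'a) \<Rightarrow> 'a poly \<Rightarrow> (nat \<Rightarrow> 'a) \<Rightarrow> nat \<Rightarrow> 'a :: comm_ring_1" where
  "act d a p v = (\<lambda>i. \<Sum>k\<le>degree p. coeff p k * (apply_mat d a ^^ k) v i)"

lemma apply_mat_linear:
  "apply_mat d a (\<lambda>i. v i + w i) = (\<lambda>i. apply_mat d a v i + apply_mat d a w i)"
  "apply_mat d a (\<lambda>i. c * v i) = (\<lambda>i. c * apply_mat d a v i)"
  "apply_mat d a (\<lambda>i. 0) = (\<lambda>i. 0)"
  by (simp_all add: apply_mat_def algebra_simps sum.distrib sum_distrib_left)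

lemma act_altdef: "degree p < n \<Longrightarrow> act d a p v i = (\<Sum>k<n. coeff p k * (apply_mat d a ^^ k) v i)"
  unfolding act_def by (intro sum.mono_neutral_left) (auto simp: coeff_eq_0)

lemma act_0 [simp]: "act d a 0 v = (\<lambda>_. 0)"
  by (simp add: act_def)

lemma act_pCons: "act d a (pCons c p) v = (\<lambda>i. c * v i + apply_mat d a (act d a p v) i)"
proof
  fix i
  define n where "n = Suc (degree p)"
  have n: "degree p < n" "degree (pCons c p) < Suc n"
    unfolding n_def using degree_pCons_le[of c p] by auto
  have "apply_mat d a (act d a p v) i = (\<Sum>j<d. a i j * (\<Sum>k<n. coeff p k * (apply_mat d a ^^ k) v j))"
    unfolding apply_mat_def[of d a "act d a p v"] act_altdef[OF n(1)] ..
  also have "\<dots> = (\<Sum>k<n. coeff p k * (apply_mat d a ^^ Suc k) v i)"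
    unfolding sum_distrib_left by (subst sum.swap) (simp add: apply_mat_def sum_distrib_left algebra_simps)
  finally show "act d a (pCons c p) v i = c * v i + apply_mat d a (act d a p v) i"
    unfolding act_altdef[OF n(2)] by (simp add: sum.lessThan_Suc_shift del: sum.lessThan_Suc)
qed

lemma act_1 [simp]: "act d a 1 v = v"
  unfolding one_pCons act_pCons by (simp add: apply_mat_linear)

lemma act_const: "act d a [:c:] v = (\<lambda>i. c * v i)"
  by (simp add: act_pCons apply_mat_linear)

lemma act_add: "act d a (p + q) v = (\<lambda>i. act d a p v i + act d a q v i)"
  by (induction p q rule: poly_induct2) (simp_all add: act_pCons apply_mat_linear algebra_simps)

lemma act_smult: "act d a (smult c p) v = (\<lambda>i. c * act d a p v i)"
  by (induction p) (simp_all add: act_pCons apply_mat_linear algebra_simps)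

lemma act_diff: "act d a (p - q) v = (\<lambda>i. act d a p v i - act d a q v i)"
  using act_add[of d a p "smult (- 1) q" v] act_smult[of d a "- 1" q v] by simp

lemma act_sum: "act d a (\<Sum>k\<in>I. p k) v = (\<lambda>i. \<Sum>k\<in>I. act d a (p k) v i)"
  by (induction I rule: infinite_finite_induct) (simp_all add: act_add)

lemma act_mult: "act d a (p * q) v = act d a p (act d a q v)"
  by (induction p) (simp_all add: act_pCons act_add act_smult)

lemma act_vec_add: "act d a p (\<lambda>i. v i + w i) = (\<lambda>i. act d a p v i + act d a p w i)"
  by (induction p) (simp_all add: act_pCons apply_mat_linear algebra_simps)

lemma act_vec_scale: "act d a p (\<lambda>i. c * v i) = (\<lambda>i. c * act d a p v i)"
  using act_mult[of d a p "[:c:]" v] act_mult[of d a "[:c:]" p v]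
  by (simp only: act_const mult.commute[of p])

lemma act_vec_0 [simp]: "act d a p (\<lambda>_. 0) = (\<lambda>_. 0)"
  using act_vec_scale[of d a p 0 "\<lambda>_. 0"] by simp

lemma act_vec_diff: "act d a p (\<lambda>i. v i - w i) = (\<lambda>i. act d a p v i - act d a p w i)"
  using act_vec_add[of d a p v "\<lambda>i. - 1 * w i"] unfolding act_vec_scale by simp

lemma act_vec_sum: "act d a p (\<lambda>i. \<Sum>k\<in>I. v k i) = (\<lambda>i. \<Sum>k\<in>I. act d a p (v k) i)"
  by (induction I rule: infinite_finite_induct) (simp_all add: act_vec_add)

lemma act_funpow: "act d a (monom c k) v = (\<lambda>i. c * (apply_mat d a ^^ k) v i)"
  by (induction k) (simp_all add: monom_0 act_const monom_Suc act_pCons apply_mat_linear)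

lemma act_of_int:
  "act d (\<lambda>i j. of_int (a i j)) (map_poly of_int p) (\<lambda>i. of_int (v i) :: complex) = (\<lambda>i. of_int (act d a p v i))"
  by (induction p) (simp_all add: act_pCons of_int_hom.map_poly_pCons_hom apply_mat_def)

definition supported :: "nat \<Rightarrow> (nat \<Rightarrow> 'a :: zero) \<Rightarrow> bool" where
  "supported d v \<longleftrightarrow> (\<forall>i\<ge>d. v i = 0)"

definition mat_fun :: "nat \<Rightarrow> 'a mat \<Rightarrow> nat \<Rightarrow> nat \<Rightarrow> 'a :: comm_ring_1" where
  "mat_fun d A i j = (if i < d \<and> j < d then A $$ (i, j) else 0)"

definition cyclic_vector :: "nat \<Rightarrow> int mat \<Rightarrow> (nat \<Rightarrow> int) \<Rightarrow> bool" where
  "cyclic_vector d A v \<longleftrightarrow> supported d v \<and> (\<forall>w. supported d w \<longrightarrow> (\<exists>r. act d (mat_fun d A) r v = w))"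

definition delta :: "nat \<Rightarrow> nat \<Rightarrow> 'a :: comm_ring_1" where
  "delta k i = (if i = k then 1 else 0)"

lemma supported_act: "supported d v \<Longrightarrow> supported d (act d (mat_fun d A) p v)"
  by (induction p) (auto simp: supported_def act_pCons apply_mat_def mat_fun_def)

lemma supported_delta: "k < d \<Longrightarrow> supported d (delta k)"
  by (auto simp: supported_def delta_def)

lemma supported_expand: "supported d v \<Longrightarrow> v = (\<lambda>i. \<Sum>k<d. v k * delta k i)"
  by (auto simp: supported_def delta_def if_distrib[of "\<lambda>x. _ * x"] fun_eq_iff not_less cong: if_cong)

text \<open>The determinant trick: column \<open>j\<close> of \<open>x - A\<close>, applied to the
  standard basis and summed, gives \<open>A e\<^sub>j - A e\<^sub>j = 0\<close>. Multiplying these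
  relations by the adjugate shows that the determinant annihilates each basis vector.\<close>

lemma cayley_hamilton:
  assumes A: "A \<in> carrier_mat d d" and v: "supported d v"
  shows "act d (mat_fun d A) (char_poly A) v = (\<lambda>_. 0)"
proof -
  define X where "X = char_poly_matrix A"
  have X: "X \<in> carrier_mat d d" unfolding X_def using A by simp
  have Xij: "X $$ (i, j) = [:- A $$ (i, j), if i = j then 1 else 0:]" if "i < d" "j < d" for i j
    using that A unfolding X_def char_poly_matrix_def by simp
  have adj: "adj_mat X \<in> carrier_mat d d" "X * adj_mat X = det X \<cdot>\<^sub>m 1\<^sub>m d" using adj_mat[OF X] by auto
  let ?act = "act d (mat_fun d A)"
  have col: "(\<Sum>i<d. ?act (X $$ (i, j)) (delta i) r) = 0" if j: "j < d" for j r
  proof -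
    have "apply_mat d (mat_fun d A) (delta i) = (\<lambda>r. mat_fun d A r i)" if "i < d" for i
      using that by (simp add: apply_mat_def delta_def if_distrib cong: if_cong)
    then have "?act (X $$ (i, j)) (delta i) r = - A $$ (i, j) * delta i r + (if i = j then mat_fun d A r j else 0)"
      if "i < d" for i
      using that j by (simp add: Xij act_pCons apply_mat_linear)
    then have "(\<Sum>i<d. ?act (X $$ (i, j)) (delta i) r)
        = - (\<Sum>i<d. A $$ (i, j) * delta i r) + (\<Sum>i<d. if i = j then mat_fun d A r j else 0)"
      by (simp add: sum.distrib sum_negf sum_subtractf)
    also have "(\<Sum>i<d. A $$ (i, j) * delta i r) = mat_fun d A r j"
      using j by (auto simp: delta_def mat_fun_def if_distrib cong: if_cong)
    finally show ?thesis using j by simp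
  qed
  have "?act (char_poly A) (delta k) r = 0" if k: "k < d" for k r
  proof -
    have "(\<Sum>j<d. X $$ (i, j) * adj_mat X $$ (j, k)) = (if i = k then char_poly A else 0)" if "i < d" for i
    proof -
      have "(X * adj_mat X) $$ (i, k) = (\<Sum>j<d. X $$ (i, j) * adj_mat X $$ (j, k))"
        using that k X adj(1) by (simp add: times_mat_def scalar_prod_def lessThan_atLeast0)
      then show ?thesis unfolding adj(2) using that k by (auto simp: X_def char_poly_def)
    qed
    then have "?act (char_poly A) (delta k) r
        = (\<Sum>i<d. ?act (\<Sum>j<d. X $$ (i, j) * adj_mat X $$ (j, k)) (delta i) r)"
      using k by (simp add: if_distrib[of "\<lambda>p. ?act p _ _"] cong: if_cong)
    also have "\<dots> = (\<Sum>j<d. \<Sum>i<d. ?act (adj_mat X $$ (j, k)) (?act (X $$ (i, j)) (delta i)) r)"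
      unfolding act_sum by (subst sum.swap) (simp add: act_mult[symmetric] mult.commute)
    also have "\<dots> = (\<Sum>j<d. ?act (adj_mat X $$ (j, k)) (\<lambda>s. \<Sum>i<d. ?act (X $$ (i, j)) (delta i) s) r)"
      unfolding act_vec_sum ..
    also have "\<dots> = 0" using col by simp
    finally show ?thesis .
  qed
  then show ?thesis
    by (subst supported_expand[OF v]) (simp add: act_vec_sum act_vec_scale)
qed

section \<open>Norm estimates and the size of eigenvalues\<close>

definition norm1 :: "nat \<Rightarrow> (nat \<Rightarrow> complex) \<Rightarrow> real" where
  "norm1 d v = (\<Sum>i<d. cmod (v i))"

lemma norm1_nonneg: "0 \<le> norm1 d v"
  unfolding norm1_def by (simp add: sum_nonneg)

lemma norm1_add: "norm1 d (\<lambda>i. v i + w i) \<le> norm1 d v + norm1 d w"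
  unfolding norm1_def sum.distrib[symmetric] by (intro sum_mono norm_triangle_ineq)

lemma norm1_scale: "norm1 d (\<lambda>i. c * v i) = cmod c * norm1 d v"
  unfolding norm1_def by (simp add: norm_mult sum_distrib_left)

lemma norm1_apply_mat:
  assumes "\<And>i j. i < d \<Longrightarrow> j < d \<Longrightarrow> cmod (a i j) \<le> H"
  shows "norm1 d (apply_mat d a v) \<le> d * H * norm1 d v"
proof -
  have "norm1 d (apply_mat d a v) \<le> (\<Sum>i<d. \<Sum>j<d. H * cmod (v j))"
    unfolding norm1_def apply_mat_def using assms
    by (intro sum_mono order.trans[OF norm_sum]) (auto simp: norm_mult intro!: mult_right_mono)
  then show ?thesis by (simp add: norm1_def sum_distrib_left mult.assoc)
qed

lemma norm1_act_linear_factors: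
  assumes a: "\<And>i j. i < d \<Longrightarrow> j < d \<Longrightarrow> cmod (a i j) \<le> H" and "0 \<le> H"
    and "\<And>\<mu>. \<mu> \<in> set as \<Longrightarrow> cmod \<mu> \<le> \<rho>" "0 \<le> \<rho>"
  shows "norm1 d (act d a (\<Prod>\<mu>\<leftarrow>as. [:- \<mu>, 1:]) v) \<le> (\<rho> + d * H) ^ length as * norm1 d v"
  using assms(3)
proof (induction as)
  case (Cons \<mu> as)
  let ?w = "act d a (\<Prod>\<mu>\<leftarrow>as. [:- \<mu>, 1:]) v"
  have eq: "act d a (\<Prod>\<mu>\<leftarrow>\<mu> # as. [:- \<mu>, 1:]) v = (\<lambda>i. - \<mu> * ?w i + apply_mat d a ?w i)"
    by (simp add: act_add act_smult act_diff act_pCons)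
  have "norm1 d (\<lambda>i. - \<mu> * ?w i + apply_mat d a ?w i) \<le> norm1 d (\<lambda>i. - \<mu> * ?w i) + norm1 d (apply_mat d a ?w)"
    by (rule norm1_add)
  moreover have "norm1 d (\<lambda>i. - \<mu> * ?w i) = cmod (- \<mu>) * norm1 d ?w" by (rule norm1_scale)
  moreover have "norm1 d (apply_mat d a ?w) \<le> d * H * norm1 d ?w" by (rule norm1_apply_mat[OF a])
  ultimately have "norm1 d (act d a (\<Prod>\<mu>\<leftarrow>\<mu> # as. [:- \<mu>, 1:]) v) \<le> cmod (- \<mu>) * norm1 d ?w + d * H * norm1 d ?w"
    unfolding eq by linarith
  also have "\<dots> = (cmod \<mu> + d * H) * norm1 d ?w" by (simp add: algebra_simps)
  also have "\<dots> \<le> (\<rho> + d * H) * norm1 d ?w"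
    using Cons.prems norm1_nonneg by (intro mult_right_mono) auto
  also have "\<dots> \<le> (\<rho> + d * H) * ((\<rho> + d * H) ^ length as * norm1 d v)"
    using Cons assms(2,4) by (intro mult_left_mono) auto
  finally show ?case by simp
qed simp

text \<open>Comparison of the norms of an eigenvector and of its image.\<close>

lemma char_poly_root_le:
  assumes A: "A \<in> carrier_mat d d" and H: "\<And>i j. i < d \<Longrightarrow> j < d \<Longrightarrow> \<bar>A $$ (i, j)\<bar> \<le> int H"
    and z: "z \<in> roots (char_poly A)"
  shows "cmod z \<le> real (d * H)"
proof -
  let ?B = "map_mat of_int A :: complex mat"
  have B: "?B \<in> carrier_mat d d" using A by simp
  have "eigenvalue ?B z"
    unfolding eigenvalue_root_char_poly[OF B] of_int_hom.char_poly_hom[OF A] using z by simp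
  then obtain v where v: "v \<in> carrier_vec d" "v \<noteq> 0\<^sub>v d" "?B *\<^sub>v v = z \<cdot>\<^sub>v v"
    unfolding eigenvalue_def eigenvector_def using A by auto
  define w where "w i = v $ i" for i
  have "apply_mat d (mat_fun d ?B) w i = z * w i" if "i < d" for i
  proof -
    have "(?B *\<^sub>v v) $ i = apply_mat d (mat_fun d ?B) w i"
      using that A v(1) by (simp add: apply_mat_def mat_fun_def w_def scalar_prod_def lessThan_atLeast0)
    then show ?thesis unfolding v(3) using that v(1) by (simp add: w_def)
  qed
  then have "norm1 d (apply_mat d (mat_fun d ?B) w) = cmod z * norm1 d w"
    unfolding norm1_scale[symmetric] by (simp add: norm1_def)
  moreover have "cmod (mat_fun d ?B i j) \<le> real H" if "i < d" "j < d" for i j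
    using that H[OF that] A by (simp add: mat_fun_def)
  then have "norm1 d (apply_mat d (mat_fun d ?B) w) \<le> d * real H * norm1 d w"
    by (rule norm1_apply_mat)
  moreover have "norm1 d w \<noteq> 0"
  proof
    assume "norm1 d w = 0"
    then have "\<forall>i<d. v $ i = 0" by (simp add: norm1_def sum_nonneg_eq_0_iff w_def)
    then have "v = 0\<^sub>v d" using v(1) by (intro eq_vecI) auto
    then show False using v(2) by simp
  qed
  ultimately show ?thesis using norm1_nonneg[of d w] by simp
qed

text \<open>The bound of \<open>dominant_unit\<close> with the degree of the factor replaced by its
  maximum \<open>d\<close>, so that it serves every factor of \<chi>. The number
  \<open>(2 * \<rho>) ^ d\<close> bounds the values of the cofactor, products of at most
  \<open>d\<close> differences of roots.\<close>

definition unit_bound :: "nat \<Rightarrow> nat \<Rightarrow> nat" where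
  "unit_bound d \<rho> = (let c = (8 * d * \<rho> ^ d) ^ d; K = (fact c * ((2 * \<rho>) ^ d) ^ d) ^ d
    in c * ((c + 1) ^ (K + 1)) ^ d)"

lemma poly_prod_list_0: "poly (\<Prod>\<mu>\<leftarrow>as. [:- \<mu>, 1:]) z = (0 :: complex) \<longleftrightarrow> z \<in> set as"
  by (induction as) auto

lemma monic_linear_factors:
  assumes "lead_coeff p = (1 :: int)"
  shows "\<exists>as. map_poly of_int p = (\<Prod>\<mu>\<leftarrow>as. [:- \<mu>, 1 :: complex:]) \<and> length as = degree p"
proof -
  obtain as where as: "smult (lead_coeff (map_poly of_int p)) (\<Prod>a\<leftarrow>as. [:- a, 1 :: complex:]) = map_poly of_int p"
    "length as = degree (map_poly of_int p :: complex poly)"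
    using fundamental_theorem_algebra_factorized by blast
  have "map_poly of_int p = (\<Prod>a\<leftarrow>as. [:- a, 1 :: complex:])" using as(1) assms by simp
  moreover have "length as = degree p" using as(2) by simp
  ultimately show ?thesis by blast
qed

lemma pderiv_prod_linear_factors:
  "pderiv (\<Prod>\<mu>\<leftarrow>as. [:- \<mu>, 1 :: complex:]) = (\<Sum>z\<leftarrow>as. \<Prod>\<mu>\<leftarrow>remove1 z as. [:- \<mu>, 1:])"
proof (induction as)
  case (Cons b bs)
  have "(\<Prod>\<mu>\<leftarrow>remove1 z (b # bs). [:- \<mu>, 1:]) = [:- b, 1:] * (\<Prod>\<mu>\<leftarrow>remove1 z bs. [:- \<mu>, 1:])"
    if "z \<in> set bs" for z
    using that prod_list_map_remove1[OF that, of "\<lambda>\<mu>. [:- \<mu>, 1:]"] by (cases "z = b") auto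
  then have "(\<Sum>z\<leftarrow>bs. \<Prod>\<mu>\<leftarrow>remove1 z (b # bs). [:- \<mu>, 1:])
      = [:- b, 1:] * (\<Sum>z\<leftarrow>bs. \<Prod>\<mu>\<leftarrow>remove1 z bs. [:- \<mu>, 1:])"
    unfolding sum_list_const_mult[symmetric] by (metis (no_types, lifting) map_cong)
  moreover have "pderiv [:- b, 1:] = 1" by (simp add: pderiv_pCons)
  ultimately show ?case using Cons by (simp add: pderiv_mult del: mult_pCons_left)
qed simp

lemma prod_linear_factors_dvd_power:
  assumes "\<And>z. z \<in> set as \<Longrightarrow> poly p z = (0 :: complex)"
  shows "(\<Prod>\<mu>\<leftarrow>as. [:- \<mu>, 1:]) dvd p ^ length as"
  using assms by (induction as) (auto simp: poly_eq_0_iff_dvd simp del: mult_pCons_left intro!: mult_dvd_mono)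

lemma act_cnj:
  "act d (\<lambda>i j. of_int (a i j)) (map_poly cnj p) (\<lambda>i. of_int (v i))
    = (\<lambda>i. cnj (act d (\<lambda>i j. of_int (a i j)) p (\<lambda>i. of_int (v i)) i))"
  by (induction p) (simp_all add: act_pCons map_poly_pCons apply_mat_def)

locale bounded_matrix =
  fixes d :: nat and A :: "int mat" and H :: nat
  assumes A: "A \<in> carrier_mat d d" and d: "0 < d" and H: "1 \<le> H"
    and A_le: "\<And>i j. i < d \<Longrightarrow> j < d \<Longrightarrow> \<bar>A $$ (i, j)\<bar> \<le> int H"
begin

section \<open>Coordinates of generators at the eigenvalues\<close>

definition \<chi> :: "int poly" where "\<chi> = char_poly A"

definition as :: "complex list" where
  "as = (SOME as. map_poly of_int \<chi> = (\<Prod>\<mu>\<leftarrow>as. [:- \<mu>, 1:]) \<and> length as = d)"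

abbreviation iact :: "int poly \<Rightarrow> (nat \<Rightarrow> int) \<Rightarrow> nat \<Rightarrow> int" where
  "iact p v \<equiv> act d (mat_fun d A) p v"

abbreviation cvec :: "(nat \<Rightarrow> int) \<Rightarrow> nat \<Rightarrow> complex" where
  "cvec v \<equiv> \<lambda>i. of_int (v i)"

definition cact :: "complex poly \<Rightarrow> (nat \<Rightarrow> complex) \<Rightarrow> nat \<Rightarrow> complex" where
  "cact p v = act d (\<lambda>i j. of_int (mat_fun d A i j)) p v"

text \<open>\<open>remove1\<close> takes away a single copy of \<open>z\<close>, so that also for a
  multiple root \<open>Q z\<close> maps supported vectors into the eigenspace of
  \<open>z\<close>.\<close>

definition Q :: "complex \<Rightarrow> complex poly" where
  "Q z = (\<Prod>\<mu>\<leftarrow>remove1 z as. [:- \<mu>, 1:])"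

definition nrm :: "complex \<Rightarrow> (nat \<Rightarrow> int) \<Rightarrow> real" where
  "nrm z v = norm1 d (cact (Q z) (cvec v))"

abbreviation generator :: "(nat \<Rightarrow> int) \<Rightarrow> bool" where
  "generator \<equiv> cyclic_vector d A"

lemma chi: "lead_coeff \<chi> = 1" "degree \<chi> = d" "\<chi> \<noteq> 0"
  using degree_monic_char_poly[OF A] unfolding \<chi>_def by auto

lemma as: "map_poly of_int \<chi> = (\<Prod>\<mu>\<leftarrow>as. [:- \<mu>, 1:])" and length_as: "length as = d"
proof -
  obtain zs where "map_poly of_int \<chi> = (\<Prod>\<mu>\<leftarrow>zs. [:- \<mu>, 1 :: complex:]) \<and> length zs = d"
    using monic_linear_factors[OF chi(1)] chi(2) by blast
  then have "map_poly of_int \<chi> = (\<Prod>\<mu>\<leftarrow>as. [:- \<mu>, 1:]) \<and> length as = d"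
    unfolding as_def by (rule someI)
  then show "map_poly of_int \<chi> = (\<Prod>\<mu>\<leftarrow>as. [:- \<mu>, 1:])" "length as = d" by auto
qed

lemma roots_chi: "roots \<chi> = set as"
  unfolding as using poly_prod_list_0 by blast

lemma root_le: "z \<in> set as \<Longrightarrow> cmod z \<le> real (d * H)"
  unfolding roots_chi[symmetric] \<chi>_def by (rule char_poly_root_le[OF A A_le])

lemma Q: "z \<in> set as \<Longrightarrow> [:- z, 1:] * Q z = map_poly of_int \<chi>"
  unfolding as Q_def by (simp add: prod_list_map_remove1[of z as] del: mult_pCons_left)

lemma cact_of_int: "cact (map_poly of_int p) (cvec v) = cvec (iact p v)"
  unfolding cact_def by (rule act_of_int)

lemma iact_chi: "supported d v \<Longrightarrow> iact \<chi> v = (\<lambda>_. 0)"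
  unfolding \<chi>_def by (rule cayley_hamilton[OF A])

lemma nrm_nonneg: "0 \<le> nrm z v"
  unfolding nrm_def by (rule norm1_nonneg)

text \<open>\<open>r - r(z)\<close> is divisible by \<open>x - z\<close>, and the product of
  \<open>x - z\<close> and \<open>Q z\<close> is \<chi>, which kills \<open>v\<close>.\<close>

lemma nrm_iact:
  assumes v: "supported d v" and z: "z \<in> set as"
  shows "nrm z (iact r v) = cmod (ipoly r z) * nrm z v"
proof -
  define y where "y = ipoly r z"
  have "poly (map_poly of_int r - [:y:]) z = 0" by (simp add: y_def)
  then have "[:- z, 1:] dvd map_poly of_int r - [:y:]" by (simp only: poly_eq_0_iff_dvd)
  then obtain s where "map_poly of_int r - [:y:] = [:- z, 1:] * s" ..
  then have "map_poly of_int r = [:y:] + [:- z, 1:] * s" by (simp only: diff_eq_eq add.commute)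
  then have "Q z * map_poly of_int r = [:ipoly r z:] * Q z + s * map_poly of_int \<chi>"
    unfolding Q[OF z, symmetric] y_def[symmetric] by (simp only: algebra_simps)
  then have "cact (Q z * map_poly of_int r) (cvec v)
      = (\<lambda>i. ipoly r z * cact (Q z) (cvec v) i + cact s (cact (map_poly of_int \<chi>) (cvec v)) i)"
    unfolding cact_def by (simp add: act_add act_mult act_smult)
  also have "cact (map_poly of_int \<chi>) (cvec v) = (\<lambda>_. 0)" unfolding cact_of_int iact_chi[OF v] by simp
  finally have "cact (Q z) (cvec (iact r v)) = (\<lambda>i. ipoly r z * cact (Q z) (cvec v) i)"
    unfolding cact_of_int[symmetric] by (simp add: cact_def act_mult)
  then show ?thesis unfolding nrm_def by (simp only: norm1_scale)
qed

text \<open>Each of the at most \<open>d\<close> linear factors of \<open>Q z\<close> multiplies the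
  norm by at most \<open>d * H + d * H\<close>, from the root and from the matrix.\<close>

lemma nrm_delta_le:
  assumes "k < d" "z \<in> set as"
  shows "nrm z (delta k) \<le> real ((2 * (d * H)) ^ d)"
proof -
  have dH: "1 \<le> d * H" using d H by simp
  have "norm1 d (cact (Q z) (cvec (delta k)))
      \<le> (real (d * H) + d * real H) ^ length (remove1 z as) * norm1 d (cvec (delta k))"
    unfolding cact_def Q_def
  proof (rule norm1_act_linear_factors)
    show "cmod (of_int (mat_fun d A i j)) \<le> real H" if "i < d" "j < d" for i j
      using A_le[OF that] that by (simp add: mat_fun_def)
    show "cmod \<mu> \<le> real (d * H)" if "\<mu> \<in> set (remove1 z as)" for \<mu>
      using that root_le notin_set_remove1 by metis
  qed auto
  also have "norm1 d (cvec (delta k)) = 1"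
  proof -
    have "cmod (of_int (delta k i)) = (if i = k then 1 else 0)" for i by (simp add: delta_def)
    then show ?thesis unfolding norm1_def using assms(1) by simp
  qed
  also have "real (d * H) + d * real H = real (2 * (d * H))" by simp
  also have "real (2 * (d * H)) ^ length (remove1 z as) * 1 \<le> real (2 * (d * H)) ^ d"
  proof -
    have "1 \<le> real (2 * (d * H))" using dH by linarith
    moreover have "length (remove1 z as) \<le> d" using length_as by (simp add: length_remove1)
    ultimately show ?thesis by (simp add: power_increasing del: of_nat_mult)
  qed
  finally show ?thesis unfolding nrm_def of_nat_power .
qed

text \<open>A dominant unit may be large at both \<open>j\<close> and \<open>cnj j\<close>, so
  smallness at \<open>j\<close> has to carry over to \<open>cnj j\<close>. It does because
  \<open>A\<close> and \<open>v\<close> are real.\<close>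

lemma nrm_cnj:
  assumes "z \<in> set as"
  shows "nrm (cnj z) v = nrm z v"
proof -
  have cnj: "cnj z \<in> set as" using assms unfolding roots_chi[symmetric] by (simp add: ipoly_cnj)
  have mc: "map_poly cnj (p * q) = map_poly cnj p * map_poly cnj q" for p q
    by (rule poly_ext) (metis poly_cnj poly_mult complex_cnj_mult complex_cnj_cnj)
  have "map_poly cnj (map_poly of_int \<chi>) = map_poly of_int \<chi>"
    by (intro poly_eqI) (simp add: coeff_map_poly)
  then have "[:- cnj z, 1:] * Q (cnj z) = [:- cnj z, 1:] * map_poly cnj (Q z)"
    unfolding Q[OF cnj] Q[OF assms, symmetric] mc by (simp add: map_poly_pCons)
  then have "Q (cnj z) = map_poly cnj (Q z)" 
    using mult_left_cancel[of "[:- cnj z, 1:]" "Q (cnj z)" "map_poly cnj (Q z)"] by simp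
  then show ?thesis unfolding nrm_def cact_def norm1_def by (simp add: act_cnj)
qed

lemma iact_pderiv_le:
  assumes "\<And>z. z \<in> set as \<Longrightarrow> nrm z v \<le> B" "i < d"
  shows "real_of_int \<bar>iact (pderiv \<chi>) v i\<bar> \<le> d * B"
proof -
  have sum: "norm1 d (\<lambda>i. \<Sum>z\<leftarrow>zs. g z i) \<le> (\<Sum>z\<leftarrow>zs. norm1 d (g z))" for zs :: "complex list" and g
  proof (induction zs)
    case (Cons b zs)
    then show ?case using norm1_add[of d "g b" "\<lambda>i. \<Sum>z\<leftarrow>zs. g z i"] by simp
  qed (simp add: norm1_def)
  have act_sum_list: "act d a (\<Sum>z\<leftarrow>zs. g z) w = (\<lambda>i. \<Sum>z\<leftarrow>zs. act d a (g z) w i)"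
    for a :: "nat \<Rightarrow> nat \<Rightarrow> complex" and zs :: "complex list" and g w
    by (induction zs) (auto simp: act_add)
  have "cvec (iact (pderiv \<chi>) v) = cact (pderiv (map_poly of_int \<chi>)) (cvec v)"
    unfolding cact_of_int[symmetric] by (simp add: of_int_hom.map_poly_pderiv)
  also have "\<dots> = (\<lambda>i. \<Sum>z\<leftarrow>as. cact (Q z) (cvec v) i)"
    unfolding as pderiv_prod_linear_factors cact_def act_sum_list Q_def ..
  finally have "norm1 d (cvec (iact (pderiv \<chi>) v)) \<le> (\<Sum>z\<leftarrow>as. nrm z v)"
    unfolding nrm_def using sum by simp
  also have "\<dots> \<le> (\<Sum>z\<leftarrow>as. real B)" using assms(1) by (intro sum_list_mono) auto
  also have "\<dots> = d * B" using length_as by (simp add: sum_list_triv)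
  finally have "norm1 d (cvec (iact (pderiv \<chi>) v)) \<le> d * B" .
  moreover have "cmod (cvec (iact (pderiv \<chi>) v) i) \<le> norm1 d (cvec (iact (pderiv \<chi>) v))"
    unfolding norm1_def using assms(2) by (intro member_le_sum) auto
  ultimately show ?thesis by simp
qed

text \<open>\<chi> divides \<open>p ^ d\<close> over the complex numbers, which is enough to compute
  the action on an integer vector.\<close>

lemma nilpotent:
  assumes "set as \<subseteq> roots p" "supported d v"
  shows "iact (p ^ d) v = (\<lambda>_. 0)"
proof -
  have "map_poly of_int \<chi> dvd (map_poly of_int p :: complex poly) ^ d"
    using prod_linear_factors_dvd_power[of as "map_poly of_int p"] assms(1) unfolding as length_as by blast
  then obtain s where "(map_poly of_int p :: complex poly) ^ d = s * map_poly of_int \<chi>"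
    by (metis dvdE mult.commute)
  then have "map_poly of_int (p ^ d) = s * (map_poly of_int \<chi> :: complex poly)"
    by (simp add: of_int_poly_hom.hom_power)
  then have "cvec (iact (p ^ d) v) = cact s (cact (map_poly of_int \<chi>) (cvec v))"
    unfolding cact_of_int[symmetric] by (simp add: cact_def act_mult)
  also have "\<dots> = (\<lambda>_. 0)" unfolding cact_of_int iact_chi[OF assms(2)] by (simp add: cact_def)
  finally show ?thesis by (simp add: fun_eq_iff)
qed

text \<open>As \<chi> may have multiple roots, being inverse at the roots only makes
  \<open>1 - u * u'\<close> act nilpotently; the finite geometric series then supplies a true
  inverse of the action of \<open>u\<close>.\<close>

lemma generator_unit:
  assumes v: "generator v" and u: "\<And>z. z \<in> set as \<Longrightarrow> ipoly u z * ipoly u' z = 1"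
  shows "generator (iact u v)"
proof -
  have sv: "supported d v" using v unfolding cyclic_vector_def by simp
  define p where "p = 1 - u * u'"
  have "set as \<subseteq> roots p" unfolding p_def using u by (auto simp: ipoly_simps)
  note nil = nilpotent[OF this]
  define t where "t = u' * (\<Sum>i<d. p ^ i)"
  have "t * u = (1 - p) * (\<Sum>i<d. p ^ i)" unfolding t_def p_def by (simp add: algebra_simps)
  then have "t * u = 1 - p ^ d" by (simp only: one_diff_power_eq)
  then have t: "iact t (iact u v) = v" using nil[OF sv] unfolding act_mult[symmetric] by (simp add: act_diff)
  show ?thesis
    unfolding cyclic_vector_def
  proof (intro conjI allI impI)
    show "supported d (iact u v)" by (rule supported_act[OF sv])
    fix w :: "nat \<Rightarrow> int"
    assume "supported d w"
    then obtain r where "iact r v = w" using v unfolding cyclic_vector_def by blast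
    then have "iact (r * t) (iact u v) = w" unfolding act_mult t .
    then show "\<exists>r. iact r (iact u v) = w" ..
  qed
qed

text \<open>Otherwise the polynomials \<open>r k\<close> that take \<open>v\<close> to the basis
  vectors have all values at the roots of \<open>f\<close> below 1. Their norms are then integers
  below 1, so they vanish at these roots. But \<open>v\<close> is a combination of the
  \<open>r k v\<close>, so its coordinates there would be 0, not large.\<close>

lemma small_root_value:
  assumes v: "generator v" and f: "conjugate_roots f" "roots f \<subseteq> set as" "roots f \<noteq> {}"
  shows "\<exists>j\<in>roots f. nrm j v \<le> real ((2 * (d * H)) ^ d)"
proof (rule ccontr)
  assume "\<not> ?thesis"
  then have big: "\<And>z. z \<in> roots f \<Longrightarrow> nrm z v > real ((2 * (d * H)) ^ d)" by (auto simp: not_le)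
  have sv: "supported d v" using v unfolding cyclic_vector_def by simp
  have lf: "lead_coeff f = 1" "card (roots f) = degree f" using f(1) unfolding conjugate_roots_def by auto
  have fin: "finite (roots f)" using lf(1) by (intro finite_roots) auto
  have "\<exists>r. iact r v = delta k" if "k < d" for k
    using v supported_delta[OF that] unfolding cyclic_vector_def by blast
  then obtain r where r: "\<And>k. k < d \<Longrightarrow> iact (r k) v = delta k" by metis
  have rz: "ipoly (r k) z = 0" if k: "k < d" and z: "z \<in> roots f" for k z
  proof -
    have lt: "cmod (ipoly (r k) w) < 1" if "w \<in> roots f" for w
    proof (rule ccontr)
      assume "\<not> ?thesis"
      then have "1 * nrm w v \<le> cmod (ipoly (r k) w) * nrm w v"
        using nrm_nonneg by (intro mult_right_mono) auto
      also have "\<dots> = nrm w (delta k)"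
        using nrm_iact[OF sv, of w "r k"] that f(2) r[OF k] by auto
      also have "\<dots> \<le> real ((2 * (d * H)) ^ d)" using nrm_delta_le[OF k] that f(2) by blast
      finally show False using big[OF that] by simp
    qed
    obtain N where N: "of_int N = (\<Prod>z\<in>roots f. ipoly (r k) z)" using norm_poly[OF lf] by blast
    have "\<bar>of_int N\<bar> = (\<Prod>z\<in>roots f. cmod (ipoly (r k) z))"
      using arg_cong[OF N, of cmod] by (simp add: prod_norm)
    also have "\<dots> = cmod (ipoly (r k) z) * (\<Prod>w\<in>roots f - {z}. cmod (ipoly (r k) w))"
      using fin z by (rule prod.remove)
    also have "\<dots> \<le> cmod (ipoly (r k) z) * 1"
      using lt by (intro mult_left_mono prod_le_1) (auto intro: less_imp_le)
    also have "\<dots> < 1" using lt[OF z] by simp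
    finally have "N = 0" by linarith
    then have "(\<Prod>z\<in>roots f. ipoly (r k) z) = 0" using N by simp
    then obtain w where "w \<in> roots f" "ipoly (r k) w = 0" using fin by (auto simp: prod_zero_iff)
    then show ?thesis using f(1) z unfolding conjugate_roots_def by blast
  qed
  obtain z where z: "z \<in> roots f" using f(3) by blast
  define s where "s = (\<Sum>k<d. smult (v k) (r k))"
  have "iact s v = (\<lambda>i. \<Sum>k<d. v k * delta k i)"
    unfolding s_def act_sum act_smult using r by simp
  then have "iact s v = v" using supported_expand[OF sv] by simp
  moreover have "ipoly s z = 0" unfolding s_def ipoly_sum using rz[OF _ z] by (simp add: ipoly_smult)
  ultimately have "nrm z v = 0" using nrm_iact[OF sv, of z s] z f(2) by auto
  then show False using big[OF z] by (metis linorder_not_less of_nat_0_le_iff)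
qed

text \<open>The roots of \<chi> outside \<open>f\<close> are roots of \<open>h\<close>, where the
  unit of \<open>dominant_unit\<close> is 1. Its constants \<open>c\<close> and \<open>K\<close>
  depend on the degree of \<open>f\<close>; \<open>c'\<close> and \<open>K'\<close> majorise them in
  terms of \<open>d\<close>.\<close>

lemma unit_for_root:
  assumes j: "j \<in> roots f" and f: "conjugate_roots f" "\<chi> = f ^ e * h" "roots f \<inter> roots h = {}"
    and sub: "roots f \<subseteq> set as"
  shows "\<exists>u u'. (\<forall>z\<in>set as. ipoly u z * ipoly u' z = 1) \<and> (\<forall>z\<in>set as - roots f. ipoly u z = 1)
    \<and> (\<forall>z\<in>roots f - {j, cnj j}. cmod (ipoly u z) < 1)
    \<and> (\<forall>z\<in>roots f. cmod (ipoly u z) \<le> real (unit_bound d (d * H)))"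
proof -
  define \<rho> where "\<rho> = d * H"
  have \<rho>: "1 \<le> \<rho>" unfolding \<rho>_def using d H by simp
  have lf: "lead_coeff f = 1" "card (roots f) = degree f" using f(1) unfolding conjugate_roots_def by auto
  have fin: "finite (roots f)" using lf(1) by (intro finite_roots) auto
  have "degree f = card (roots f)" using lf by simp
  also have "\<dots> \<le> card (set as)" using sub by (intro card_mono) auto
  also have "\<dots> \<le> d" using card_length[of as] length_as by simp
  finally have df: "degree f \<le> d" .
  have "0 < card (roots f)" using j fin by (auto simp: card_gt_0_iff)
  then have "1 \<le> degree f" using lf(2) by simp
  have h_le: "cmod (ipoly h z) \<le> real ((2 * \<rho>) ^ d)" if z: "z \<in> roots f" for z
  proof -
    have "lead_coeff h = 1"
      using arg_cong[OF f(2), of lead_coeff] chi(1) lf(1) by (simp add: lead_coeff_mult lead_coeff_power)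
    then obtain bs where bs: "map_poly of_int h = (\<Prod>\<mu>\<leftarrow>bs. [:- \<mu>, 1 :: complex:])" "length bs = degree h"
      using monic_linear_factors by blast
    have "cmod b \<le> \<rho>" if "b \<in> set bs" for b
    proof -
      have "ipoly h b = 0" unfolding bs(1) poly_prod_list_0 by (rule that)
      then have "b \<in> roots \<chi>" unfolding f(2) by (simp add: ipoly_simps)
      then show ?thesis using root_le unfolding roots_chi \<rho>_def by blast
    qed
    moreover have "cmod z \<le> \<rho>" using root_le sub z unfolding \<rho>_def by blast
    ultimately have *: "\<forall>b\<in>set bs. cmod (z - b) \<le> 2 * real \<rho>"
      by (metis add_mono mult_2 norm_triangle_ineq4 order_trans)
    have "cmod (poly (\<Prod>\<mu>\<leftarrow>bs. [:- \<mu>, 1:]) z) \<le> (2 * real \<rho>) ^ length bs"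
      using * by (induction bs) (auto simp: norm_mult intro!: mult_mono simp del: mult_pCons_left)
    also have "\<dots> \<le> (2 * real \<rho>) ^ d"
    proof -
      have "degree h \<le> degree \<chi>" using f(2) chi(3) by (intro dvd_imp_degree_le) auto
      then show ?thesis unfolding bs(2) using \<rho> chi(2) by (intro power_increasing) auto
    qed
    finally show ?thesis unfolding bs(1) by simp
  qed
  define n where "n = degree f"
  define c where "c = (8 * n * \<rho> ^ n) ^ n"
  define K where "K = (fact c * ((2 * \<rho>) ^ d) ^ n) ^ n"
  define c' where "c' = (8 * d * \<rho> ^ d) ^ d"
  define K' where "K' = (fact c' * ((2 * \<rho>) ^ d) ^ d) ^ d"
  have mono: "x ^ n \<le> y ^ d" if "1 \<le> x" "x \<le> y" for x y :: nat
  proof -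
    have "x ^ n \<le> x ^ d" using that(1) df unfolding n_def by (intro power_increasing)
    also have "\<dots> \<le> y ^ d" using that(2) by (intro power_mono) auto
    finally show ?thesis .
  qed
  have n1: "1 \<le> n" "n \<le> d" using \<open>1 \<le> degree f\<close> df unfolding n_def by auto
  have cc': "c \<le> c'" unfolding c_def c'_def using n1 \<rho> by (intro mono mult_mono) (auto intro: mono)
  have "(1 :: nat) \<le> (2 * \<rho>) ^ d" using \<rho> by simp
  then have KK': "K \<le> K'"
    unfolding K_def K'_def using cc'
    by (intro mono mult_mono fact_mono) (simp_all add: Suc_le_eq)
  have bound: "real (c * ((c + 1) ^ (K + 1)) ^ n) \<le> real (unit_bound d (d * H))"
  proof -
    have "(c + 1) ^ (K + 1) \<le> (c' + 1) ^ (K' + 1)"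
      using cc' KK' by (meson add_le_cancel_right le_add2 order_trans power_increasing power_mono zero_le)
    moreover have "1 \<le> (c + 1) ^ (K + 1)" by (intro one_le_power) simp
    ultimately have "((c + 1) ^ (K + 1)) ^ n \<le> ((c' + 1) ^ (K' + 1)) ^ d" by (intro mono)
    then have "c * ((c + 1) ^ (K + 1)) ^ n \<le> c' * ((c' + 1) ^ (K' + 1)) ^ d" using cc' by (intro mult_mono) auto
    then show ?thesis unfolding unit_bound_def c'_def K'_def \<rho>_def Let_def by (simp only: of_nat_le_iff)
  qed
  have "cmod z \<le> real \<rho>" if "z \<in> roots f" for z using root_le sub that unfolding \<rho>_def by blast
  moreover have "ipoly h z \<noteq> 0 \<and> cmod (ipoly h z) \<le> real ((2 * \<rho>) ^ d)" if "z \<in> roots f" for z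
    using h_le[OF that] f(3) that by blast
  ultimately obtain u u' where u: "\<forall>z\<in>roots f. ipoly u z * ipoly u' z = 1"
    "\<forall>z\<in>roots h. ipoly u z = 1 \<and> ipoly u' z = 1" "\<forall>z\<in>roots f - {j, cnj j}. cmod (ipoly u z) < 1"
    "\<forall>z\<in>roots f. cmod (ipoly u z) \<le> real (c * ((c + 1) ^ (K + 1)) ^ n)"
    using dominant_unit[OF f(1) j _ \<rho>, of h "(2 * \<rho>) ^ d"] unfolding c_def K_def n_def by blast
  have cases: "z \<in> roots f \<or> z \<in> roots h" if "z \<in> set as" for z
    using that unfolding roots_chi[symmetric] f(2) by (auto simp: ipoly_simps)
  show ?thesis
  proof (rule exI[of _ u], rule exI[of _ u'], intro conjI ballI)
    fix z
    show "ipoly u z * ipoly u' z = 1" if "z \<in> set as"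
      using cases[OF that] u(1,2) by (metis mult_1)
    show "ipoly u z = 1" if "z \<in> set as - roots f"
      using cases[of z] u(2) that by blast
    show "cmod (ipoly u z) < 1" if "z \<in> roots f - {j, cnj j}"
      using u(3) that by blast
    show "cmod (ipoly u z) \<le> real (unit_bound d (d * H))" if "z \<in> roots f"
      using u(4) that bound order.trans by blast
  qed
qed

end

section \<open>Explicit bounds and reduction of generators\<close>

text \<open>The bound of \<open>small_integer_solution\<close> for \<open>d\<close> equations in
  \<open>d\<close> unknowns.\<close>

definition solution_bound :: "nat \<Rightarrow> nat \<Rightarrow> nat" where
  "solution_bound d h = (let E = (2 * h) ^ (2 ^ d) in E * (d * E + 1) ^ d)"

text \<open>The inner \<open>solution_bound\<close> limits a generator recovered from its image
  under \<open>\<chi>'(A)\<close>, the factor \<open>(d * H) ^ d\<close> the growth of its iterates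
  under \<open>A\<close>, and the outer \<open>solution_bound\<close> the coefficients that express
  the basis by these iterates.\<close>

definition certificate_bound :: "nat \<Rightarrow> nat \<Rightarrow> nat" where
  "certificate_bound d H = solution_bound d
    ((d * H) ^ d * solution_bound d (d * ((2 * (d * H)) ^ d * unit_bound d (d * H))))"

text \<open>\<open>x\<close> witnesses solvability and may be arbitrarily large; the congruence of
  \<open>small_integer_solution\<close> is taken modulo 1.\<close>

lemma small_square_system_solution:
  fixes G :: "nat \<Rightarrow> nat \<Rightarrow> int"
  assumes "\<And>i. i < d \<Longrightarrow> (\<Sum>j<d. G i j * x j) = b i"
    and "\<And>i j. i < d \<Longrightarrow> j < d \<Longrightarrow> \<bar>G i j\<bar> \<le> int h" "\<And>i. i < d \<Longrightarrow> \<bar>b i\<bar> \<le> int h" "1 \<le> h"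
  shows "\<exists>y. (\<forall>i<d. (\<Sum>j<d. G i j * y j) = b i) \<and> (\<forall>j<d. \<bar>y j\<bar> \<le> int (solution_bound d h))"
proof -
  define es where "es = map (\<lambda>i. (G i, b i)) [0..<d]"
  have es: "\<exists>i<d. g = G i \<and> c = b i" if "(g, c) \<in> set es" for g c
    using that unfolding es_def by auto
  have "\<exists>y. (\<forall>(a, b) \<in> set es. (\<Sum>j\<in>{..<d}. a j * y j) = b)
    \<and> (\<forall>j\<in>{..<d}. \<bar>y j\<bar> \<le> int ((2 * h) ^ (2 ^ d)) * (int (card {..<d}) * int ((2 * h) ^ (2 ^ d)) + 1) ^ length es)
    \<and> (\<forall>j\<in>{..<d}. 1 dvd y j - x j)"
  proof (rule small_integer_solution[where h = "int h"])
    show "(\<Sum>j\<in>{..<d}. a j * x j) = c" if "(a, c) \<in> set es" for a c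
      using es[OF that] assms(1) by auto
    show "\<bar>c\<bar> \<le> int h \<and> (\<forall>j\<in>{..<d}. \<bar>a j\<bar> \<le> int h)" if "(a, c) \<in> set es" for a c
      using es[OF that] assms(2,3) by auto
    show "(2 * int h) ^ 2 ^ length es \<le> int ((2 * h) ^ (2 ^ d))" by (simp add: es_def)
  qed (use assms(4) in auto)
  then obtain y where y: "\<forall>(a, b) \<in> set es. (\<Sum>j<d. a j * y j) = b"
    "\<forall>j<d. \<bar>y j\<bar> \<le> int ((2 * h) ^ (2 ^ d)) * (int d * int ((2 * h) ^ (2 ^ d)) + 1) ^ d"
    by (auto simp: es_def)
  have "(\<Sum>j<d. G i j * y j) = b i" if "i < d" for i using y(1) that unfolding es_def by auto
  moreover have "int (solution_bound d h) = int ((2 * h) ^ (2 ^ d)) * (int d * int ((2 * h) ^ (2 ^ d)) + 1) ^ d"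
    unfolding solution_bound_def Let_def by (simp only: of_nat_mult of_nat_power of_nat_add of_nat_1)
  ultimately show ?thesis using y(2) by metis
qed

lemma solution_bound_ge: "1 \<le> h \<Longrightarrow> h \<le> solution_bound d h"
proof -
  assume h: "1 \<le> h"
  define E where "E = (2 * h) ^ (2 ^ d)"
  have "h \<le> (2 * h) ^ 1" by simp
  also have "\<dots> \<le> E" unfolding E_def using h by (intro power_increasing) auto
  finally have "h \<le> E" .
  also have "E \<le> E * (d * E + 1) ^ d" by simp
  finally show ?thesis unfolding solution_bound_def E_def[symmetric] Let_def .
qed

context bounded_matrix
begin

lemma unit_bound_ge_1: "1 \<le> unit_bound d (d * H)"
  unfolding unit_bound_def Let_def using d H by (simp add: Suc_le_eq)

text \<open>A coordinate as small as \<open>small_root_value\<close> provides, multiplied by a unit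
  at its largest.\<close>

definition nrm_bound :: nat where
  "nrm_bound = (2 * (d * H)) ^ d * unit_bound d (d * H)"

lemma nrm_bound_ge_1: "1 \<le> nrm_bound"
  unfolding nrm_bound_def using unit_bound_ge_1 d H by (simp add: Suc_le_eq)

text \<open>One step picks a root \<open>j\<close> with a small coordinate and multiplies by its
  unit: the coordinates at \<open>j\<close> and \<open>cnj j\<close> end up at most
  \<open>nrm_bound\<close>, the others at roots of \<open>f\<close> shrink. The number of steps
  depends on \<open>v\<close>, the bound reached does not.\<close>

lemma reduce_factor:
  assumes f: "conjugate_roots f" "\<chi> = f ^ e * h" "roots f \<inter> roots h = {}" "roots f \<subseteq> set as" "roots f \<noteq> {}"
    and v: "generator v"
  shows "\<exists>w. generator w \<and> (\<forall>z\<in>roots f. nrm z w \<le> nrm_bound)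
    \<and> (\<forall>z\<in>set as - roots f. nrm z w = nrm z v)"
proof -
  have fin: "finite (roots f)" using f(4) finite_subset by blast
  define P where "P j u u' \<longleftrightarrow> (\<forall>z\<in>set as. ipoly u z * ipoly u' z = 1) \<and> (\<forall>z\<in>set as - roots f. ipoly u z = 1)
    \<and> (\<forall>z\<in>roots f - {j, cnj j}. cmod (ipoly u z) < 1)
    \<and> (\<forall>z\<in>roots f. cmod (ipoly u z) \<le> real (unit_bound d (d * H)))" for j u u'
  have "\<exists>u u'. P j u u'" if "j \<in> roots f" for j
    unfolding P_def using that f(1-4) by (rule unit_for_root)
  then obtain U U' where P: "\<And>j. j \<in> roots f \<Longrightarrow> P j (U j) (U' j)" by metis
  have U: "\<And>j z. j \<in> roots f \<Longrightarrow> z \<in> set as \<Longrightarrow> ipoly (U j) z * ipoly (U' j) z = 1"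
    "\<And>j z. j \<in> roots f \<Longrightarrow> z \<in> set as - roots f \<Longrightarrow> ipoly (U j) z = 1"
    "\<And>j z. j \<in> roots f \<Longrightarrow> z \<in> roots f - {j, cnj j} \<Longrightarrow> cmod (ipoly (U j) z) < 1"
    "\<And>j z. j \<in> roots f \<Longrightarrow> z \<in> roots f \<Longrightarrow> cmod (ipoly (U j) z) \<le> unit_bound d (d * H)"
    using P unfolding P_def by blast+
  \<comment> \<open>The contraction has to be uniform: one unit is fixed for each of the finitely
    many \<open>j\<close>, and \<open>\<theta>\<close> is the largest of their absolute values at
    the roots other than \<open>j\<close> and \<open>cnj j\<close>. The 0 covers the case that there
    are none.\<close>
  define F where "F = insert 0 ((\<lambda>(j, z). cmod (ipoly (U j) z)) ` (SIGMA j:roots f. roots f - {j, cnj j}))"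
  define \<theta> where "\<theta> = Max F"
  have F: "finite F" "0 \<in> F" unfolding F_def using fin by auto
  have \<theta>0: "0 \<le> \<theta>" unfolding \<theta>_def using F by (rule Max_ge)
  have "\<theta> \<in> F" unfolding \<theta>_def using F by (intro Max_in) auto
  then have \<theta>1: "\<theta> < 1" unfolding F_def using U(3) by auto
  have U_le: "cmod (ipoly (U j) z) \<le> \<theta>" if "j \<in> roots f" "z \<in> roots f - {j, cnj j}" for j z
    unfolding \<theta>_def using F(1) that by (intro Max_ge) (auto simp: F_def)
  have bound1: "1 \<le> real nrm_bound"
    using nrm_bound_ge_1 by simp
  \<comment> \<open>Invariant: a coordinate exceeds the bound by no more than the remaining
    \<open>n\<close> contractions can remove.\<close>
  have step: "\<exists>w. generator w \<and> (\<forall>z\<in>roots f. nrm z w \<le> nrm_bound)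
      \<and> (\<forall>z\<in>set as - roots f. nrm z w = nrm z v)"
    if "generator v" "\<And>z. z \<in> roots f \<Longrightarrow> nrm z v * \<theta> ^ n \<le> nrm_bound" for n v
    using that
  proof (induction n arbitrary: v)
    case 0
    then show ?case by (intro exI[of _ v]) auto
  next
    case (Suc n)
    have sv: "supported d v" using Suc.prems(1) unfolding cyclic_vector_def by simp
    obtain j where j: "j \<in> roots f" "nrm j v \<le> real ((2 * (d * H)) ^ d)"
      using small_root_value[OF Suc.prems(1) f(1,4,5)] by blast
    define x where "x = iact (U j) v"
    have gx: "generator x" unfolding x_def using U(1)[OF j(1)] by (rule generator_unit[OF Suc.prems(1)])
    have nx: "nrm z x = cmod (ipoly (U j) z) * nrm z v" if "z \<in> set as" for z
      unfolding x_def by (rule nrm_iact[OF sv that])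
    have "nrm z x * \<theta> ^ n \<le> nrm_bound" if z: "z \<in> roots f" for z
    proof (cases "z \<in> {j, cnj j}")
      case True
      then have "nrm z v \<le> real ((2 * (d * H)) ^ d)" using j nrm_cnj f(4) by auto
      then have "nrm z x \<le> unit_bound d (d * H) * real ((2 * (d * H)) ^ d)"
        using nx z f(4) U(4)[OF j(1) z] nrm_nonneg by (metis mult_mono norm_ge_zero of_nat_0_le_iff subsetD)
      also have "\<dots> = nrm_bound" unfolding nrm_bound_def by simp
      finally have "nrm z x * \<theta> ^ n \<le> real nrm_bound * 1"
        using \<theta>0 \<theta>1 by (intro mult_mono power_le_one) auto
      then show ?thesis by simp
    next
      case False
      have "nrm z x \<le> \<theta> * nrm z v"
      proof -
        have *: "z \<in> set as" "z \<in> roots f - {j, cnj j}" using z f(4) False by blast+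
        show ?thesis unfolding nx[OF *(1)] by (intro mult_right_mono U_le[OF j(1) *(2)] nrm_nonneg)
      qed
      then have "nrm z x * \<theta> ^ n \<le> (\<theta> * nrm z v) * \<theta> ^ n"
        using \<theta>0 by (intro mult_right_mono) auto
      also have "\<dots> = nrm z v * \<theta> ^ Suc n" by simp
      also have "\<dots> \<le> nrm_bound" by (rule Suc.prems(2)[OF z])
      finally show ?thesis .
    qed
    from Suc.IH[OF gx this] obtain w where w: "generator w" "\<forall>z\<in>roots f. nrm z w \<le> nrm_bound"
      "\<forall>z\<in>set as - roots f. nrm z w = nrm z x" by blast
    have "nrm z x = nrm z v" if "z \<in> set as - roots f" for z
      using nx[of z] U(2)[OF j(1) that] that by simp
    then show ?case using w by auto
  qed
  define m where "m = 1 + (\<Sum>z\<in>roots f. nrm z v)"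
  have m: "nrm z v \<le> m" if "z \<in> roots f" for z
    unfolding m_def using member_le_sum[OF that, of "\<lambda>z. nrm z v"] nrm_nonneg fin by simp
  have m1: "1 \<le> m" unfolding m_def using nrm_nonneg by (simp add: sum_nonneg)
  obtain n where "\<theta> ^ n < nrm_bound / m"
    using real_arch_pow_inv[of "nrm_bound / m" \<theta>] bound1 m1 \<theta>1 by auto
  then have mn: "m * \<theta> ^ n \<le> nrm_bound" using m1 by (simp add: field_simps)
  have "nrm z v * \<theta> ^ n \<le> nrm_bound" if "z \<in> roots f" for z
    using mult_right_mono[OF m[OF that], of "\<theta> ^ n"] \<theta>0 mn by simp
  then show ?thesis using step[OF v] by blast
qed

text \<open>Reducing at the roots of one factor leaves the coordinates at all other roots unchanged,
  so the number of large coordinates drops.\<close>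

lemma reduced_generator:
  assumes "generator v"
  shows "\<exists>w. generator w \<and> (\<forall>z\<in>set as. nrm z w \<le> nrm_bound)"
  using assms
proof (induction "card {z \<in> set as. \<not> nrm z v \<le> nrm_bound}" arbitrary: v rule: less_induct)
  case less
  show ?case
  proof (cases "\<forall>z\<in>set as. nrm z v \<le> nrm_bound")
    case True
    then show ?thesis using less.prems by blast
  next
    case False
    then obtain j where j: "j \<in> set as" "\<not> nrm j v \<le> nrm_bound" by blast
    obtain f h e where f: "conjugate_roots f" "j \<in> roots f" "\<chi> = f ^ e * h" "roots f \<inter> roots h = {}"
      using conjugate_roots_factor[OF chi(1)] j(1) unfolding roots_chi[symmetric] by metis
    have sub: "roots f \<subseteq> set as"
      using f(1,2) j(1) unfolding roots_chi[symmetric] conjugate_roots_def by blast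
    obtain w where w: "generator w" "\<forall>z\<in>roots f. nrm z w \<le> nrm_bound"
      "\<forall>z\<in>set as - roots f. nrm z w = nrm z v"
      using reduce_factor[OF f(1,3,4) sub _ less.prems] f(2) by blast
    have "{z \<in> set as. \<not> nrm z w \<le> nrm_bound} \<subset> {z \<in> set as. \<not> nrm z v \<le> nrm_bound}"
    proof
      show "{z \<in> set as. \<not> nrm z w \<le> nrm_bound} \<subseteq> {z \<in> set as. \<not> nrm z v \<le> nrm_bound}"
      proof
        fix x
        assume x: "x \<in> {z \<in> set as. \<not> nrm z w \<le> nrm_bound}"
        then have "x \<notin> roots f" using w(2) by blast
        then show "x \<in> {z \<in> set as. \<not> nrm z v \<le> nrm_bound}" using w(3) x by auto
      qed
      show "{z \<in> set as. \<not> nrm z w \<le> nrm_bound} \<noteq> {z \<in> set as. \<not> nrm z v \<le> nrm_bound}"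
        using j f(2) w(2) by blast
    qed
    then have "card {z \<in> set as. \<not> nrm z w \<le> nrm_bound} < card {z \<in> set as. \<not> nrm z v \<le> nrm_bound}"
      by (intro psubset_card_mono) auto
    then show ?thesis using less.hyps w(1) by blast
  qed
qed

section \<open>From small coordinates to a small generator and its certificate\<close>

text \<open>Reduction modulo \<chi> brings every polynomial below degree \<open>d\<close>, so
  \<open>d\<close> iterates suffice.\<close>

lemma generator_coefficients:
  assumes v: "generator v" and k: "k < d"
  shows "\<exists>c. \<forall>l. (\<Sum>i<d. c i * (apply_mat d (mat_fun d A) ^^ i) v l) = delta k l"
proof -
  have sv: "supported d v" using v unfolding cyclic_vector_def by simp
  obtain r where r: "iact r v = delta k" using v supported_delta[OF k] unfolding cyclic_vector_def by blast
  obtain q s where s: "r = \<chi> * q + s" "s = 0 \<or> degree s < degree \<chi>" using monic_division[OF chi(1)] by blast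
  have "iact (\<chi> * q) v = (\<lambda>_. 0)" unfolding act_mult using iact_chi[OF supported_act[OF sv]] by simp
  then have "iact s v = delta k" using r unfolding s(1) act_add by simp
  moreover have "degree s < d" using s(2) chi(2) d by auto
  ultimately show ?thesis by (metis act_altdef)
qed

text \<open>The matrix with columns \<open>A ^ i v\<close> for \<open>i < d\<close> has an integer
  right inverse, so its determinant is nonzero and no nonzero remainder modulo \<chi> can kill
  \<open>v\<close>.\<close>

lemma generator_annihilator:
  assumes v: "generator v" and p: "iact p v = (\<lambda>_. 0)"
  shows "\<chi> dvd p"
proof -
  have sv: "supported d v" using v unfolding cyclic_vector_def by simp
  obtain q s where s: "p = \<chi> * q + s" "s = 0 \<or> degree s < degree \<chi>" using monic_division[OF chi(1)] by blast
  have "iact (\<chi> * q) v = (\<lambda>_. 0)" unfolding act_mult using iact_chi[OF supported_act[OF sv]] by simp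
  then have s0: "iact s v = (\<lambda>_. 0)" using p unfolding s(1) act_add by simp
  have ds: "degree s < d" using s(2) chi(2) d by auto
  define W where "W = mat d d (\<lambda>(l, i). (apply_mat d (mat_fun d A) ^^ i) v l)"
  obtain c where c: "\<And>k l. k < d \<Longrightarrow> (\<Sum>i<d. c k i * (apply_mat d (mat_fun d A) ^^ i) v l) = delta k l"
    using generator_coefficients[OF v] by metis
  define C where "C = mat d d (\<lambda>(i, k). c k i)"
  have W: "W \<in> carrier_mat d d" and C: "C \<in> carrier_mat d d" unfolding W_def C_def by auto
  have "W * C = 1\<^sub>m d"
  proof (rule eq_matI)
    fix l k assume "l < dim_row (1\<^sub>m d)" "k < dim_col (1\<^sub>m d)"
    then show "(W * C) $$ (l, k) = 1\<^sub>m d $$ (l, k)"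
      using c[of k l] by (simp add: W_def C_def times_mat_def scalar_prod_def lessThan_atLeast0 delta_def mult.commute)
  qed (auto simp: W_def C_def)
  then have "det W * det C = 1" using det_mult[OF W C] by simp
  then have "det W \<noteq> 0" by auto
  define x where "x = vec d (coeff s)"
  have x: "x \<in> carrier_vec d" unfolding x_def by simp
  have "W *\<^sub>v x = 0\<^sub>v d"
  proof (rule eq_vecI)
    fix l assume "l < dim_vec (0\<^sub>v d :: int vec)"
    then show "(W *\<^sub>v x) $ l = 0\<^sub>v d $ l"
      using fun_cong[OF s0, of l] unfolding act_altdef[OF ds]
      by (simp add: W_def x_def scalar_prod_def lessThan_atLeast0 mult.commute)
  qed (simp add: W_def)
  moreover have "adj_mat W *\<^sub>v 0\<^sub>v d = 0\<^sub>v d" using adj_mat(1)[OF W] by (intro eq_vecI) auto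
  ultimately have "(adj_mat W * W) *\<^sub>v x = 0\<^sub>v d" using adj_mat(1)[OF W] W x by (simp add: assoc_mult_mat_vec)
  then have "(det W \<cdot>\<^sub>m 1\<^sub>m d) *\<^sub>v x = 0\<^sub>v d" unfolding adj_mat(3)[OF W] .
  moreover have "((det W \<cdot>\<^sub>m 1\<^sub>m d) *\<^sub>v x) $ i = det W * coeff s i" if "i < d" for i
  proof -
    have "((det W \<cdot>\<^sub>m 1\<^sub>m d) *\<^sub>v x) $ i = (\<Sum>j<d. det W * (if j = i then 1 else 0) * coeff s j)"
      using that unfolding x_def by (simp add: scalar_prod_def lessThan_atLeast0)
    also have "\<dots> = (\<Sum>j<d. if j = i then det W * coeff s j else 0)" by (intro sum.cong) auto
    finally show ?thesis using that by simp
  qed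
  ultimately have "det W * coeff s i = 0" if "i < d" for i
    using that by (metis index_zero_vec(1))
  then have "coeff s i = 0" for i using \<open>det W \<noteq> 0\<close> ds by (cases "i < d") (auto simp: coeff_eq_0)
  then have "s = 0" by (intro poly_eqI) simp
  then show ?thesis using s(1) by simp
qed

text \<open>The ambiguity of a vector with prescribed image under \<open>\<chi>'(A)\<close> is nilpotent, by comparing the
  multiplicities of the roots of \<open>\<chi>\<close> and \<open>\<chi>'\<close>.\<close>

lemma generator_cong_pderiv:
  assumes v: "generator v" and w: "supported d w" and eq: "iact (pderiv \<chi>) w = iact (pderiv \<chi>) v"
  shows "generator w"
proof -
  have sv: "supported d v" using v unfolding cyclic_vector_def by simp
  have "supported d (\<lambda>i. w i - v i)" using sv w unfolding supported_def by simp
  then obtain r where r: "iact r v = (\<lambda>i. w i - v i)" using v unfolding cyclic_vector_def by blast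
  have "iact (pderiv \<chi> * r) v = (\<lambda>_. 0)" unfolding act_mult r act_vec_diff eq by simp
  then have dvd: "\<chi> dvd pderiv \<chi> * r" by (rule generator_annihilator[OF v])
  have "ipoly r z = 0" if z: "z \<in> set as" for z
  proof (cases "r = 0")
    case False
    let ?X = "map_poly of_int \<chi> :: complex poly" and ?r = "map_poly of_int r :: complex poly"
    have X: "?X \<noteq> 0" "?r \<noteq> 0" using chi(3) False by auto
    have pX: "pderiv ?X \<noteq> 0" using chi(2) d by (simp add: pderiv_eq_0_iff)
    have "?X dvd pderiv ?X * ?r"
      using of_int_poly_hom.hom_dvd[OF dvd, where 'a = complex]
      by (simp add: of_int_poly_hom.hom_mult of_int_hom.map_poly_pderiv)
    then have "order z ?X \<le> order z (pderiv ?X * ?r)" using pX X by (intro dvd_imp_order_le) auto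
    also have "\<dots> = order z (pderiv ?X) + order z ?r" using pX X by (intro order_mult) auto
    finally have "order z ?X \<le> order z (pderiv ?X) + order z ?r" .
    moreover have "poly ?X z = 0" using z roots_chi by blast
    then have "order z ?X = Suc (order z (pderiv ?X))"
      using X by (intro order_pderiv) (auto simp: order_root)
    ultimately have "order z ?r \<noteq> 0" by simp
    then show ?thesis using order_root by blast
  qed simp
  \<comment> \<open>\<open>w\<close> is the image of \<open>v\<close> under \<open>1 + r\<close>,
    which takes the value 1 at every root.\<close>
  then have "ipoly (1 + r) z * ipoly 1 z = 1" if "z \<in> set as" for z using that by (simp add: ipoly_simps)
  then have "generator (iact (1 + r) v)" by (rule generator_unit[OF v])
  then show ?thesis unfolding act_add r by simp
qed

lemma bounded_generator:
  assumes "generator v"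
  shows "\<exists>w. generator w \<and> (\<forall>j<d. \<bar>w j\<bar> \<le> int (solution_bound d (d * nrm_bound)))"
proof -
  obtain x where x: "generator x" "\<forall>z\<in>set as. nrm z x \<le> nrm_bound" using reduced_generator[OF assms] by blast
  have sx: "supported d x" using x(1) unfolding cyclic_vector_def by simp
  have iact_sum: "iact p y i = (\<Sum>j<d. iact p (delta j) i * y j)" if "supported d y" for p y i
    by (subst supported_expand[OF that]) (simp add: act_vec_sum act_vec_scale mult.commute)
  have le: "\<bar>iact (pderiv \<chi>) y i\<bar> \<le> int (d * nrm_bound)"
    if "\<And>z. z \<in> set as \<Longrightarrow> nrm z y \<le> nrm_bound" "i < d" for y i
  proof -
    have "real_of_int \<bar>iact (pderiv \<chi>) y i\<bar> \<le> real_of_int (int (d * nrm_bound))"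
      using iact_pderiv_le[OF that] by simp
    then show ?thesis by (simp only: of_int_le_iff)
  qed
  have "(2 * (d * H)) ^ d \<le> nrm_bound"
    unfolding nrm_bound_def using mult_le_mono2[OF unit_bound_ge_1, of "(2 * (d * H)) ^ d"]
    by (simp only: mult_1_right)
  then have Cb: "real ((2 * (d * H)) ^ d) \<le> real nrm_bound" by (rule of_nat_mono)
  \<comment> \<open>The columns of the system are the images of the basis vectors, whose coordinates
    obey the same bound as those of \<open>x\<close>; one constant covers the matrix and the
    right-hand side.\<close>
  have "nrm z (delta j) \<le> nrm_bound" if "j < d" "z \<in> set as" for j z
    using nrm_delta_le[OF that] Cb by (rule order.trans)
  then have G: "\<bar>iact (pderiv \<chi>) (delta j) i\<bar> \<le> int (d * nrm_bound)" if "i < d" "j < d" for i j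
    using that by (intro le) auto
  have b: "\<bar>iact (pderiv \<chi>) x i\<bar> \<le> int (d * nrm_bound)" if "i < d" for i
    using that x(2) by (intro le) auto
  have "1 \<le> d * nrm_bound" using d nrm_bound_ge_1 by (simp add: Suc_le_eq)
  from small_square_system_solution[of d "\<lambda>i j. iact (pderiv \<chi>) (delta j) i" x, OF iact_sum[OF sx, symmetric] G b this]
  obtain y where y: "\<forall>i<d. (\<Sum>j<d. iact (pderiv \<chi>) (delta j) i * y j) = iact (pderiv \<chi>) x i"
    "\<forall>j<d. \<bar>y j\<bar> \<le> int (solution_bound d (d * nrm_bound))"
    by blast
  define w where "w j = (if j < d then y j else 0)" for j
  have sw: "supported d w" unfolding w_def supported_def by simp
  have "iact (pderiv \<chi>) w i = iact (pderiv \<chi>) x i" for i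
  proof (cases "i < d")
    case True
    then show ?thesis using y(1) unfolding iact_sum[OF sw] by (simp add: w_def)
  next
    case False
    then show ?thesis
      using supported_act[OF sw, of A "pderiv \<chi>"] supported_act[OF sx, of A "pderiv \<chi>"] unfolding supported_def by simp
  qed
  then have "generator w" using generator_cong_pderiv[OF x(1) sw] by blast
  then show ?thesis using y(2) by (intro exI[of _ w]) (simp add: w_def)
qed

text \<open>Turns cyclicity into finitely many integer equations for the iterates \<open>w\<close>
  of a generator and the coefficients \<open>c\<close> that combine them to the basis. Some
  coefficients exist for every generator; as they solve a system with bounded entries, they can be
  exchanged for bounded ones.\<close>

lemma bounded_certificate:
  assumes "generator v"
  shows "\<exists>w c. (\<forall>i<d. \<forall>l<d. w (Suc i) l = (\<Sum>m<d. A $$ (l, m) * w i m))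
    \<and> (\<forall>k<d. \<forall>l<d. (\<Sum>i<d. c k i * w i l) = delta k l)
    \<and> (\<forall>i\<le>d. \<forall>l<d. \<bar>w i l\<bar> \<le> int (certificate_bound d H))
    \<and> (\<forall>k<d. \<forall>i<d. \<bar>c k i\<bar> \<le> int (certificate_bound d H))"
proof -
  define X where "X = solution_bound d (d * nrm_bound)"
  define Y where "Y = (d * H) ^ d * X"
  obtain x where x: "generator x" "\<forall>j<d. \<bar>x j\<bar> \<le> int X" using bounded_generator[OF assms] unfolding X_def by blast
  have dH: "1 \<le> d * H" using d H by simp
  have "1 \<le> d * nrm_bound" using d nrm_bound_ge_1 by (simp add: Suc_le_eq)
  then have X1: "1 \<le> X" using solution_bound_ge[of "d * nrm_bound" d] unfolding X_def by linarith
  then have Y1: "1 \<le> Y" unfolding Y_def using dH by (simp add: Suc_le_eq)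
  have cb: "certificate_bound d H = solution_bound d Y"
    unfolding certificate_bound_def Y_def X_def nrm_bound_def ..
  define w where "w i = (apply_mat d (mat_fun d A) ^^ i) x" for i
  have w_Suc: "w (Suc i) l = (\<Sum>m<d. A $$ (l, m) * w i m)" if "l < d" for i l
    using that unfolding w_def by (simp add: apply_mat_def mat_fun_def)
  have "\<bar>w i l\<bar> \<le> int ((d * H) ^ i * X)" if "l < d" for i l
    using that
  proof (induction i arbitrary: l)
    case 0
    then show ?case using x(2) by (simp add: w_def)
  next
    case (Suc i)
    have "\<bar>w (Suc i) l\<bar> \<le> (\<Sum>m<d. \<bar>A $$ (l, m) * w i m\<bar>)" unfolding w_Suc[OF Suc.prems] by (rule sum_abs)
    also have "\<dots> \<le> (\<Sum>m<d. int H * int ((d * H) ^ i * X))"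
      unfolding abs_mult using Suc A_le by (intro sum_mono mult_mono) auto
    finally show ?case by (simp add: mult_ac)
  qed
  moreover have "(d * H) ^ i * X \<le> Y" if "i \<le> d" for i
    unfolding Y_def using that dH by (intro mult_right_mono power_increasing) auto
  ultimately have wY: "\<bar>w i l\<bar> \<le> int Y" if "i \<le> d" "l < d" for i l
    using that by (meson of_nat_mono order_trans)
  have "\<exists>c. (\<forall>l<d. (\<Sum>i<d. w i l * c i) = delta k l) \<and> (\<forall>i<d. \<bar>c i\<bar> \<le> int (solution_bound d Y))"
    if k: "k < d" for k
  proof -
    obtain c where c: "\<And>l. (\<Sum>i<d. c i * w i l) = delta k l"
      using generator_coefficients[OF x(1) k] unfolding w_def by blast
    have "\<bar>delta k l :: int\<bar> \<le> int Y" for l using Y1 by (simp add: delta_def)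
    then show ?thesis
      using small_square_system_solution[of d "\<lambda>l i. w i l" c "delta k" Y] c wY Y1 by (simp add: mult.commute)
  qed
  then obtain c where c: "\<And>k l. k < d \<Longrightarrow> l < d \<Longrightarrow> (\<Sum>i<d. w i l * c k i) = delta k l"
    "\<And>k i. k < d \<Longrightarrow> i < d \<Longrightarrow> \<bar>c k i\<bar> \<le> int (solution_bound d Y)"
    by metis
  have "int Y \<le> int (solution_bound d Y)" using solution_bound_ge[OF Y1, of d] by simp
  then have w_le: "\<bar>w i l\<bar> \<le> int (solution_bound d Y)" if "i \<le> d" "l < d" for i l
    using wY[OF that] by linarith
  show ?thesis
    unfolding cb
  proof (rule exI[of _ w], rule exI[of _ c], intro conjI allI impI)
    show "(\<Sum>i<d. c k i * w i l) = delta k l" if "k < d" "l < d" for k l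
      using c(1)[OF that] by (simp only: mult.commute)
  qed (simp_all only: w_Suc w_le c(2))
qed

end

section \<open>Generators of the mapping torus\<close>

locale integral_torus =
  fixes d :: nat and A :: "int mat"
  assumes d: "0 < d" and GL: "A \<in> GL_int d"
begin

abbreviation Z :: "int vec monoid" where "Z \<equiv> int_vec_group d"
abbreviation T :: "(int vec \<times> int) monoid" where "T \<equiv> mapping_torus Z (mat_auto d A)"
abbreviation P :: "int \<Rightarrow> int vec \<Rightarrow> int vec" where "P m \<equiv> mat_auto d A [^]\<^bsub>AutoGroup Z\<^esub> m"
abbreviation iact :: "int poly \<Rightarrow> (nat \<Rightarrow> int) \<Rightarrow> nat \<Rightarrow> int" where "iact \<equiv> act d (mat_fun d A)"

definition fv :: "int vec \<Rightarrow> nat \<Rightarrow> int" where "fv x i = (if i < d then x $ i else 0)"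

sublocale Z: group Z by (rule group_int_vec_group)

lemma phi: "mat_auto d A \<in> auto Z" by (rule mat_auto_in_auto[OF GL])

sublocale T: group T by (rule Z.group_mapping_torus[OF phi])

lemma A: "A \<in> carrier_mat d d" using GL by (simp add: GL_int_def)

lemma carrier_T: "(a, m) \<in> carrier T \<longleftrightarrow> a \<in> carrier_vec d"
  by (simp add: mapping_torus_simps monoid_vec_simps)

lemma mult_T: "(a, m) \<otimes>\<^bsub>T\<^esub> (b, n) = (a + P m b, m + n)"
  by (simp add: mapping_torus_simps monoid_vec_simps)

lemma one_T: "\<one>\<^bsub>T\<^esub> = (0\<^sub>v d, 0)"
  by (simp add: mapping_torus_simps monoid_vec_simps)

lemma P:
  "a \<in> carrier_vec d \<Longrightarrow> P m a \<in> carrier_vec d"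
  "a \<in> carrier_vec d \<Longrightarrow> P (m + n) a = P m (P n a)"
  "a \<in> carrier_vec d \<Longrightarrow> P 0 a = a"
  "a \<in> carrier_vec d \<Longrightarrow> P 1 a = A *\<^sub>v a"
  "P m (0\<^sub>v d) = 0\<^sub>v d"
  using auto_closed[OF Z.auto_int_pow(1)[OF phi], of a m] Z.auto_int_pow(2,3,4)[OF phi]
    Z.auto_one[OF Z.auto_int_pow(1)[OF phi], of m]
  by (simp_all add: monoid_vec_simps mat_auto_def del: int_pow_0)

lemma fv_simps:
  "x \<in> carrier_vec d \<Longrightarrow> y \<in> carrier_vec d \<Longrightarrow> fv (x + y) = (\<lambda>i. fv x i + fv y i)"
  "x \<in> carrier_vec d \<Longrightarrow> fv (- x) = (\<lambda>i. - fv x i)"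
  "fv (0\<^sub>v d) = (\<lambda>_. 0)" "supported d (fv x)"
  "supported d f \<Longrightarrow> fv (vec d f) = f"
  by (auto simp: fv_def supported_def fun_eq_iff)

lemma vec_fv: "x \<in> carrier_vec d \<Longrightarrow> vec d (fv x) = x"
  by (auto simp: fv_def intro!: eq_vecI)

lemma fv_mult: "x \<in> carrier_vec d \<Longrightarrow> fv (A *\<^sub>v x) = apply_mat d (mat_fun d A) (fv x)"
  using A by (auto simp: fv_def apply_mat_def mat_fun_def scalar_prod_def lessThan_atLeast0 fun_eq_iff intro!: sum.cong)

text \<open>The part \<open>c\<close> cancels because addition of vectors is commutative.
  Consequently, subgroups of \<open>\<int>\<^sup>d\<close> stable under all \<open>P n\<close> are
  normal in the torus.\<close>

lemma conj_T:
  assumes "c \<in> carrier_vec d" "w \<in> carrier_vec d"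
  shows "(c, n) \<otimes>\<^bsub>T\<^esub> (w, 0) \<otimes>\<^bsub>T\<^esub> inv\<^bsub>T\<^esub> (c, n) = (P n w, 0)"
proof -
  have e: "(c, n) \<otimes>\<^bsub>T\<^esub> (w, 0) = (P n w, 0) \<otimes>\<^bsub>T\<^esub> (c, n)"
    unfolding mult_T using assms P(1)[OF assms(2), of n] by (simp add: P(3) comm_add_vec del: int_pow_0)
  have c: "(P n w, 0) \<in> carrier T" "(c, n) \<in> carrier T"
    using assms P(1) by (simp_all add: carrier_T)
  show ?thesis
    unfolding e using T.m_assoc[OF c T.inv_closed[OF c(2)]] T.r_inv[OF c(2)] T.r_one[OF c(1)]
    by (simp only:)
qed

lemma inv_T_0: "w \<in> carrier_vec d \<Longrightarrow> inv\<^bsub>T\<^esub> (w, 0) = (- w, 0)"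
  by (intro T.inv_equality) (simp_all add: mult_T carrier_T P(3) one_T del: int_pow_0)

lemma snd_pow: "x \<in> carrier T \<Longrightarrow> snd (x [^]\<^bsub>T\<^esub> (k :: int)) = k * snd x"
proof -
  assume x: "x \<in> carrier T"
  have nat: "snd (x [^]\<^bsub>T\<^esub> n) = int n * snd x" for n :: nat
  proof (induction n)
    case (Suc n)
    obtain a m b l where "x [^]\<^bsub>T\<^esub> n = (a, m)" "x = (b, l)" by fastforce
    then show ?case using Suc by (simp add: mult_T algebra_simps)
  qed (simp add: one_T)
  have inv: "snd (inv\<^bsub>T\<^esub> y) = - snd y" if "y \<in> carrier T" for y
  proof -
    obtain a m b l where "inv\<^bsub>T\<^esub> y = (a, m)" "y = (b, l)" by fastforce
    then show ?thesis using T.l_inv[OF that] by (simp add: mult_T one_T)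
  qed
  show ?thesis
  proof (cases "k < 0")
    case True
    then show ?thesis unfolding int_pow_def2 by (simp only: if_True inv[OF T.nat_pow_closed[OF x]] nat) simp
  next
    case False
    then show ?thesis unfolding int_pow_def2 by (simp only: if_False nat) simp
  qed
qed

text \<open>If all elements were powers of \<open>x\<close>, then \<open>t\<close> would force
  \<open>snd x\<close> to be nonzero. Hence only the trivial power has exponent 0 in
  \<open>t\<close>, but a unit vector has exponent 0 as well.\<close>

lemma not_generated_by_one:
  assumes "S \<subseteq> carrier T" "finite S" "card S \<le> 1"
  shows "generate T S \<noteq> carrier T"
proof
  assume gen: "generate T S = carrier T"
  obtain x where x: "x \<in> carrier T" "S \<subseteq> {x}"
  proof (cases "S = {}")
    case True
    then show ?thesis using that[of "\<one>\<^bsub>T\<^esub>"] by simp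
  next
    case False
    then obtain x where "x \<in> S" by blast
    then show ?thesis using that[of x] assms card_le_Suc0_iff_eq[of S] by auto
  qed
  have "carrier T \<subseteq> {x [^]\<^bsub>T\<^esub> (k :: int) | k. k \<in> UNIV}"
    using T.mono_generate[OF x(2)] T.generate_pow[OF x(1)] gen by auto
  moreover have "(0\<^sub>v d, 1) \<in> carrier T" "(unit_vec d 0, 0) \<in> carrier T" by (simp_all add: carrier_T)
  ultimately obtain k l :: int where kl: "(0\<^sub>v d, 1) = x [^]\<^bsub>T\<^esub> k" "(unit_vec d 0, 0) = x [^]\<^bsub>T\<^esub> l" by blast
  have "k * snd x = 1" using snd_pow[OF x(1), of k] kl(1)[symmetric] by simp
  moreover have "l * snd x = 0" using snd_pow[OF x(1), of l] kl(2)[symmetric] by simp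
  ultimately have "l = 0" by auto
  then have "(unit_vec d 0 :: int vec, 0 :: int) = (0\<^sub>v d, 0)" using kl(2) by (simp add: one_T)
  then have "(unit_vec d 0 :: int vec) $ 0 = 0\<^sub>v d $ 0" by simp
  then show False using d by simp
qed

lemma rank_two: "group_rank T = 2 \<longleftrightarrow> (\<exists>S\<subseteq>carrier T. finite S \<and> card S = 2 \<and> generate T S = carrier T)"
  (is "_ \<longleftrightarrow> ?R")
proof
  let ?Q = "\<lambda>n. \<exists>S\<subseteq>carrier T. finite S \<and> card S = n \<and> generate T S = carrier T"
  have "\<exists>n. ?Q n" using finitely_generated_mapping_torus_int_vec_group[OF GL] by blast
  then have "?Q (group_rank T)" unfolding group_rank_def by (rule LeastI_ex)
  then show "group_rank T = 2 \<Longrightarrow> ?R" by simp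
  assume ?R
  then show "group_rank T = 2"
    unfolding group_rank_def
  proof (rule Least_equality)
    fix n assume "?Q n"
    then show "2 \<le> n" using not_generated_by_one by (metis One_nat_def Suc_1 not_less_eq_eq)
  qed
qed

text \<open>\<open>v\<close> and \<open>t\<close> generate: the vectors in the generated subgroup
  form a group \<open>L\<close> that conjugation by \<open>t\<close> makes stable under
  \<open>A\<close>, so it contains all \<open>r(A) v\<close>.\<close>

lemma rank_two_if_cyclic:
  assumes "cyclic_vector d A v"
  shows "group_rank T = 2"
proof -
  define S where "S = {(vec d v, 0), (0\<^sub>v d, 1 :: int)}"
  define H where "H = generate T S"
  have v: "supported d v" using assms unfolding cyclic_vector_def by simp
  have S: "S \<subseteq> carrier T" unfolding S_def by (simp add: carrier_T)
  have H: "subgroup H T" unfolding H_def by (rule T.generate_is_subgroup[OF S])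
  have gens: "(vec d v, 0) \<in> H" "(0\<^sub>v d, 1) \<in> H" unfolding H_def S_def by (auto intro: generate.incl)
  define L where "L = {w. w \<in> carrier_vec d \<and> (w, 0) \<in> H}"
  have L_add: "x + y \<in> L" if "x \<in> L" "y \<in> L" for x y
    using subgroup.m_closed[OF H, of "(x, 0)" "(y, 0)"] that
    unfolding L_def by (simp add: mult_T P(3) del: int_pow_0)
  have L_uminus: "- x \<in> L" if "x \<in> L" for x
    using subgroup.m_inv_closed[OF H, of "(x, 0)"] that unfolding L_def by (simp add: inv_T_0)
  have L_0: "0\<^sub>v d \<in> L" using subgroup.one_closed[OF H] unfolding L_def by (simp add: one_T)
  have L_smult: "c \<cdot>\<^sub>v x \<in> L" if x: "x \<in> L" for c x
  proof (induction c rule: int_induct[where k = 0])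
    case base
    have "0 \<cdot>\<^sub>v x = 0\<^sub>v d" using x by (intro eq_vecI) (auto simp: L_def)
    then show ?case using L_0 by simp
  next
    case (step1 i)
    have "(i + 1) \<cdot>\<^sub>v x = i \<cdot>\<^sub>v x + x" using x by (intro eq_vecI) (auto simp: L_def algebra_simps)
    then show ?case using L_add[OF step1(2) x] by simp
  next
    case (step2 i)
    have "(i - 1) \<cdot>\<^sub>v x = i \<cdot>\<^sub>v x + - x" using x by (intro eq_vecI) (auto simp: L_def algebra_simps)
    then show ?case using L_add[OF step2(2) L_uminus[OF x]] by simp
  qed
  have L_phi: "A *\<^sub>v x \<in> L" if x: "x \<in> L" for x
  proof -
    have "(0\<^sub>v d, 1) \<otimes>\<^bsub>T\<^esub> (x, 0) \<otimes>\<^bsub>T\<^esub> inv\<^bsub>T\<^esub> (0\<^sub>v d, 1) \<in> H"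
      using x gens(2) unfolding L_def by (intro subgroup.m_closed[OF H] subgroup.m_inv_closed[OF H]) auto
    then show ?thesis using x A unfolding L_def by (simp add: conj_T P(4))
  qed
  have "vec d (iact r v) \<in> L" for r
  proof (induction r)
    case 0
    have "vec d (\<lambda>_. 0) = (0\<^sub>v d :: int vec)" by auto
    then show ?case using L_0 by simp
  next
    case (pCons c p)
    let ?w = "iact p v"
    have "fv (A *\<^sub>v vec d ?w) = apply_mat d (mat_fun d A) ?w"
      using fv_mult[of "vec d ?w"] fv_simps(5)[OF supported_act[OF v]] by simp
    then have "vec d (iact (pCons c p) v) = c \<cdot>\<^sub>v vec d v + A *\<^sub>v vec d ?w"
      using A by (intro eq_vecI) (auto simp: act_pCons fv_def fun_eq_iff split: if_splits)
    moreover have "vec d v \<in> L" unfolding L_def using gens(1) by simp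
    ultimately show ?case using L_add L_smult L_phi pCons.IH by simp
  qed
  then have all: "x \<in> L" if "x \<in> carrier_vec d" for x
    using assms fv_simps(4)[of x] vec_fv[OF that] unfolding cyclic_vector_def by metis
  have inv_t: "inv\<^bsub>T\<^esub> (0\<^sub>v d, 1) = (0\<^sub>v d, - 1)"
    by (rule T.inv_equality) (simp_all add: mult_T P(5) one_T carrier_T)
  have "(x, m) \<in> H" if x: "x \<in> carrier_vec d" for x m
  proof (induction m rule: int_induct[where k = 0])
    case base
    then show ?case using all[OF x] unfolding L_def by simp
  next
    case (step1 i)
    then show ?case using subgroup.m_closed[OF H step1(2) gens(2)] x by (simp add: mult_T P(5))
  next
    case (step2 i)
    then show ?case
      using subgroup.m_closed[OF H step2(2) subgroup.m_inv_closed[OF H gens(2)]] x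
      by (simp add: mult_T P(5) inv_t)
  qed
  then have "generate T S = carrier T"
    using T.generate_incl[OF S] unfolding H_def by (auto simp: carrier_T)
  moreover have "card S = 2" unfolding S_def by simp
  ultimately show ?thesis unfolding rank_two using S by (metis card.infinite zero_neq_numeral)
qed

lemma generate_pair_mono:
  assumes "generate T {x, y} = carrier T" "x \<in> generate T S" "y \<in> generate T S" "S \<subseteq> carrier T"
  shows "generate T S = carrier T"
  using T.generate_subgroup_incl[of "{x, y}" "generate T S"] T.generate_is_subgroup[OF assms(4)]
    T.generate_incl[OF assms(4)] assms(1-3) by auto

text \<open>Nielsen moves: replacing \<open>x\<close> by its product with \<open>y\<close> or with
  the inverse of \<open>y\<close> preserves generation. Choosing by the signs, and changing the
  element with the larger exponent, lowers the sum of the absolute exponents while both are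
  nonzero.\<close>

lemma normalized_generators:
  assumes "x \<in> carrier T" "y \<in> carrier T" "generate T {x, y} = carrier T"
  shows "\<exists>x y. x \<in> carrier T \<and> y \<in> carrier T \<and> generate T {x, y} = carrier T \<and> snd y = 0"
  using assms
proof (induction "nat \<bar>snd x\<bar> + nat \<bar>snd y\<bar>" arbitrary: x y rule: less_induct)
  case less
  have snd_mult: "snd (x \<otimes>\<^bsub>T\<^esub> y) = snd x + snd y" for x y by (cases x; cases y) (simp add: mult_T)
  have snd_inv: "snd (inv\<^bsub>T\<^esub> x) = - snd x" if "x \<in> carrier T" for x
    using snd_mult[of "inv\<^bsub>T\<^esub> x" x] T.l_inv[OF that] by (simp add: one_T)
  have mult: "generate T {x \<otimes>\<^bsub>T\<^esub> y, y} = carrier T"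
    if "x \<in> carrier T" "y \<in> carrier T" "generate T {x, y} = carrier T" for x y
  proof (rule generate_pair_mono[OF that(3)])
    have "x = (x \<otimes>\<^bsub>T\<^esub> y) \<otimes>\<^bsub>T\<^esub> inv\<^bsub>T\<^esub> y" using that by (simp add: T.m_assoc)
    then show "x \<in> generate T {x \<otimes>\<^bsub>T\<^esub> y, y}"
      by (metis generate.eng generate.incl generate.inv insertI1 insertI2)
  qed (use that in \<open>auto intro: generate.incl\<close>)
  have div: "generate T {x \<otimes>\<^bsub>T\<^esub> inv\<^bsub>T\<^esub> y, y} = carrier T"
    if "x \<in> carrier T" "y \<in> carrier T" "generate T {x, y} = carrier T" for x y
  proof (rule generate_pair_mono[OF that(3)])
    have "x = (x \<otimes>\<^bsub>T\<^esub> inv\<^bsub>T\<^esub> y) \<otimes>\<^bsub>T\<^esub> y" using that by (simp add: T.m_assoc)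
    then show "x \<in> generate T {x \<otimes>\<^bsub>T\<^esub> inv\<^bsub>T\<^esub> y, y}"
      by (metis generate.eng generate.incl insertI1 insertI2)
  qed (use that in \<open>auto intro: generate.incl\<close>)
  have step: ?case if "\<bar>snd v\<bar> \<le> \<bar>snd u\<bar>" "snd v \<noteq> 0" "u \<in> carrier T" "v \<in> carrier T"
      "generate T {u, v} = carrier T"
      "nat \<bar>snd u\<bar> + nat \<bar>snd v\<bar> = nat \<bar>snd x\<bar> + nat \<bar>snd y\<bar>" for u v
  proof (cases "sgn (snd u) = sgn (snd v)")
    case True
    have "nat \<bar>snd u - snd v\<bar> < nat \<bar>snd u\<bar>" using that(1,2) True by (auto simp: sgn_if split: if_splits)
    then have "nat \<bar>snd (u \<otimes>\<^bsub>T\<^esub> inv\<^bsub>T\<^esub> v)\<bar> + nat \<bar>snd v\<bar> < nat \<bar>snd x\<bar> + nat \<bar>snd y\<bar>"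
      unfolding snd_mult snd_inv[OF that(4)] add_uminus_conv_diff using that(6) by linarith
    from less.hyps[OF this _ that(4) div[OF that(3-5)]] that(3,4) show ?thesis by simp
  next
    case False
    have "nat \<bar>snd u + snd v\<bar> < nat \<bar>snd u\<bar>" using that(1,2) False by (auto simp: sgn_if split: if_splits)
    then have "nat \<bar>snd (u \<otimes>\<^bsub>T\<^esub> v)\<bar> + nat \<bar>snd v\<bar> < nat \<bar>snd x\<bar> + nat \<bar>snd y\<bar>"
      unfolding snd_mult using that(6) by linarith
    from less.hyps[OF this _ that(4) mult[OF that(3-5)]] that(3,4) show ?thesis by simp
  qed
  have swap: "generate T {y, x} = carrier T" using less.prems(3) by (simp add: insert_commute)
  consider "snd y = 0" | "snd x = 0" | "snd y \<noteq> 0" "\<bar>snd y\<bar> \<le> \<bar>snd x\<bar>" | "snd x \<noteq> 0" "\<bar>snd x\<bar> \<le> \<bar>snd y\<bar>"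
    by linarith
  then show ?case
  proof cases
    case 1
    then show ?thesis using less.prems by blast
  next
    case 2
    then show ?thesis using less.prems swap by blast
  next
    case 3
    then show ?thesis using step[of y x] less.prems by simp
  next
    case 4
    then show ?thesis using step[of x y] less.prems swap by simp
  qed
qed

text \<open>Let \<open>y = (b, 0)\<close> and let \<open>K\<close> be the module spanned by all
  \<open>P m b\<close>, a normal subgroup. The product of \<open>K\<close> and the powers of
  \<open>x\<close> contains both generators, so it is the whole torus; since \<open>snd x\<close> is
  nonzero, a vector in it involves the trivial power of \<open>x\<close> and lies in
  \<open>K\<close>.\<close>

lemma cyclic_if_rank_two:
  assumes "group_rank T = 2"
  shows "\<exists>v. cyclic_vector d A v"
proof -
  obtain S where S: "S \<subseteq> carrier T" "card S = 2" "generate T S = carrier T" using assms unfolding rank_two by blast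
  then obtain x y where "S = {x, y}" by (meson card_2_iff)
  then obtain x y where xy: "x \<in> carrier T" "y \<in> carrier T" "generate T {x, y} = carrier T" "snd y = 0"
    using normalized_generators[of x y] S by auto
  obtain b where y: "y = (b, 0)" "b \<in> carrier_vec d" using xy(2,4) by (cases y) (auto simp: carrier_T)
  \<comment> \<open>The module generated by \<open>b\<close> over Laurent polynomials, expressed
    with nonnegative powers: some power of \<open>A\<close> carries \<open>w\<close> into the span
    of the iterates of \<open>b\<close>.\<close>
  define N where "N = {w. w \<in> carrier_vec d \<and> (\<exists>t r. iact (monom 1 t) (fv w) = iact r (fv b))}"
  have act_neg: "iact p (\<lambda>i. - v i) = (\<lambda>i. - iact p v i)" for p v
    using act_vec_scale[of d "mat_fun d A" p "- 1" v] by simp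
  have N_phi: "A *\<^sub>v w \<in> N \<longleftrightarrow> w \<in> N" if w: "w \<in> carrier_vec d" for w
  proof -
    have fA: "fv (A *\<^sub>v w) = iact [:0, 1:] (fv w)" unfolding fv_mult[OF w] by (simp add: act_pCons apply_mat_linear)
    have 1: "\<exists>t r. iact (monom 1 t) (fv (A *\<^sub>v w)) = iact r (fv b)" if "iact (monom 1 t) (fv w) = iact r (fv b)" for t r
    proof -
      have "iact (monom 1 t) (fv (A *\<^sub>v w)) = iact [:0, 1:] (iact (monom 1 t) (fv w))"
        unfolding fA act_mult[symmetric] by (simp only: mult.commute)
      then show ?thesis unfolding that act_mult[symmetric] by blast
    qed
    have 2: "\<exists>t r. iact (monom 1 t) (fv w) = iact r (fv b)" if "iact (monom 1 t) (fv (A *\<^sub>v w)) = iact r (fv b)" for t r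
    proof -
      have "iact (monom 1 (Suc t)) (fv w) = iact (monom 1 t) (fv (A *\<^sub>v w))"
        unfolding fA act_mult[symmetric] by (simp add: monom_Suc mult.commute)
      then show ?thesis unfolding that by blast
    qed
    have "A *\<^sub>v w \<in> carrier_vec d" using A w by simp
    then show ?thesis unfolding N_def using w 1 2 by blast
  qed
  have N_P: "P m w \<in> N" if w: "w \<in> N" for m w
  proof -
    have wc: "w \<in> carrier_vec d" using w unfolding N_def by simp
    show ?thesis
    proof (induction m rule: int_induct[where k = 0])
      case base
      show ?case using w P(3)[OF wc] by simp
    next
      case (step1 i)
      have "P (i + 1) w = A *\<^sub>v P i w" using P(2)[OF wc, of 1 i] P(4)[OF P(1)[OF wc]] by (simp add: add.commute)
      then show ?case using step1(2) N_phi[OF P(1)[OF wc]] by simp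
    next
      case (step2 i)
      have "P i w = A *\<^sub>v P (i - 1) w" using P(2)[OF wc, of 1 "i - 1"] P(4)[OF P(1)[OF wc]] by simp
      then show ?case using step2(2) N_phi[OF P(1)[OF wc]] by simp
    qed
  qed
  have N_add: "u + w \<in> N" if N: "u \<in> N" "w \<in> N" for u w
  proof -
    obtain s p t r where *: "iact (monom 1 s) (fv u) = iact p (fv b)" "iact (monom 1 t) (fv w) = iact r (fv b)"
      and uw: "u \<in> carrier_vec d" "w \<in> carrier_vec d"
      using N unfolding N_def by blast
    have m: "monom (1 :: int) (s + t) = monom 1 t * monom 1 s" "monom (1 :: int) (s + t) = monom 1 s * monom 1 t"
      by (simp_all add: mult_monom add.commute)
    have "iact (monom 1 (s + t)) (fv u) = iact (monom 1 t * p) (fv b)" unfolding m(1) act_mult *(1) ..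
    moreover have "iact (monom 1 (s + t)) (fv w) = iact (monom 1 s * r) (fv b)" unfolding m(2) act_mult *(2) ..
    ultimately have "iact (monom 1 (s + t)) (fv (u + w)) = iact (monom 1 t * p + monom 1 s * r) (fv b)"
      unfolding fv_simps(1)[OF uw] act_vec_add act_add by simp
    then show ?thesis unfolding N_def using add_carrier_vec[OF uw] by blast
  qed
  have N_uminus: "- w \<in> N" if N: "w \<in> N" for w
  proof -
    obtain t r where *: "iact (monom 1 t) (fv w) = iact r (fv b)" and w: "w \<in> carrier_vec d"
      using N unfolding N_def by blast
    have "iact (monom 1 t) (fv (- w)) = iact (- r) (fv b)"
      unfolding fv_simps(2)[OF w] act_neg * using act_smult[of d "mat_fun d A" "- 1" r "fv b"] by simp
    then show ?thesis unfolding N_def using w by auto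
  qed
  have N_0: "0\<^sub>v d \<in> N" unfolding N_def by (auto simp: fv_simps(3) intro!: exI[of _ 0])
  have N_b: "b \<in> N" unfolding N_def using y(2) by auto
  have Nc: "w \<in> carrier_vec d" if "w \<in> N" for w using that unfolding N_def by simp
  define K where "K = N \<times> {0 :: int}"
  have "subgroup K T"
  proof (rule T.subgroupI)
    show "K \<subseteq> carrier T" unfolding K_def by (auto simp: carrier_T Nc)
    show "K \<noteq> {}" unfolding K_def using N_0 by blast
    show "inv\<^bsub>T\<^esub> z \<in> K" if "z \<in> K" for z
      using that unfolding K_def by (auto simp: inv_T_0 Nc N_uminus)
    show "z \<otimes>\<^bsub>T\<^esub> z' \<in> K" if "z \<in> K" "z' \<in> K" for z z'
      using that unfolding K_def by (auto simp: mult_T P(3) Nc N_add simp del: int_pow_0)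
  qed
  then have normal: "K \<lhd> T"
    unfolding T.normal_inv_iff K_def by (auto simp: carrier_T conj_T Nc N_P)
  have C: "subgroup (generate T {x}) T" using xy(1) by (intro T.generate_is_subgroup) simp
  have KC: "subgroup (K <#>\<^bsub>T\<^esub> generate T {x}) T" by (rule T.mult_norm_subgroup[OF normal C])
  have "x \<in> K <#>\<^bsub>T\<^esub> generate T {x}"
  proof -
    have "x = \<one>\<^bsub>T\<^esub> \<otimes>\<^bsub>T\<^esub> x" using xy(1) by simp
    moreover have "\<one>\<^bsub>T\<^esub> \<in> K" unfolding K_def one_T using N_0 by simp
    moreover have "x \<in> generate T {x}" by (auto intro: generate.incl)
    ultimately show ?thesis unfolding set_mult_def by blast
  qed
  moreover have "y \<in> K <#>\<^bsub>T\<^esub> generate T {x}"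
  proof -
    have "y = y \<otimes>\<^bsub>T\<^esub> \<one>\<^bsub>T\<^esub>" using xy(2) by simp
    moreover have "y \<in> K" unfolding K_def y using N_b by simp
    moreover have "\<one>\<^bsub>T\<^esub> \<in> generate T {x}" by (rule generate.one)
    ultimately show ?thesis unfolding set_mult_def by blast
  qed
  ultimately have "carrier T \<subseteq> K <#>\<^bsub>T\<^esub> generate T {x}"
    using T.generate_subgroup_incl[OF _ KC, of "{x, y}"] xy(3) by auto
  then have decomp: "\<exists>w k. w \<in> N \<and> z = (w, 0) \<otimes>\<^bsub>T\<^esub> x [^]\<^bsub>T\<^esub> (k :: int)" if "z \<in> carrier T" for z
    using that unfolding set_mult_def T.generate_pow[OF xy(1)] K_def by fastforce
  have snd_mult: "snd (u \<otimes>\<^bsub>T\<^esub> v) = snd u + snd v" for u v by (cases u; cases v) (simp add: mult_T)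
  \<comment> \<open>Otherwise no element of the torus would have exponent 1.\<close>
  have "snd x \<noteq> 0"
  proof
    assume "snd x = 0"
    obtain w k where "(0\<^sub>v d, 1) = (w, 0) \<otimes>\<^bsub>T\<^esub> x [^]\<^bsub>T\<^esub> (k :: int)"
      using decomp[of "(0\<^sub>v d, 1)"] by (auto simp: carrier_T)
    from arg_cong[OF this, of snd] show False
      unfolding snd_mult snd_pow[OF xy(1)] by (simp add: \<open>snd x = 0\<close>)
  qed
  have all: "u \<in> N" if u: "u \<in> carrier_vec d" for u
  proof -
    obtain w k where w: "w \<in> N" "(u, 0) = (w, 0) \<otimes>\<^bsub>T\<^esub> x [^]\<^bsub>T\<^esub> (k :: int)"
      using decomp[of "(u, 0)"] u by (auto simp: carrier_T)
    have "k * snd x = 0" using arg_cong[OF w(2), of snd] unfolding snd_mult snd_pow[OF xy(1)] by simp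
    then have "k = 0" using \<open>snd x \<noteq> 0\<close> by simp
    then have "x [^]\<^bsub>T\<^esub> k = (0\<^sub>v d, 0)" by (simp add: one_T)
    then have "(u, 0) = (w, 0 :: int)" using w Nc by (simp add: mult_T P(5) del: int_pow_0)
    then show ?thesis using w(1) by simp
  qed
  have "\<exists>t r. iact (monom 1 t) (delta k) = iact r (fv b)" if "k < d" for k
  proof -
    have "vec d (delta k) \<in> N" by (rule all) simp
    then show ?thesis unfolding N_def using fv_simps(5)[OF supported_delta[OF that]] by simp
  qed
  then obtain t r where tr: "\<And>k. k < d \<Longrightarrow> iact (monom 1 (t k)) (delta k) = iact (r k) (fv b)" by metis
  \<comment> \<open>A common power that works for all basis vectors. It is removed in the end, since
    the powers of the invertible \<open>A\<close> are surjective.\<close>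
  define M where "M = (\<Sum>k<d. t k)"
  have M: "iact (monom 1 M) (delta k) = iact (monom 1 (M - t k) * r k) (fv b)" if "k < d" for k
  proof -
    have "t k \<le> M" unfolding M_def using that by (intro member_le_sum) auto
    then have "monom (1 :: int) M = monom 1 (M - t k) * monom 1 (t k)" by (simp add: mult_monom)
    then show ?thesis unfolding act_mult by (simp only: act_mult tr[OF that])
  qed
  have surj: "\<exists>u. supported d u \<and> iact (monom 1 n) u = w" if "supported d w" for w n
    using that
  proof (induction n arbitrary: w)
    case 0
    then show ?case by (auto simp: monom_0 act_const)
  next
    case (Suc n)
    have c: "vec d w \<in> carrier_vec d" by simp
    have "A *\<^sub>v P (- 1) (vec d w) = vec d w"
      using P(2)[OF c, of 1 "- 1"] P(4)[OF P(1)[OF c]] P(3)[OF c] by simp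
    then have "apply_mat d (mat_fun d A) (fv (P (- 1) (vec d w))) = w"
      using fv_mult[OF P(1)[OF c]] fv_simps(5)[OF Suc.prems] by metis
    moreover obtain u where u: "supported d u" "iact (monom 1 n) u = fv (P (- 1) (vec d w))"
      using Suc.IH[OF fv_simps(4)] by blast
    ultimately have "iact (monom 1 (Suc n)) u = w" by (simp add: monom_Suc act_pCons)
    then show ?case using u(1) by blast
  qed
  have "\<exists>p. iact p (fv b) = w" if w: "supported d w" for w
  proof -
    obtain u where u: "supported d u" "iact (monom 1 M) u = w" using surj[OF w] by blast
    have "w = iact (monom 1 M) (\<lambda>i. \<Sum>k<d. u k * delta k i)"
      using u(2) supported_expand[OF u(1)] by simp
    also have "\<dots> = (\<lambda>i. \<Sum>k<d. u k * iact (monom 1 (M - t k) * r k) (fv b) i)"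
      unfolding act_vec_sum act_vec_scale using M by simp
    also have "\<dots> = iact (\<Sum>k<d. smult (u k) (monom 1 (M - t k) * r k)) (fv b)"
      unfolding act_sum act_smult ..
    finally show ?thesis by metis
  qed
  then have "cyclic_vector d A (fv b)" unfolding cyclic_vector_def using fv_simps(4) by blast
  then show ?thesis by blast
qed

end

section \<open>The decision procedure\<close>

text \<open>Row 0 of \<open>w\<close> is the candidate generator, and the recurrence makes the later
  rows its iterates; \<open>c\<close> combines them to the basis. All quantifiers and sums are
  bounded, so the check is decidable.\<close>

definition certificate :: "nat \<Rightarrow> nat \<Rightarrow> nat \<Rightarrow> nat \<Rightarrow> bool" where
  "certificate d e w c \<longleftrightarrow>
    (\<forall>i<d. \<forall>l<d. entry_code w (Suc i) l = (\<Sum>m<d. entry_code e l m * entry_code w i m)) \<and>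
    (\<forall>k<d. \<forall>l<d. (\<Sum>i<d. entry_code c k i * entry_code w i l) = int (if k = l then 1 else 0))"

text \<open>The parameters occur below up to three bound variables, each of which adds one
  \<open>drop 1\<close>; \<open>var0\<close>, \<open>var1\<close> and \<open>var2\<close> are the
  bound variables themselves, seen from increasing depth.\<close>

lemma decidable_certificate:
  assumes "recursive n d" "recursive n e" "recursive n w" "recursive n c"
  shows "decidable n (\<lambda>xs. certificate (d xs) (e xs) (w xs) (c xs))"
proof -
  have drop1: "recursive (Suc n) (\<lambda>xs. f (drop 1 xs))"
    and drop2: "recursive (Suc (Suc n)) (\<lambda>xs. f (drop 1 (drop 1 xs)))"
    and drop3: "recursive (Suc (Suc (Suc n))) (\<lambda>xs. f (drop 1 (drop 1 (drop 1 xs))))"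
    if f: "recursive n f" for f
  proof -
    show 1: "recursive (Suc n) (\<lambda>xs. f (drop 1 xs))" by (rule recursive_drop[OF f]) simp
    show 2: "recursive (Suc (Suc n)) (\<lambda>xs. f (drop 1 (drop 1 xs)))" by (rule recursive_drop[OF 1]) simp
    show "recursive (Suc (Suc (Suc n))) (\<lambda>xs. f (drop 1 (drop 1 (drop 1 xs))))" by (rule recursive_drop[OF 2]) simp
  qed
  have var0: "recursive (Suc m) (\<lambda>xs. xs ! 0)" for m by (rule recursive_proj) simp
  have var1: "recursive (Suc (Suc m)) (\<lambda>xs. drop 1 xs ! 0)" for m by (rule recursive_drop[OF var0]) simp
  have var2: "recursive (Suc (Suc (Suc m))) (\<lambda>xs. drop 1 (drop 1 xs) ! 0)" for m
    by (rule recursive_drop[OF var1]) simp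
  note drops = assms[THEN drop1] assms[THEN drop2] assms[THEN drop3]
  show ?thesis
    unfolding certificate_def
    by (intro decidable_conj decidable_all decidable_int_eq recursive_int_sum recursive_int_mult
        recursive_entry_code recursive_int_of_nat recursive_if decidable_eq recursive_Suc recursive_const
        assms drops var0 var1 var2)
qed

lemma recursive_certificate_bound:
  assumes "recursive n f" "recursive n g"
  shows "recursive n (\<lambda>xs. certificate_bound (f xs) (g xs))"
proof -
  have sol: "recursive n (\<lambda>xs. solution_bound (f xs) (h xs))" if "recursive n h" for h
    unfolding solution_bound_def Let_def
    by (intro recursive_mult recursive_add recursive_power recursive_const assms that)
  have unit: "recursive n (\<lambda>xs. unit_bound (f xs) (h xs))" if "recursive n h" for h
    unfolding unit_bound_def Let_def
    by (intro recursive_mult recursive_add recursive_power recursive_fact recursive_const assms that)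
  show ?thesis
    unfolding certificate_bound_def
    by (intro sol unit recursive_mult recursive_power recursive_const assms)
qed

lemma mat_encode_eq_table_code:
  assumes "A \<in> carrier_mat d d"
  shows "mat_encode A = table_code d d (\<lambda>i j. A $$ (i, j))"
  using assms unfolding mat_encode_def table_code_def mat_to_list_def by (simp add: comp_def)

text \<open>Lets the code of the matrix serve as bound on its entries, so that the search bound is
  computed from the input alone.\<close>

lemma entry_le_table_code:
  assumes "i < m" "j < n"
  shows "\<bar>a i j\<bar> \<le> int (table_code m n a)"
proof -
  have elem: "x \<le> list_encode xs" if "x \<in> set xs" for x xs
    using that
  proof (induction xs)
    case (Cons y ys)
    then show ?case using le_prod_encode_1[of y "list_encode ys"] le_prod_encode_2[of "list_encode ys" y]
      by (auto intro: le_SucI order.trans)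
  qed simp
  have "\<bar>a i j\<bar> \<le> int (int_encode (a i j))" by (auto simp: int_encode_def sum_encode_def)
  also have "int_encode (a i j) \<le> list_encode (map (\<lambda>j. int_encode (a i j)) [0..<n])"
    using assms(2) by (intro elem) auto
  also have "\<dots> \<le> table_code m n a"
    unfolding table_code_def using assms(1) by (intro elem) auto
  finally show ?thesis by simp
qed

text \<open>From left to right, the coded combinations yield every basis vector. From right to left,
  \<open>bounded_certificate\<close> applies with \<open>H = Suc (mat_encode A)\<close>: the code
  majorises the entries, and \<open>Suc\<close> ensures \<open>1 \<le> H\<close>.\<close>

lemma certificate_iff_cyclic:
  assumes A: "A \<in> carrier_mat d d" and d: "0 < d"
  defines "B \<equiv> certificate_bound d (Suc (mat_encode A))"
  shows "(\<exists>w<Suc (list_code_bound (list_code_bound (2 * B + 1) d) (Suc d)).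
      \<exists>c<Suc (list_code_bound (list_code_bound (2 * B + 1) d) d). certificate d (mat_encode A) w c)
    \<longleftrightarrow> (\<exists>v. cyclic_vector d A v)" (is "?L \<longleftrightarrow> ?R")
proof
  have e: "entry_code (mat_encode A) i j = A $$ (i, j)" if "i < d" "j < d" for i j
    using that unfolding mat_encode_eq_table_code[OF A] by (rule entry_table_code)
  {
    assume ?L
    then obtain w c where wc: "certificate d (mat_encode A) w c" by blast
    define v where "v l = (if l < d then entry_code w 0 l else 0)" for l
    have v: "supported d v" unfolding v_def supported_def by simp
    have w: "(apply_mat d (mat_fun d A) ^^ i) v l = entry_code w i l" if "i \<le> d" "l < d" for i l
      using that
    proof (induction i arbitrary: l)
      case 0
      then show ?case by (simp add: v_def)
    next
      case (Suc i)
      have "entry_code w (Suc i) l = (\<Sum>m<d. entry_code (mat_encode A) l m * entry_code w i m)"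
        using wc Suc.prems unfolding certificate_def by simp
      also have "\<dots> = (\<Sum>m<d. mat_fun d A l m * (apply_mat d (mat_fun d A) ^^ i) v m)"
      proof (intro sum.cong refl)
        fix m
        assume "m \<in> {..<d}"
        then have m: "m < d" by simp
        then have "mat_fun d A l m = A $$ (l, m)" using Suc.prems(2) by (simp add: mat_fun_def)
        then show "entry_code (mat_encode A) l m * entry_code w i m
            = mat_fun d A l m * (apply_mat d (mat_fun d A) ^^ i) v m"
          using Suc.IH[OF _ m] Suc.prems e[OF Suc.prems(2) m] by simp
      qed
      finally show ?case by (simp add: apply_mat_def[of d _ "(apply_mat d (mat_fun d A) ^^ i) v"])
    qed
    have "\<exists>r. act d (mat_fun d A) r v = u" if u: "supported d u" for u
    proof -
      define r where "r = (\<Sum>k<d. smult (u k) (\<Sum>i<d. monom (entry_code c k i) i))"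
      have "act d (mat_fun d A) r v l = u l" for l
      proof (cases "l < d")
        case True
        have "act d (mat_fun d A) r v l = (\<Sum>k<d. u k * (\<Sum>i<d. entry_code c k i * entry_code w i l))"
          unfolding r_def act_sum act_smult act_funpow using w True by simp
        also have "\<dots> = (\<Sum>k<d. u k * delta k l)"
          using wc True unfolding certificate_def by (intro sum.cong) (auto simp: delta_def)
        also have "\<dots> = u l" using fun_cong[OF supported_expand[OF u], of l] by simp
        finally show ?thesis .
      next
        case False
        then show ?thesis using u supported_act[OF v, of A r] unfolding supported_def by simp
      qed
      then show ?thesis by blast
    qed
    then show ?R unfolding cyclic_vector_def using v by blast
  }
  assume ?R
  then obtain v where v: "cyclic_vector d A v" ..
  interpret bounded_matrix d A "Suc (mat_encode A)"
  proof
    show "\<bar>A $$ (i, j)\<bar> \<le> int (Suc (mat_encode A))" if "i < d" "j < d" for i j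
      using entry_le_table_code[OF that, of "\<lambda>i j. A $$ (i, j)"] unfolding mat_encode_eq_table_code[OF A] by simp
  qed (use A d in auto)
  obtain w c where wc: "\<forall>i<d. \<forall>l<d. w (Suc i) l = (\<Sum>m<d. A $$ (l, m) * w i m)"
    "\<forall>k<d. \<forall>l<d. (\<Sum>i<d. c k i * w i l) = delta k l"
    "\<forall>i\<le>d. \<forall>l<d. \<bar>w i l\<bar> \<le> int B" "\<forall>k<d. \<forall>i<d. \<bar>c k i\<bar> \<le> int B"
    using bounded_certificate[OF v, folded B_def] by (elim exE conjE) (rule that)
  let ?w = "table_code (Suc d) d w" and ?c = "table_code d d c"
  have "certificate d (mat_encode A) ?w ?c"
    unfolding certificate_def using wc(1,2) by (auto simp: entry_table_code e delta_def)
  moreover have "?w < Suc (list_code_bound (list_code_bound (2 * B + 1) d) (Suc d))"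
    unfolding less_Suc_eq_le using wc(3) by (intro table_code_le) auto
  moreover have "?c < Suc (list_code_bound (list_code_bound (2 * B + 1) d) d)"
    unfolding less_Suc_eq_le using wc(4) by (intro table_code_le) auto
  ultimately show ?L by blast
qed

theorem theorem1p1:
  shows "\<exists>p. \<forall>(d::nat) (\<phi>::int mat). d \<ge> 1 \<longrightarrow> \<phi> \<in> GL_int d \<longrightarrow>
    computes p [d, mat_encode \<phi>]
      (if group_rank (mapping_torus (int_vec_group d) (mat_auto d \<phi>)) = 2 then 1 else 0)"
proof -
  define B where "B xs = certificate_bound (xs ! 0) (Suc (xs ! 1))" for xs :: "nat list"
  define L where "L xs = list_code_bound (2 * B xs + 1) (xs ! 0)" for xs :: "nat list"
  define P where "P xs \<longleftrightarrow> (\<exists>w<Suc (list_code_bound (L xs) (Suc (xs ! 0))).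
    \<exists>c<Suc (list_code_bound (L xs) (xs ! 0)). certificate (xs ! 0) (xs ! 1) w c)" for xs :: "nat list"
  have L: "recursive 2 L"
    unfolding L_def B_def
    by (intro recursive_list_code_bound recursive_add recursive_mult recursive_certificate_bound
        recursive_Suc recursive_const recursive_proj) simp_all
  have bounds: "recursive 2 (\<lambda>xs. Suc (list_code_bound (L xs) (Suc (xs ! 0))))"
    "recursive 2 (\<lambda>xs. Suc (list_code_bound (L xs) (xs ! 0)))"
    by (intro recursive_Suc recursive_list_code_bound L recursive_proj; simp)+
  \<comment> \<open>Under the first quantifier one witness precedes the input, under the second two;
    hence one and two applications of \<open>drop 1\<close>.\<close>
  have "recursive (Suc 2) (\<lambda>ys. Suc (list_code_bound (L (drop 1 ys)) (drop 1 ys ! 0)))"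
    by (rule recursive_drop[OF bounds(2)]) simp
  moreover have "recursive (Suc (Suc 2)) (\<lambda>zs. zs ! 0)" by (rule recursive_proj) simp
  moreover have "recursive (Suc (Suc 2)) (\<lambda>zs. drop 1 zs ! 0)" by (rule recursive_proj_drop) simp
  moreover have "recursive (Suc (Suc 2)) (\<lambda>zs. drop 1 (drop 1 zs) ! 0)"
    "recursive (Suc (Suc 2)) (\<lambda>zs. drop 1 (drop 1 zs) ! 1)"
    unfolding drop_drop by (rule recursive_proj_drop; simp)+
  ultimately have "decidable 2 P"
    unfolding P_def by (intro decidable_ex decidable_certificate bounds(1))
  then obtain p where p: "\<And>xs. length xs = 2 \<Longrightarrow> computes p xs (if P xs then 1 else 0)"
    unfolding decidable_def recursive_def by blast
  have "P [d, mat_encode \<phi>] \<longleftrightarrow> group_rank (mapping_torus (int_vec_group d) (mat_auto d \<phi>)) = 2"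
    if "d \<ge> 1" "\<phi> \<in> GL_int d" for d \<phi>
  proof -
    interpret integral_torus d \<phi> using that by unfold_locales auto
    have "P [d, mat_encode \<phi>] \<longleftrightarrow> (\<exists>v. cyclic_vector d \<phi> v)"
      unfolding P_def L_def B_def using certificate_iff_cyclic[OF A d] by simp
    then show ?thesis using rank_two_if_cyclic cyclic_if_rank_two by blast
  qed
  then have "computes p [d, mat_encode \<phi>]
      (if group_rank (mapping_torus (int_vec_group d) (mat_auto d \<phi>)) = 2 then 1 else 0)"
    if "d \<ge> 1" "\<phi> \<in> GL_int d" for d \<phi>
    using p[of "[d, mat_encode \<phi>]"] that by simp
  then show ?thesis by blast
qed

end
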